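(* Let $A$ be a von Neumann algebra, $a\in A_{sa}$, $r,s\in\mathbb{R}$ with $s<r$, $\Delta=(s,r)$, and $\epsilon>0$. Put $$\hat{\Delta}=\mathcal{C}\times[-\infty,r)\times(s,+\infty],\qquad \hat{\Delta}+\epsilon=\mathcal{C}\times[-\infty,r+\epsilon)\times(s-\epsilon,+\infty],$$ regarded as open subsets of $\mathcal{C}_{\downarrow}\times\mathbb{R}_u\times\mathbb{R}_l$. Then $$\delta(a)^{-1}(\hat{\Delta})\subseteq[a<r]\cap[a>s]\subseteq\delta(a)^{-1}(\hat{\Delta}+\epsilon).$$
   Context: $A_{sa}$ denotes the self-adjoint elements of the von Neumann algebra $A$. $\mathcal{C}$ is the poset (under inclusion) of abelian von Neumann subalgebras $C\subseteq A$ (containing the unit of $A$), called contexts. $\mathcal{C}_{\downarrow}$ is $\mathcal{C}$ with the Alexandroff topology whose opens are the downward closed subsets. $\Sigma_C$ is the Gelfand spectrum of $C$ (multiplicative linear functionals $\lambda:C\to\mathbb{C}$), $\langle\lambda,c\rangle=\lambda(c)$. $\Sigma=\coprod_{C\in\mathcal{C}}\Sigma_C$, with elements $(C,\lambda)$, $\lambda\in\Sigma_C$. Spectral order: for $a,b\in A_{sa}$ with spectral resolutions $(e^a_x)_{x\in\mathbb R}$, $(e^b_x)_{x\in\mathbb R}$, $a\leq_s b$ iff $e^a_x\geq e^b_x$ for all $x\in\mathbb{R}$. $A_{sa}$ is a boundedly complete lattice for $\leq_s$, and on $C_{sa}$ the order $\leq_s$ coincides with the usual order. Daseinisation: $\delta^o(a)_C=\bigwedge\{b\in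 C_{sa}\mid b\geq_s a\}$ and $\delta^i(a)_C=\bigvee\{b\in C_{sa}\mid b\leq_s a\}$. For a projection $p\in A$, $\delta^o(p)_C=\bigwedge\{q\in \mathrm{Proj}(C)\mid q\geq p\}$. $\mathbb{R}_l$ is the extended real line with topology generated by the sets $(y,+\infty]$; $\mathbb{R}_u$ is the extended real line with topology generated by the sets $[-\infty,y)$ ($y\in\mathbb{R}$). The map $\delta(a):\Sigma\to\mathcal{C}\times\mathbb{R}_u\times\mathbb{R}_l$ is $\delta(a)(C,\lambda)=(C,\langle\lambda,\delta^i(a)_C\rangle,\langle\lambda,\delta^o(a)_C\rangle)$. For $\Delta'\subseteq\mathbb{R}$ open, with spectral projection $\chi_{\Delta'}(a)$, $[a\in\Delta']=\{(C,\lambda)\in\Sigma\mid\langle\lambda,\delta^o(\chi_{\Delta'}(a))_C\rangle=1\}$; moreover $[a<r]:=[a\in(-\infty,r)]$ and $[a>s]:=[a\in(s,+\infty)]$. *)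

theory Defs
  imports "HOL-Algebra.Lattice" "HOL-Analysis.Analysis"
begin

hide_const (open) Lattice.inf Lattice.sup Lattice.join Lattice.meet Order.top Order.bottom

text \<open>A complex Hilbert space is presented as a complete real inner product space (which provides
  norm, topology and the Banach space of bounded real-linear operators) together with a complex
  scalar multiplication extending the real one and a complex inner product, antilinear in the
  first argument, whose real part is the given real inner product.\<close>

class chilbert_space = real_inner + complete_space +
  fixes scaleC :: "complex \<Rightarrow> 'a \<Rightarrow> 'a" (infixr \<open>*\<^sub>C\<close> 75)
    and cinner :: "'a \<Rightarrow> 'a \<Rightarrow> complex"
  assumes scaleC_add_right: "c *\<^sub>C (x + y) = c *\<^sub>C x + c *\<^sub>C y"
    and scaleC_add_left: "(c + d) *\<^sub>C x = c *\<^sub>C x + d *\<^sub>C x"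
    and scaleC_scaleC: "c *\<^sub>C d *\<^sub>C x = (c * d) *\<^sub>C x"
    and scaleC_of_real: "complex_of_real t *\<^sub>C x = t *\<^sub>R x"
    and cinner_commute: "cinner x y = cnj (cinner y x)"
    and cinner_add_right: "cinner x (y + z) = cinner x y + cinner x z"
    and cinner_scaleC_right: "cinner x (c *\<^sub>C y) = c * cinner x y"
    and Re_cinner: "Re (cinner x y) = inner x y"

lemma cinner_scaleC_left:
  fixes x y :: "'h::chilbert_space"
  shows "cinner (c *\<^sub>C x) y = cnj c * cinner x y"
  by (metis cinner_commute cinner_scaleC_right complex_cnj_mult)

lemma norm_scaleC:
  fixes x :: "'h::chilbert_space"
  shows "norm (c *\<^sub>C x) = cmod c * norm x"
proof -
  have "cinner (c *\<^sub>C x) (c *\<^sub>C x) = complex_of_real ((cmod c)\<^sup>2) * cinner x x"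
    by (simp only: cinner_scaleC_left cinner_scaleC_right complex_norm_square mult_ac)
  then have "inner (c *\<^sub>C x) (c *\<^sub>C x) = (cmod c)\<^sup>2 * inner x x"
    unfolding Re_cinner[symmetric] by simp
  then show ?thesis
    by (simp add: norm_eq_sqrt_inner real_sqrt_mult)
qed

type_synonym 'h op = "'h \<Rightarrow>\<^sub>L 'h"

definition bounded_ops :: "'h::chilbert_space op set" where
  "bounded_ops = {T :: 'h op. \<forall>c x. T (c *\<^sub>C x) = c *\<^sub>C T x}"

definition cscale_op :: "complex \<Rightarrow> 'h::chilbert_space op \<Rightarrow> 'h op" where
  "cscale_op c T = Blinfun (\<lambda>x. c *\<^sub>C T x)"

lemma cscale_op_apply: "cscale_op c T x = c *\<^sub>C T x"
proof -
  have lin: "bounded_linear (\<lambda>y :: 'a. c *\<^sub>C y)"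
  proof (rule bounded_linear_intro)
    show "c *\<^sub>C (y + z) = c *\<^sub>C y + c *\<^sub>C z" for y z :: 'a
      by (rule scaleC_add_right)
    show "c *\<^sub>C (t *\<^sub>R y) = t *\<^sub>R (c *\<^sub>C y)" for t and y :: 'a
      by (simp only: scaleC_of_real[symmetric] scaleC_scaleC mult.commute)
    show "norm (c *\<^sub>C y) \<le> norm y * cmod c" for y :: 'a
      by (simp add: norm_scaleC)
  qed
  have "bounded_linear (\<lambda>x. c *\<^sub>C T x)"
    by (rule bounded_linear_compose[OF lin blinfun.bounded_linear_right])
  then show ?thesis
    by (simp add: cscale_op_def bounded_linear_Blinfun_apply)
qed

definition is_adjoint :: "'h::chilbert_space op \<Rightarrow> 'h op \<Rightarrow> bool" where
  "is_adjoint S T \<longleftrightarrow> (\<forall>x y. cinner (T x) y = cinner x (S y))"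

definition self_adjoint :: "'h::chilbert_space op \<Rightarrow> bool" where
  "self_adjoint T \<longleftrightarrow> T \<in> bounded_ops \<and> is_adjoint T T"

definition projection :: "'h::chilbert_space op \<Rightarrow> bool" where
  "projection P \<longleftrightarrow> self_adjoint P \<and> P o\<^sub>L P = P"

definition op_le :: "'h::chilbert_space op \<Rightarrow> 'h op \<Rightarrow> bool" where
  "op_le S T \<longleftrightarrow> (\<forall>x. Re (cinner x (S x)) \<le> Re (cinner x (T x)))"

definition commutant :: "'h::chilbert_space op set \<Rightarrow> 'h op set" where
  "commutant S = {T \<in> bounded_ops. \<forall>U\<in>S. T o\<^sub>L U = U o\<^sub>L T}"

definition star_subalgebra :: "'h::chilbert_space op set \<Rightarrow> bool" where
  "star_subalgebra A \<longleftrightarrow> A \<subseteq> bounded_ops \<and> id_blinfun \<in> A \<and>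
     (\<forall>S\<in>A. \<forall>T\<in>A. S + T \<in> A \<and> S o\<^sub>L T \<in> A) \<and>
     (\<forall>c. \<forall>T\<in>A. cscale_op c T \<in> A) \<and>
     (\<forall>T\<in>A. \<exists>S\<in>A. is_adjoint S T)"

definition von_neumann_algebra :: "'h::chilbert_space op set \<Rightarrow> bool" where
  "von_neumann_algebra A \<longleftrightarrow> star_subalgebra A \<and> commutant (commutant A) = A"

definition sa_part :: "'h::chilbert_space op set \<Rightarrow> 'h op set" where
  "sa_part A = {a \<in> A. self_adjoint a}"

definition Proj :: "'h::chilbert_space op set \<Rightarrow> 'h op set" where
  "Proj A = {p \<in> A. projection p}"

definition contexts :: "'h::chilbert_space op set \<Rightarrow> 'h op set set" where
  "contexts A = {C. C \<subseteq> A \<and> von_neumann_algebra C \<and> (\<forall>S\<in>C. \<forall>T\<in>C. S o\<^sub>L T = T o\<^sub>L S)}"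

text \<open>The requirement that a character is nonzero is expressed by unitality.  Characters are
  made extensional so that they correspond one-to-one to functions on \<open>C\<close>.\<close>

definition gelfand_spectrum :: "'h::chilbert_space op set \<Rightarrow> ('h op \<Rightarrow> complex) set" where
  "gelfand_spectrum C = {l \<in> extensional C.
     (\<forall>S\<in>C. \<forall>T\<in>C. l (S + T) = l S + l T) \<and>
     (\<forall>c. \<forall>T\<in>C. l (cscale_op c T) = c * l T) \<and>
     (\<forall>S\<in>C. \<forall>T\<in>C. l (S o\<^sub>L T) = l S * l T) \<and>
     l id_blinfun = 1}"

definition spectral_presheaf_space ::
    "'h::chilbert_space op set \<Rightarrow> ('h op set \<times> ('h op \<Rightarrow> complex)) set" where
  "spectral_presheaf_space A = (SIGMA C:contexts A. gelfand_spectrum C)"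

text \<open>The scalar measure \<open>B \<mapsto> \<langle>x, E(B) x\<rangle>\<close> on the Borel sets of the real line.\<close>

definition scalar_measure :: "(real set \<Rightarrow> 'h::chilbert_space op) \<Rightarrow> 'h \<Rightarrow> real measure" where
  "scalar_measure E x = measure_of UNIV (sets borel) (\<lambda>B. ennreal (Re (cinner x (E B x))))"

text \<open>A bounded projection-valued measure \<open>E\<close> with \<open>a = \<integral> t dE(t)\<close>.  Countable additivity is
  with respect to the strong operator topology; multiplicativity
  \<open>E (B \<inter> B') = E B o E B'\<close> is a consequence of additivity for projections.\<close>

definition spectral_measure_of ::
    "'h::chilbert_space op \<Rightarrow> (real set \<Rightarrow> 'h op) \<Rightarrow> bool" where
  "spectral_measure_of a E \<longleftrightarrow>
     (\<forall>B\<in>sets borel. projection (E B)) \<and>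
     E {} = 0 \<and>
     (\<exists>M. E {-M..M} = id_blinfun) \<and>
     (\<forall>F :: nat \<Rightarrow> real set. range F \<subseteq> sets borel \<longrightarrow> disjoint_family F \<longrightarrow>
        (\<forall>x. (\<lambda>n. E (F n) x) sums E (\<Union>n. F n) x)) \<and>
     (\<forall>x. cinner x (a x) = complex_of_real (\<integral>t. t \<partial>scalar_measure E x))"

text \<open>\<open>\<chi>\<^sub>B(a)\<close> for a Borel set \<open>B\<close> and self-adjoint \<open>a\<close>; existence and uniqueness of the value
  is the spectral theorem.\<close>

definition spectral_projection :: "'h::chilbert_space op \<Rightarrow> real set \<Rightarrow> 'h op" where
  "spectral_projection a B = (THE P. \<exists>E. spectral_measure_of a E \<and> P = E B)"

definition spectral_resolution :: "'h::chilbert_space op \<Rightarrow> real \<Rightarrow> 'h op" where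
  "spectral_resolution a x = spectral_projection a {..x}"

definition spectral_le :: "'h::chilbert_space op \<Rightarrow> 'h op \<Rightarrow> bool" where
  "spectral_le a b \<longleftrightarrow> (\<forall>x. op_le (spectral_resolution b x) (spectral_resolution a x))"

definition spectral_order :: "'h::chilbert_space op set \<Rightarrow> 'h op gorder" where
  "spectral_order A = \<lparr>carrier = sa_part A, eq = (=), le = spectral_le\<rparr>"

definition Proj_order :: "'h::chilbert_space op set \<Rightarrow> 'h op gorder" where
  "Proj_order A = \<lparr>carrier = Proj A, eq = (=), le = op_le\<rparr>"

text \<open>The bounds are taken in the lattices \<open>(A\<^sub>s\<^sub>a, \<le>\<^sub>s)\<close> and \<open>Proj(A)\<close> of the ambient algebra.\<close>

definition outer_das ::
    "'h::chilbert_space op set \<Rightarrow> 'h op \<Rightarrow> 'h op set \<Rightarrow> 'h op" where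
  "outer_das A a C = \<Sqinter>\<^bsub>spectral_order A\<^esub> {b \<in> sa_part C. spectral_le a b}"

definition inner_das ::
    "'h::chilbert_space op set \<Rightarrow> 'h op \<Rightarrow> 'h op set \<Rightarrow> 'h op" where
  "inner_das A a C = \<Squnion>\<^bsub>spectral_order A\<^esub> {b \<in> sa_part C. spectral_le b a}"

definition outer_das_proj ::
    "'h::chilbert_space op set \<Rightarrow> 'h op \<Rightarrow> 'h op set \<Rightarrow> 'h op" where
  "outer_das_proj A p C = \<Sqinter>\<^bsub>Proj_order A\<^esub> {q \<in> Proj C. op_le p q}"

text \<open>Characters are real on self-adjoint elements, so taking real parts loses nothing.\<close>

definition das_map ::
    "'h::chilbert_space op set \<Rightarrow> 'h op \<Rightarrow> 'h op set \<times> ('h op \<Rightarrow> complex)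
      \<Rightarrow> 'h op set \<times> ereal \<times> ereal" where
  "das_map A a = (\<lambda>(C, l). (C, ereal (Re (l (inner_das A a C))), ereal (Re (l (outer_das A a C)))))"

definition elementary_prop ::
    "'h::chilbert_space op set \<Rightarrow> 'h op \<Rightarrow> real set
      \<Rightarrow> ('h op set \<times> ('h op \<Rightarrow> complex)) set" where
  "elementary_prop A a D = {(C, l) \<in> spectral_presheaf_space A.
     l (outer_das_proj A (spectral_projection a D) C) = 1}"

definition context_topology :: "'h::chilbert_space op set \<Rightarrow> 'h op set topology" where
  "context_topology A = topology (\<lambda>U. U \<subseteq> contexts A \<and>
     (\<forall>C\<in>U. \<forall>D\<in>contexts A. D \<subseteq> C \<longrightarrow> D \<in> U))"

lemma openin_context_topology:
  "openin (context_topology A) U \<longleftrightarrow>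
     U \<subseteq> contexts A \<and> (\<forall>C\<in>U. \<forall>D\<in>contexts A. D \<subseteq> C \<longrightarrow> D \<in> U)"
proof -
  have "istopology (\<lambda>U. U \<subseteq> contexts A \<and> (\<forall>C\<in>U. \<forall>D\<in>contexts A. D \<subseteq> C \<longrightarrow> D \<in> U))"
    unfolding istopology_def by blast
  then show ?thesis
    by (simp add: context_topology_def)
qed

text \<open>The whole space is added to the generators because \<open>topology_generated_by\<close> takes their union
  as underlying space, which would otherwise omit one of the infinite points.\<close>

definition R_l :: "ereal topology" where
  "R_l = topology_generated_by (insert UNIV (range (\<lambda>y::real. {ereal y<..})))"

definition R_u :: "ereal topology" where
  "R_u = topology_generated_by (insert UNIV (range (\<lambda>y::real. {..<ereal y})))"

end

theory Submission
  imports Defs "HOL-Probability.Distribution_Functions"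
begin

text \<open>Everything is read off from spectral resolutions.  A self-adjoint \<open>a\<close> is encoded by the projections
  \<open>e\<^sub>t = \<chi>\<^bsub>(-\<infinity>, t]\<^esub>(a)\<close>, which are characterised by commuting with \<open>a\<close>, by \<open>a \<le> t\<close> on the range of
  \<open>e\<^sub>t\<close> and by \<open>a > t\<close> on its complement.  Both daseinisations are attained extrema: their spectral
  resolutions are the right regularisations of \<open>t \<mapsto> \<Or>{q \<in> Proj C. q \<le> e\<^sub>t}\<close> (outer) and of
  \<open>t \<mapsto> \<And>{q \<in> Proj C. q \<ge> e\<^sub>t}\<close> (inner).  A character \<open>l\<close> takes only the values \<open>0\<close> and \<open>1\<close> on projections, and
  \<open>l b \<le> t\<close> or \<open>l b \<ge> t\<close> according to whether \<open>l\<close> is \<open>1\<close> or \<open>0\<close> on the resolution of \<open>b\<close> at \<open>t\<close>, which gives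
  both inclusions.

  The spectral theorem holds for symmetric operators on real Hilbert spaces; complex linearity of the
  spectral projections follows because they commute with everything that commutes with \<open>a\<close>.\<close>

section \<open>Commutants and projections in real Hilbert spaces\<close>

text \<open>The \<open>\<epsilon>\<close> has a single source. Characters need not be normal:
  \<open>l\<close> may vanish on the resolution of \<open>b\<close> at \<open>t\<close> while
  \<open>l b = t\<close>, as happens over the left endpoint of a continuous spectrum. So membership
  in the two elementary propositions yields only weak inequalities at \<open>r\<close> and
  \<open>s\<close>, and any \<open>\<epsilon> > 0\<close> makes them strict again.

  The obstacle that shapes the file is that \<open>spectral_projection\<close> is a definite
  description over spectral measures: nothing can be said about it before such measures are known to
  exist and to be unique. Existence starts from the absolute value of a - t for each single t. Only
  afterwards are the resulting projections, as t varies, assembled into a measure by means of their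
  scalar distribution functions.

  Every operator built on the way is placed in the bicommutant of its data. This one membership
  later gives complex linearity, membership in the algebra \<open>A\<close>, and membership in a
  context \<open>C\<close>.\<close>

definition symmetric_op :: "'a::real_inner op \<Rightarrow> bool" where
  "symmetric_op T \<longleftrightarrow> (\<forall>x y. inner (T x) y = inner x (T y))"

definition orth_proj :: "'a::real_inner op \<Rightarrow> bool" where
  "orth_proj P \<longleftrightarrow> symmetric_op P \<and> P o\<^sub>L P = P"

text \<open>Formed among all bounded real-linear operators. Complex linearity is itself commutation
  with the scalar multiplications, so \<open>bounded_ops\<close> and every complex
  \<open>commutant\<close> are real commutants too.\<close>

definition real_commutant :: "'a::real_normed_vector op set \<Rightarrow> 'a op set" where
  "real_commutant F = {T. \<forall>S\<in>F. T o\<^sub>L S = S o\<^sub>L T}"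

lemma real_commutantI:
  fixes F :: "'a::real_normed_vector op set" and T :: "'a op"
  shows "(\<And>S x. S \<in> F \<Longrightarrow> T (S x) = S (T x)) \<Longrightarrow> T \<in> real_commutant F"
  by (auto simp: real_commutant_def intro!: blinfun_eqI)

lemma real_commutantD:
  fixes F :: "'a::real_normed_vector op set" and T :: "'a op"
  shows "T \<in> real_commutant F \<Longrightarrow> S \<in> F \<Longrightarrow> T (S x) = S (T x)"
  by (metis (mono_tags, lifting) real_commutant_def blinfun_apply_blinfun_compose mem_Collect_eq)

lemma real_commutant_antimono: "F \<subseteq> G \<Longrightarrow> real_commutant G \<subseteq> real_commutant F"
  by (auto simp: real_commutant_def)

lemma subset_real_bicommutant: "F \<subseteq> real_commutant (real_commutant F)"
  by (auto simp: real_commutant_def)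

text \<open>Commutants reverse inclusions: G inside F'' gives F' inside G', hence G'' inside F''.
  This carries membership along chains of constructions that start from the same operators.\<close>

lemma real_bicommutant_least:
  assumes "G \<subseteq> real_commutant (real_commutant F)"
  shows "real_commutant (real_commutant G) \<subseteq> real_commutant (real_commutant F)"
proof
  fix T assume T: "T \<in> real_commutant (real_commutant G)"
  have "S \<in> real_commutant G" if "S \<in> real_commutant F" for S
    using that assms by (fastforce simp: real_commutant_def)
  then show "T \<in> real_commutant (real_commutant F)"
    using T unfolding real_commutant_def by blast
qed

lemma id_in_real_commutant: "id_blinfun \<in> real_commutant F"
  and zero_in_real_commutant: "0 \<in> real_commutant F"
  by (auto intro!: real_commutantI)

lemma real_commutant_add: "S \<in> real_commutant F \<Longrightarrow> T \<in> real_commutant F \<Longrightarrow> S + T \<in> real_commutant F"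
  and real_commutant_diff: "S \<in> real_commutant F \<Longrightarrow> T \<in> real_commutant F \<Longrightarrow> S - T \<in> real_commutant F"
  and real_commutant_scaleR: "S \<in> real_commutant F \<Longrightarrow> c *\<^sub>R S \<in> real_commutant F"
  and real_commutant_compose: "S \<in> real_commutant F \<Longrightarrow> T \<in> real_commutant F \<Longrightarrow> S o\<^sub>L T \<in> real_commutant F"
  by (auto intro!: real_commutantI
      simp: real_commutantD blinfun.bilinear_simps)

text \<open>Commutation is tested vector by vector, so strong convergence suffices. This matters for
  monotone limits and series of projections, which usually do not converge in norm.\<close>

lemma real_commutant_limit:
  fixes T :: "nat \<Rightarrow> 'a::real_normed_vector op"
  assumes "\<And>n. T n \<in> real_commutant F" and "\<And>x. (\<lambda>n. T n x) \<longlonglongrightarrow> blinfun_apply L x"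
  shows "L \<in> real_commutant F"
proof (rule real_commutantI)
  fix S x assume "S \<in> F"
  then have "(\<lambda>n. T n (S x)) = (\<lambda>n. S (T n x))"
    using real_commutantD[OF assms(1)] by blast
  moreover have "(\<lambda>n. S (T n x)) \<longlonglongrightarrow> S (L x)"
    by (intro blinfun.tendsto tendsto_const assms(2))
  ultimately show "L (S x) = S (L x)"
    using LIMSEQ_unique assms(2)[of "S x"] by metis
qed

lemma closed_real_commutant: "closed (real_commutant F)"
  unfolding closed_sequential_limits
proof (intro allI impI, elim conjE)
  fix T L assume T: "\<forall>n. T n \<in> real_commutant F" "T \<longlonglongrightarrow> L"
  show "L \<in> real_commutant F"
  proof (rule real_commutant_limit)
    show "T n \<in> real_commutant F" for n using T by blast
    show "(\<lambda>n. blinfun_apply (T n) x) \<longlonglongrightarrow> blinfun_apply L x" for x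
      using T by (intro blinfun.tendsto tendsto_const)
  qed
qed

lemma symmetric_opD:
  fixes T :: "'a::real_inner op"
  shows "symmetric_op T \<Longrightarrow> inner (T x) y = inner x (T y)"
  by (simp add: symmetric_op_def)

text \<open>Polarisation: for symmetric D with vanishing form, the form at x + D x equals twice the
  squared norm of D x. Thus operator identities between projections can be read off from scalar
  measures.\<close>

lemma symmetric_op_eqI:
  fixes S T :: "'a::real_inner op"
  assumes "symmetric_op S" "symmetric_op T" and "\<And>x. inner x (S x) = inner x (T x)"
  shows "S = T"
proof -
  define D where "D = S - T"
  have sym: "inner (D x) y = inner x (D y)" for x y
    using assms(1,2) by (simp add: D_def symmetric_op_def blinfun.bilinear_simps inner_diff)
  have q: "inner x (D x) = 0" for x
    using assms(3) by (simp add: D_def blinfun.bilinear_simps inner_diff)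
  have "D x = 0" for x
  proof -
    have "inner (x + D x) (D (x + D x)) = 2 * inner (D x) (D x)"
      using q[of x] q[of "D x"] sym[of x "D x"]
      by (simp add: blinfun.bilinear_simps inner_add)
    then show ?thesis by (simp add: q)
  qed
  then show ?thesis unfolding D_def
    by (metis blinfun_eqI eq_iff_diff_eq_0 zero_blinfun.rep_eq)
qed

lemma symmetric_op_limit:
  fixes T :: "nat \<Rightarrow> 'a::real_inner op"
  assumes "\<And>n. symmetric_op (T n)" and "\<And>x. (\<lambda>n. T n x) \<longlonglongrightarrow> blinfun_apply L x"
  shows "symmetric_op L"
  unfolding symmetric_op_def
proof (intro allI)
  fix x y
  have "(\<lambda>n. inner (T n x) y) \<longlonglongrightarrow> inner (L x) y"
    by (intro tendsto_intros assms(2))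
  moreover have "(\<lambda>n. inner (T n x) y) = (\<lambda>n. inner x (T n y))"
    using assms(1) by (simp add: symmetric_op_def)
  moreover have "(\<lambda>n. inner x (T n y)) \<longlonglongrightarrow> inner x (L y)"
    by (intro tendsto_intros assms(2))
  ultimately show "inner (L x) y = inner x (L y)"
    using LIMSEQ_unique by metis
qed

lemma orth_projI:
  fixes P :: "'a::real_inner op"
  assumes "\<And>x y. inner (P x) y = inner x (P y)" and "\<And>x. P (P x) = P x"
  shows "orth_proj P"
  using assms by (auto simp: orth_proj_def symmetric_op_def intro!: blinfun_eqI)

lemma orth_proj_symmetric: "orth_proj P \<Longrightarrow> symmetric_op P"
  by (simp add: orth_proj_def)

lemma orth_proj_sym:
  fixes P :: "'a::real_inner op"
  shows "orth_proj P \<Longrightarrow> inner (P x) y = inner x (P y)"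
  by (simp add: orth_proj_def symmetric_op_def)

lemma orth_proj_idem:
  fixes P :: "'a::real_inner op"
  shows "orth_proj P \<Longrightarrow> P (P x) = P x"
  by (metis blinfun_apply_blinfun_compose orth_proj_def)

lemma orth_proj_inner:
  fixes P :: "'a::real_inner op"
  shows "orth_proj P \<Longrightarrow> inner x (P x) = (norm (P x))\<^sup>2"
  by (metis orth_proj_idem orth_proj_sym power2_norm_eq_inner)

lemma orth_proj_compl:
  fixes P :: "'a::real_inner op"
  shows "orth_proj P \<Longrightarrow> orth_proj (id_blinfun - P)"
  by (rule orth_projI)
    (simp_all add: blinfun.bilinear_simps inner_diff orth_proj_sym orth_proj_idem)

lemma orth_proj_0: "orth_proj 0" and orth_proj_id: "orth_proj id_blinfun"
  by (auto intro: orth_projI)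

lemma orth_proj_pythagoras:
  fixes P :: "'a::real_inner op"
  assumes "orth_proj P"
  shows "(norm x)\<^sup>2 = (norm (P x))\<^sup>2 + (norm (x - P x))\<^sup>2"
proof -
  have "inner (P x) (x - P x) = 0"
    using assms by (simp add: orth_proj_sym blinfun.bilinear_simps orth_proj_idem)
  then show ?thesis
    unfolding power2_norm_eq_inner by (simp add: inner_diff inner_commute)
qed

lemma orth_proj_norm_le:
  fixes P :: "'a::real_inner op"
  shows "orth_proj P \<Longrightarrow> norm (P x) \<le> norm x"
  by (rule power2_le_imp_le) (simp_all add: orth_proj_pythagoras[of P x])

text \<open>If the forms are ordered, \<open>Q\<close> preserves the norm of P x, so Pythagoras
  leaves no room for P x - Q (P x). Conversely QP = P has the adjoint PQ = P, and P x = P (Q x) is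
  no longer than Q x.\<close>

lemma orth_proj_le_iff:
  fixes P :: "'a::real_inner op"
  assumes "orth_proj P" "orth_proj Q"
  shows "(\<forall>x. inner x (P x) \<le> inner x (Q x)) \<longleftrightarrow> (\<forall>x. Q (P x) = P x)"
proof
  assume le: "\<forall>x. inner x (P x) \<le> inner x (Q x)"
  show "\<forall>x. Q (P x) = P x"
  proof
    fix x
    have "(norm (P x))\<^sup>2 \<le> (norm (Q (P x)))\<^sup>2"
      using le[rule_format, of "P x"] assms
      by (metis assms orth_proj_idem orth_proj_inner)
    then have "norm (P x - Q (P x)) = 0"
      using orth_proj_pythagoras[OF assms(2), of "P x"]
      by (smt (verit) zero_eq_power2 zero_le_power2)
    then show "Q (P x) = P x" by simp
  qed
next
  assume eq: "\<forall>x. Q (P x) = P x"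
  show "\<forall>x. inner x (P x) \<le> inner x (Q x)"
  proof
    fix x
    have PQ: "P (Q x) = P x"
    proof -
      have "inner (P (Q x) - P x) y = 0" for y
        using assms eq by (simp add: inner_diff orth_proj_sym)
      then show ?thesis by (metis eq_iff_diff_eq_0 inner_eq_zero_iff)
    qed
    have "norm (P x) \<le> norm (Q x)"
      using orth_proj_norm_le[OF assms(1), of "Q x"] PQ by simp
    then show "inner x (P x) \<le> inner x (Q x)"
      using assms by (simp add: orth_proj_inner power_mono)
  qed
qed

text \<open>The two equations are adjoints of each other.\<close>

lemma orth_proj_absorb_swap:
  fixes P :: "'a::real_inner op"
  assumes "orth_proj P" "orth_proj Q"
  shows "(\<forall>x. Q (P x) = P x) \<longleftrightarrow> (\<forall>x. P (Q x) = P x)"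
proof -
  have imp: "R (S x) = R x" if R: "orth_proj R" and S: "orth_proj S" and eq: "\<forall>x. S (R x) = R x"
    for R S :: "'a op" and x
  proof -
    have "inner (R (S x) - R x) y = 0" for y
      using R S eq by (simp add: inner_diff orth_proj_sym)
    then show ?thesis by (metis eq_iff_diff_eq_0 inner_eq_zero_iff)
  qed
  have imp': "S (R x) = R x" if R: "orth_proj R" and S: "orth_proj S" and eq: "\<forall>x. R (S x) = R x"
    for R S :: "'a op" and x
  proof -
    have "inner (S (R x) - R x) y = 0" for y
      using R S eq by (simp add: inner_diff orth_proj_sym)
    then show ?thesis by (metis eq_iff_diff_eq_0 inner_eq_zero_iff)
  qed
  show ?thesis using imp imp' assms by blast
qed

section \<open>Orthogonal projections onto closed spans\<close>

lemma vanishes_on_closure_span: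
  fixes L :: "'a::real_normed_vector \<Rightarrow>\<^sub>L 'b::real_normed_vector"
  assumes "\<And>w. w \<in> W \<Longrightarrow> L w = 0" and x: "x \<in> closure (span W)"
  shows "L x = 0"
proof -
  have "span W \<subseteq> {x. L x = 0}"
    by (rule span_minimal) (use assms(1) in \<open>auto simp: subspace_def blinfun.bilinear_simps\<close>)
  moreover have "closed {x. L x = 0}"
    by (intro closed_Collect_eq continuous_intros)
  ultimately show ?thesis using x closure_minimal by blast
qed

lemma subspace_closure:
  fixes S :: "'a::real_normed_vector set"
  assumes "subspace S"
  shows "subspace (closure S)"
  unfolding subspace_def
proof (intro conjI ballI allI)
  show "0 \<in> closure S"
    using assms closure_subset subspace_0 by blast
  fix x assume "x \<in> closure S"
  then obtain u where u: "\<And>n. u n \<in> S" "u \<longlonglongrightarrow> x"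
    unfolding closure_sequential by blast
  show "x + y \<in> closure S" if "y \<in> closure S" for y
  proof -
    obtain v where "\<And>n. v n \<in> S" "v \<longlonglongrightarrow> y"
      using \<open>y \<in> closure S\<close> unfolding closure_sequential by blast
    with u show ?thesis
      unfolding closure_sequential
      by (intro exI[of _ "\<lambda>n. u n + v n"]) (auto intro: tendsto_add subspace_add[OF assms])
  qed
  show "c *\<^sub>R x \<in> closure S" for c
    unfolding closure_sequential using u
    by (intro exI[of _ "\<lambda>n. c *\<^sub>R u n"]) (auto intro: tendsto_intros subspace_scale[OF assms])
qed

text \<open>A minimising sequence for the distance is Cauchy by the parallelogram law; at its limit,
  moving along any direction of \<open>K\<close> cannot shorten the distance, which forces
  orthogonality.\<close>

lemma closest_point_hilbert:
  fixes K :: "'a::{real_inner,banach} set"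
  assumes cl: "closed K" and sub: "subspace K"
  obtains y where "y \<in> K" and "\<And>z. z \<in> K \<Longrightarrow> inner (x - y) z = 0"
proof -
  define d where "d = (INF y\<in>K. (norm (x - y))\<^sup>2)"
  have ne: "K \<noteq> {}" using sub by (auto simp: subspace_def)
  have bdd: "bdd_below ((\<lambda>y. (norm (x - y))\<^sup>2) ` K)"
    by (rule bdd_belowI[of _ 0]) auto
  have low: "d \<le> (norm (x - y))\<^sup>2" if "y \<in> K" for y
    unfolding d_def using cINF_lower[OF bdd that] by simp
  have "\<exists>y\<in>K. (norm (x - y))\<^sup>2 < d + 1 / Suc n" for n
    using cINF_less_iff[OF ne bdd, of "d + 1 / Suc n"] by (simp add: d_def)
  then obtain y where yK: "\<And>n. y n \<in> K" and yd: "\<And>n. (norm (x - y n))\<^sup>2 < d + 1 / Suc n"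
    by metis
  have close: "(norm (y m - y n))\<^sup>2 \<le> 2 / Suc m + 2 / Suc n" for m n
  proof -
    \<comment> \<open>The midpoint of two near-minimisers stays in \<open>K\<close>, so its squared
      distance is at least \<open>d\<close>; the parallelogram law then bounds how far apart the two
      can be.\<close>
    have "(1/2) *\<^sub>R (y m + y n) \<in> K"
      using yK sub by (simp add: subspace_add subspace_scale)
    from low[OF this]
    have "4 * d \<le> (norm (2 *\<^sub>R (x - (1/2) *\<^sub>R (y m + y n))))\<^sup>2"
      by (simp add: power_mult_distrib)
    also have "2 *\<^sub>R (x - (1/2) *\<^sub>R (y m + y n)) = (x - y m) + (x - y n)"
      by (simp add: algebra_simps scaleR_2)
    also have "(norm ((x - y m) + (x - y n)))\<^sup>2 =
        2 * (norm (x - y m))\<^sup>2 + 2 * (norm (x - y n))\<^sup>2 - (norm (y m - y n))\<^sup>2"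
      unfolding power2_norm_eq_inner by (simp add: inner_simps inner_commute)
    finally show ?thesis using yd[of m] yd[of n] by simp
  qed
  have "Cauchy y"
  proof (rule metric_CauchyI)
    fix e :: real assume e: "e > 0"
    obtain N where N: "4 / e\<^sup>2 < real N" using reals_Archimedean2 by blast
    have "dist (y m) (y n) < e" if "m \<ge> N" "n \<ge> N" for m n
    proof -
      have "2 / real (Suc k) \<le> 2 / real (Suc N)" if "k \<ge> N" for k
        using that by (simp add: frac_le)
      from this[OF \<open>m \<ge> N\<close>] this[OF \<open>n \<ge> N\<close>]
      have "(norm (y m - y n))\<^sup>2 \<le> 2 / Suc N + 2 / Suc N"
        using close[of m n] by linarith
      then have "(norm (y m - y n))\<^sup>2 \<le> 4 / Suc N" by simp
      also have "\<dots> < e\<^sup>2" using N e by (simp add: field_simps) (smt (verit) zero_less_power)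
      finally show ?thesis using e by (simp add: dist_norm power_less_imp_less_base)
    qed
    then show "\<exists>N. \<forall>m\<ge>N. \<forall>n\<ge>N. dist (y m) (y n) < e" by blast
  qed
  then obtain u where u: "y \<longlonglongrightarrow> u" using Cauchy_convergent convergent_def by blast
  have uK: "u \<in> K" using closed_sequentially[OF cl] yK u by blast
  have ud: "(norm (x - u))\<^sup>2 \<le> d"
  proof (rule LIMSEQ_le)
    show "(\<lambda>n. (norm (x - y n))\<^sup>2) \<longlonglongrightarrow> (norm (x - u))\<^sup>2"
      by (intro tendsto_intros u)
    have "(\<lambda>n. d + 1 / real (Suc n)) \<longlonglongrightarrow> d + 0"
      by (intro tendsto_intros LIMSEQ_Suc[OF lim_1_over_n])
    then show "(\<lambda>n. d + 1 / real (Suc n)) \<longlonglongrightarrow> d" by simp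
    show "\<exists>N. \<forall>n\<ge>N. (norm (x - y n))\<^sup>2 \<le> d + 1 / real (Suc n)"
      using yd less_imp_le by blast
  qed
  have "inner (x - u) z = 0" if z: "z \<in> K" for z
  proof (cases "z = 0")
    case False
    \<comment> \<open>The parameter at which the squared norm of x - u - t z is smallest.\<close>
    define t where "t = inner (x - u) z / inner z z"
    have "u + t *\<^sub>R z \<in> K" using uK z sub by (simp add: subspace_add subspace_scale)
    from low[OF this] ud have "(norm (x - u))\<^sup>2 \<le> (norm (x - u - t *\<^sub>R z))\<^sup>2"
      unfolding diff_diff_add by linarith
    also have "\<dots> = (norm (x - u))\<^sup>2 - 2 * t * inner (x - u) z + t\<^sup>2 * inner z z"
      unfolding power2_norm_eq_inner by (simp add: inner_simps inner_commute power2_eq_square)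
    also have "\<dots> = (norm (x - u))\<^sup>2 - (inner (x - u) z)\<^sup>2 / inner z z"
      using False by (simp add: t_def power2_eq_square)
    finally have "(inner (x - u) z)\<^sup>2 / inner z z \<le> 0" by simp
    then show ?thesis using False
      by (smt (verit) divide_pos_pos inner_gt_zero_iff zero_less_power2)
  qed simp
  then show thesis using that uK by blast
qed

text \<open>The last property transfers linear identities: by
  \<open>vanishes_on_closure_span\<close>, what is checked on \<open>W\<close> holds on the whole
  range of \<open>P\<close>.\<close>

lemma closure_span_projection:
  fixes W :: "'a::{real_inner,banach} set"
  obtains P :: "'a op" where "orth_proj P" and "\<And>w. w \<in> W \<Longrightarrow> P w = w"
    and "\<And>x. (\<And>w. w \<in> W \<Longrightarrow> inner x w = 0) \<Longrightarrow> P x = 0"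
    and "\<And>x. P x \<in> closure (span W)"
proof -
  define K where "K = closure (span W)"
  have cl: "closed K" and sub: "subspace K"
    by (simp_all add: K_def subspace_span closed_closure subspace_closure)
  have "\<forall>x. \<exists>y. y \<in> K \<and> (\<forall>z\<in>K. inner (x - y) z = 0)"
    using closest_point_hilbert[OF cl sub] by metis
  then obtain p where pK: "\<And>x. p x \<in> K" and po: "\<And>x z. z \<in> K \<Longrightarrow> inner (x - p x) z = 0"
    by metis
  \<comment> \<open>Orthogonality of the residual determines the point, so additivity, homogeneity
    and fixed points all follow by exhibiting a candidate.\<close>
  have uniq: "p x = y" if "y \<in> K" "\<And>z. z \<in> K \<Longrightarrow> inner (x - y) z = 0" for x y
  proof -
    have "p x - y \<in> K" using pK that(1) sub by (simp add: subspace_diff)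
    then have "inner (p x - y) (p x - y) = 0"
      using that(2) po[of "p x - y" x] by (simp add: inner_diff_left)
    then show ?thesis by simp
  qed
  have add: "p (x + y) = p x + p y" for x y
  proof (rule uniq)
    show "p x + p y \<in> K" using pK sub by (simp add: subspace_add)
    show "inner (x + y - (p x + p y)) z = 0" if "z \<in> K" for z
      using po[OF that, of x] po[OF that, of y] by (simp add: inner_diff_left inner_add_left)
  qed
  have scale: "p (c *\<^sub>R x) = c *\<^sub>R p x" for c x
  proof (rule uniq)
    show "c *\<^sub>R p x \<in> K" using pK sub by (simp add: subspace_scale)
    show "inner (c *\<^sub>R x - c *\<^sub>R p x) z = 0" if "z \<in> K" for z
      using po[OF that, of x] by (simp flip: scaleR_diff_right)
  qed
  have "norm (p x) \<le> norm x * 1" for x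
  proof -
    have "(norm (p x))\<^sup>2 = inner x (p x)"
      using po[OF pK, of x x] by (simp add: power2_norm_eq_inner inner_diff)
    also have "\<dots> \<le> norm x * norm (p x)" by (rule norm_cauchy_schwarz)
    finally show ?thesis by (cases "p x = 0") (auto simp: power2_eq_square)
  qed
  then have bl: "bounded_linear p"
    by (rule bounded_linear_intro[OF add scale])
  define P where "P = Blinfun p"
  have Pp: "P x = p x" for x
    by (simp add: P_def bounded_linear_Blinfun_apply[OF bl])
  have fixK: "p x = x" if "x \<in> K" for x
    by (rule uniq) (use that in auto)
  show thesis
  proof
    show "orth_proj P"
    proof (rule orth_projI)
      show "inner (P x) y = inner x (P y)" for x y
        using po[OF pK[of x], of y] po[OF pK[of y], of x]
        by (simp add: Pp inner_diff inner_commute)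
      show "P (P x) = P x" for x
        by (simp add: Pp fixK pK)
    qed
    show "P w = w" if "w \<in> W" for w
    proof -
      have "w \<in> K" unfolding K_def using that closure_subset span_base by blast
      then show ?thesis by (simp add: Pp fixK)
    qed
    show "P x = 0" if x: "\<And>w. w \<in> W \<Longrightarrow> inner x w = 0" for x
    proof -
      have "blinfun_inner_right x z = 0" if "z \<in> closure (span W)" for z
        by (rule vanishes_on_closure_span[OF _ that]) (simp add: x)
      then have "inner x z = 0" if "z \<in> K" for z using that by (simp add: K_def)
      then show ?thesis
        unfolding Pp by (intro uniq) (use sub in \<open>auto simp: subspace_0\<close>)
    qed
    show "P x \<in> closure (span W)" for x
      using pK by (simp add: Pp K_def)
  qed
qed

text \<open>\<open>T\<close> is not assumed symmetric, so the invariance of the orthogonal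
  complement of \<open>W\<close> does not follow from that of \<open>W\<close> and is a separate
  hypothesis.\<close>

lemma closure_span_projection_commute:
  fixes P T :: "'a::real_inner op"
  assumes P: "orth_proj P" "\<And>w. w \<in> W \<Longrightarrow> P w = w"
    "\<And>x. (\<And>w. w \<in> W \<Longrightarrow> inner x w = 0) \<Longrightarrow> P x = 0" "\<And>x. P x \<in> closure (span W)"
    and T: "\<And>w. w \<in> W \<Longrightarrow> T w \<in> W"
    "\<And>x w. (\<And>w. w \<in> W \<Longrightarrow> inner x w = 0) \<Longrightarrow> w \<in> W \<Longrightarrow> inner (T x) w = 0"
  shows "T (P x) = P (T x)"
proof -
  have "(T - (P o\<^sub>L T)) (P x) = 0"
    by (rule vanishes_on_closure_span[of W]) (simp_all add: P T blinfun.bilinear_simps)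
  then have 1: "P (T (P x)) = T (P x)" by (simp add: blinfun.bilinear_simps)
  have "inner (x - P x) w = 0" if "w \<in> W" for w
    using P(1,2) that by (simp add: inner_diff orth_proj_sym)
  then have "P (T (x - P x)) = 0"
    using P(3) T(2) by blast
  then show ?thesis using 1 by (simp add: blinfun.bilinear_simps)
qed

section \<open>Spectral projections of half-lines\<close>

text \<open>The solution of \<open>2Y = B + Y\<^sup>2\<close> is the limit of \<open>Y\<^sub>n\<^sub>+\<^sub>1 = (B + Y\<^sub>n\<^sup>2) / 2\<close>; since \<open>\<parallel>B\<parallel> \<le> 1\<close>, the
  increments are dominated in norm by those of the scalar iteration with \<open>B = 1\<close>.\<close>

lemma op_quadratic_solution:
  fixes B :: "'a::{real_inner,banach} op"
  assumes B: "norm B \<le> 1" and sym: "symmetric_op B"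
  obtains Y where "norm Y \<le> 1" and "2 *\<^sub>R Y = B + (Y o\<^sub>L Y)"
    and "Y \<in> real_commutant (real_commutant {B})" and "symmetric_op Y"
proof -
  define Y where "Y = rec_nat 0 (\<lambda>_ Z. (1/2) *\<^sub>R (B + (Z o\<^sub>L Z)))"
  define y :: "nat \<Rightarrow> real" where "y = rec_nat 0 (\<lambda>_ z. (1 + z\<^sup>2) / 2)"
  have Y0: "Y 0 = 0" and YS: "Y (Suc n) = (1/2) *\<^sub>R (B + (Y n o\<^sub>L Y n))" for n
    by (simp_all add: Y_def)
  have y0: "y 0 = 0" and yS: "y (Suc n) = (1 + (y n)\<^sup>2) / 2" for n
    by (simp_all add: y_def)
  have y_range: "0 \<le> y n \<and> y n \<le> 1" for n
    by (induction n) (auto simp: y0 yS power_le_one)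
  have norm_Y: "norm (Y n) \<le> y n" for n
  proof (induction n)
    case (Suc n)
    have "norm (Y n o\<^sub>L Y n) \<le> (y n)\<^sup>2"
      using norm_blinfun_compose[of "Y n" "Y n"] Suc
      by (smt (verit) mult_mono norm_ge_zero power2_eq_square)
    then show ?case
      using norm_triangle_ineq[of B "Y n o\<^sub>L Y n"] B by (simp add: YS yS)
  qed (simp add: Y0 y0)
  have step: "norm (Y (Suc n) - Y n) \<le> y (Suc n) - y n" for n
  proof (induction n)
    case 0
    then show ?case using B by (simp add: Y0 YS y0 yS)
  next
    case (Suc n)
    let ?D = "Y (Suc n) - Y n" and ?d = "y (Suc n) - y n"
    \<comment> \<open>Noncommutative difference of squares: X X - Z Z = X (X - Z) + (X - Z) Z. The
      scalar sequence satisfies the same recursion with equality.\<close>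
    have "Y (Suc (Suc n)) - Y (Suc n) = (1/2) *\<^sub>R ((Y (Suc n) o\<^sub>L ?D) + (?D o\<^sub>L Y n))"
      unfolding YS[of "Suc n"] YS[of n]
      by (rule blinfun_eqI)
        (simp add: blinfun.bilinear_simps algebra_simps flip: YS)
    moreover have "norm (Y (Suc n) o\<^sub>L ?D) \<le> y (Suc n) * ?d"
      by (rule order_trans[OF norm_blinfun_compose])
        (intro mult_mono norm_Y Suc.IH norm_ge_zero, use y_range in auto)
    moreover have "norm (?D o\<^sub>L Y n) \<le> ?d * y n"
      by (rule order_trans[OF norm_blinfun_compose])
        (intro mult_mono norm_Y Suc.IH norm_ge_zero order_trans[OF norm_ge_zero Suc.IH])
    ultimately have "norm (Y (Suc (Suc n)) - Y (Suc n)) \<le> (y (Suc n) * ?d + ?d * y n) / 2"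
      using norm_triangle_ineq[of "Y (Suc n) o\<^sub>L ?D" "?D o\<^sub>L Y n"] by simp
    also have "\<dots> = y (Suc (Suc n)) - y (Suc n)"
      unfolding yS[of "Suc n"] yS[of n] by (simp add: power2_eq_square field_simps)
    finally show ?case .
  qed
  have inc: "incseq y"
  proof (rule incseq_SucI)
    show "y n \<le> y (Suc n)" for n
      using step[of n] norm_ge_zero[of "Y (Suc n) - Y n"] by linarith
  qed
  have diff: "norm (Y (n + k) - Y n) \<le> y (n + k) - y n" for n k
  proof (induction k)
    case (Suc k)
    have "norm (Y (n + Suc k) - Y n) \<le> norm (Y (Suc (n + k)) - Y (n + k)) + norm (Y (n + k) - Y n)"
      using norm_triangle_ineq[of "Y (Suc (n + k)) - Y (n + k)" "Y (n + k) - Y n"] by simp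
    then show ?case using Suc step[of "n + k"] by simp
  qed simp
  have "convergent y"
    using inc y_range by (metis incseq_convergent convergentI)
  then have Cy: "Cauchy y" by (rule convergent_Cauchy)
  have "Cauchy Y"
  proof (rule metric_CauchyI)
    fix e :: real assume "e > 0"
    then obtain N where N: "\<And>m n. m \<ge> N \<Longrightarrow> n \<ge> N \<Longrightarrow> dist (y m) (y n) < e"
      using metric_CauchyD[OF Cy] by blast
    have *: "dist (Y m) (Y n) < e" if "n \<ge> N" "m \<ge> n" for m n
      using diff[of n "m - n"] N[of m n] that by (simp add: dist_norm)
    have "dist (Y m) (Y n) < e" if "m \<ge> N" "n \<ge> N" for m n
      using *[of n m] *[of m n] that by (cases "m \<ge> n") (auto simp: dist_commute)
    then show "\<exists>N. \<forall>m\<ge>N. \<forall>n\<ge>N. dist (Y m) (Y n) < e" by blast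
  qed
  then obtain L where L: "Y \<longlonglongrightarrow> L" using Cauchy_convergent convergent_def by blast
  have Lx: "(\<lambda>n. Y n x) \<longlonglongrightarrow> L x" for x
    using L by (intro blinfun.tendsto tendsto_const)
  show thesis
  proof
    show "norm L \<le> 1"
      by (rule LIMSEQ_le_const2[OF tendsto_norm[OF L]])
        (use norm_Y y_range order_trans in blast)
    have "(\<lambda>n. (1/2) *\<^sub>R (B + (Y n o\<^sub>L Y n))) \<longlonglongrightarrow> (1/2) *\<^sub>R (B + (L o\<^sub>L L))"
      by (intro tendsto_intros L bounded_bilinear.tendsto[OF bounded_bilinear_blinfun_compose])
    then have "(\<lambda>n. Y (Suc n)) \<longlonglongrightarrow> (1/2) *\<^sub>R (B + (L o\<^sub>L L))" by (simp add: YS)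
    then have "L = (1/2) *\<^sub>R (B + (L o\<^sub>L L))"
      using LIMSEQ_Suc[OF L] LIMSEQ_unique by blast
    then have "2 *\<^sub>R L = 2 *\<^sub>R ((1/2) *\<^sub>R (B + (L o\<^sub>L L)))" by (rule arg_cong)
    then show "2 *\<^sub>R L = B + (L o\<^sub>L L)" by simp
    have "Y n \<in> real_commutant (real_commutant {B})" for n
    proof (induction n)
      case (Suc n)
      have "B \<in> real_commutant (real_commutant {B})"
        using subset_real_bicommutant by blast
      with Suc show ?case unfolding YS
        by (intro real_commutant_scaleR real_commutant_add real_commutant_compose)
    qed (simp add: Y0 zero_in_real_commutant)
    then show "L \<in> real_commutant (real_commutant {B})"
      by (rule real_commutant_limit[OF _ Lx])
    have "symmetric_op (Y n)" for n
      by (induction n)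
        (use sym in \<open>auto simp: Y0 YS symmetric_op_def blinfun.bilinear_simps inner_add\<close>)
    then show "symmetric_op L" by (rule symmetric_op_limit[OF _ Lx])
  qed
qed

text \<open>\<open>k (1 - Y)\<close> is the absolute value \<open>\<bar>b\<bar>\<close>.  This form makes its values under characters
  nonnegative as soon as characters are contractive.\<close>

lemma op_absolute_value:
  fixes b :: "'a::{real_inner,banach} op"
  assumes sym: "symmetric_op b"
  obtains Y k where "0 \<le> k" and "norm Y \<le> 1" and "symmetric_op Y"
    and "Y \<in> real_commutant (real_commutant {b})"
    and "(k *\<^sub>R (id_blinfun - Y)) o\<^sub>L (k *\<^sub>R (id_blinfun - Y)) = b o\<^sub>L b"
proof -
  \<comment> \<open>Adding 1 keeps \<open>k\<close> positive when b = 0, while b / k is still a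
    contraction.\<close>
  define k where "k = norm b + 1"
  have k: "k > 0" by (simp add: k_def add_nonneg_pos)
  define c where "c = (1/k) *\<^sub>R b"
  have "norm c \<le> 1" using k by (simp add: c_def k_def divide_simps)
  then have c_le: "norm (c x) \<le> norm x" for x
    using norm_blinfun[of c x] by (smt (verit) mult_left_le_one_le norm_ge_zero)
  have c_sym: "inner (c x) y = inner x (c y)" for x y
    using sym by (simp add: c_def symmetric_op_def blinfun.bilinear_simps)
  \<comment> \<open>With B = 1 - c c, the equation 2 Y = B + Y Y says exactly that 1 - Y squares to
    c c.\<close>
  define B where "B = id_blinfun - (c o\<^sub>L c)"
  have "norm B \<le> 1"
  proof (rule norm_blinfun_bound)
    fix x
    have "(norm (B x))\<^sup>2 = (norm x)\<^sup>2 - 2 * (norm (c x))\<^sup>2 + (norm (c (c x)))\<^sup>2"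
      unfolding power2_norm_eq_inner B_def
      by (simp add: blinfun.bilinear_simps inner_diff c_sym)
    also have "\<dots> \<le> (norm x)\<^sup>2"
      using power_mono[OF c_le[of "c x"] norm_ge_zero, of 2] zero_le_power2[of "norm (c x)"]
      by linarith
    finally have "norm (B x) \<le> norm x" by (rule power2_le_imp_le) simp
    then show "norm (B x) \<le> 1 * norm x" by simp
  qed simp
  moreover have "symmetric_op B"
    by (simp add: B_def symmetric_op_def blinfun.bilinear_simps inner_diff c_sym)
  ultimately obtain Y where Y: "norm Y \<le> 1" "2 *\<^sub>R Y = B + (Y o\<^sub>L Y)"
    "Y \<in> real_commutant (real_commutant {B})" "symmetric_op Y"
    using op_quadratic_solution by blast
  have b: "b \<in> real_commutant (real_commutant {b})" using subset_real_bicommutant by blast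
  have "B \<in> real_commutant (real_commutant {b})"
    unfolding B_def c_def
    by (intro real_commutant_diff real_commutant_compose real_commutant_scaleR b id_in_real_commutant)
  then have "Y \<in> real_commutant (real_commutant {b})"
    using real_bicommutant_least[of "{B}" "{b}"] Y(3) by blast
  moreover have "(k *\<^sub>R (id_blinfun - Y)) o\<^sub>L (k *\<^sub>R (id_blinfun - Y)) = b o\<^sub>L b"
  proof (rule blinfun_eqI)
    fix x
    have "2 *\<^sub>R Y x = B x + Y (Y x)"
      using arg_cong[OF Y(2), of "\<lambda>T. T x"] by (simp add: blinfun.bilinear_simps)
    then have "Y (Y x) = 2 *\<^sub>R Y x - B x" by simp
    then have "x - Y x - Y (x - Y x) = c (c x)"
      by (simp add: blinfun.bilinear_simps B_def scaleR_2)
    then show "((k *\<^sub>R (id_blinfun - Y)) o\<^sub>L (k *\<^sub>R (id_blinfun - Y))) x = (b o\<^sub>L b) x"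
      using k by (simp add: blinfun.bilinear_simps c_def flip: scaleR_diff_right)
  qed
  ultimately show thesis using that[of k Y] Y k by simp
qed

text \<open>\<open>e\<close> is the spectral projection \<open>\<chi>\<^bsub>(-\<infinity>, t]\<^esub>(a)\<close>; the two inequalities determine it.\<close>

definition spectral_cut :: "'a::real_inner op \<Rightarrow> real \<Rightarrow> 'a op \<Rightarrow> bool" where
  "spectral_cut a t e \<longleftrightarrow> orth_proj e \<and> (\<forall>x. a (e x) = e (a x)) \<and>
     (\<forall>x. inner (e x) (a (e x)) \<le> t * (norm (e x))\<^sup>2) \<and>
     (\<forall>x. e x = 0 \<longrightarrow> x \<noteq> 0 \<longrightarrow> t * (norm x)\<^sup>2 < inner x (a x))"

text \<open>With \<open>p = \<bar>b\<bar>\<close> and \<open>b = a - t\<close>, the projection is the one onto \<open>ker (p + b)\<close>.  It is obtained as the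
  complement of the projection onto the closed range of \<open>p + b\<close>, because everything commuting with
  \<open>a\<close> leaves both that range and its orthogonal complement \<open>ker (p + b)\<close> invariant.\<close>

lemma spectral_cut_exists:
  fixes a :: "'a::{real_inner,banach} op"
  assumes sym: "symmetric_op a"
  obtains e Y k where "spectral_cut a t e" and "e \<in> real_commutant (real_commutant {a})"
    and "0 \<le> k" and "norm Y \<le> 1" and "Y \<in> real_commutant (real_commutant {a})"
    and "(k *\<^sub>R (id_blinfun - Y)) o\<^sub>L e = (t *\<^sub>R id_blinfun - a) o\<^sub>L e"
    and "(k *\<^sub>R (id_blinfun - Y)) o\<^sub>L (id_blinfun - e) = (a - t *\<^sub>R id_blinfun) o\<^sub>L (id_blinfun - e)"
proof -
  define b where "b = a - t *\<^sub>R id_blinfun"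
  have bx: "b x = a x - t *\<^sub>R x" for x by (simp add: b_def blinfun.bilinear_simps)
  have b_sym: "symmetric_op b"
    using sym by (simp add: symmetric_op_def bx inner_diff)
  obtain Y k where Y: "0 \<le> k" "norm Y \<le> 1" "symmetric_op Y"
    "Y \<in> real_commutant (real_commutant {b})"
    "(k *\<^sub>R (id_blinfun - Y)) o\<^sub>L (k *\<^sub>R (id_blinfun - Y)) = b o\<^sub>L b"
    using op_absolute_value[OF b_sym] by blast
  have a_in: "a \<in> real_commutant (real_commutant {a})" using subset_real_bicommutant by blast
  have b_in: "b \<in> real_commutant (real_commutant {a})"
    unfolding b_def
    by (intro real_commutant_diff real_commutant_scaleR a_in id_in_real_commutant)
  then have Y_in: "Y \<in> real_commutant (real_commutant {a})"
    using real_bicommutant_least[of "{b}" "{a}"] Y(4) by blast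
  define p where "p = k *\<^sub>R (id_blinfun - Y)"
  have p_in: "p \<in> real_commutant (real_commutant {a})"
    unfolding p_def by (intro real_commutant_diff real_commutant_scaleR Y_in id_in_real_commutant)
  have b_comm: "b (T x) = T (b x)" and p_comm: "p (T x) = T (p x)"
    if "T \<in> real_commutant {a}" for T x
    using b_in p_in that by (auto dest: real_commutantD)
  have p_sym: "symmetric_op p"
    using Y(3) by (simp add: symmetric_op_def p_def blinfun.bilinear_simps inner_diff)
  have p_sq: "p (p x) = b (b x)" for x
    using arg_cong[OF Y(5), of "\<lambda>T. blinfun_apply T x"] by (simp add: p_def)
  have "b \<in> real_commutant {a}"
    by (rule real_commutantI) (auto simp: bx blinfun.bilinear_simps)
  then have pb: "p (b x) = b (p x)" for x by (rule p_comm)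
  have p_pos: "0 \<le> inner x (p x)" for x
  proof -
    have "inner x (Y x) \<le> norm x * norm (Y x)" by (rule norm_cauchy_schwarz)
    also have "\<dots> \<le> norm x * (1 * norm x)"
      by (intro mult_left_mono order_trans[OF norm_blinfun] mult_right_mono Y) auto
    finally show ?thesis
      using Y(1) by (simp add: p_def blinfun.bilinear_simps inner_diff power2_norm_eq_inner
          flip: power2_eq_square)
  qed
  \<comment> \<open>A vanishing form is the equality case of Cauchy-Schwarz for x and Y x, which
    forces Y x = x unless k = 0.\<close>
  have p_zero: "p x = 0" if "inner x (p x) = 0" for x
  proof -
    have "k = 0 \<or> inner x (Y x) = (norm x)\<^sup>2"
      using that by (auto simp: p_def blinfun.bilinear_simps inner_diff power2_norm_eq_inner)
    moreover have "Y x = x" if *: "inner x (Y x) = (norm x)\<^sup>2"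
    proof -
      have "norm (Y x) \<le> 1 * norm x"
        by (intro order_trans[OF norm_blinfun] mult_right_mono Y) auto
      then have "(norm (Y x))\<^sup>2 \<le> (norm x)\<^sup>2" by (simp add: power_mono)
      moreover have "(norm (Y x - x))\<^sup>2 = (norm (Y x))\<^sup>2 - 2 * inner x (Y x) + (norm x)\<^sup>2"
        unfolding power2_norm_eq_inner by (simp add: inner_diff inner_commute)
      ultimately have "(norm (Y x - x))\<^sup>2 \<le> 0" using * by linarith
      then show ?thesis by simp
    qed
    ultimately show ?thesis by (auto simp: p_def blinfun.bilinear_simps)
  qed
  define W where "W = range (\<lambda>x. p x + b x)"
  obtain f where f: "orth_proj f" "\<And>w. w \<in> W \<Longrightarrow> f w = w"
    "\<And>x. (\<And>w. w \<in> W \<Longrightarrow> inner x w = 0) \<Longrightarrow> f x = 0" "\<And>x. f x \<in> closure (span W)"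
    using closure_span_projection[of W] by blast
  \<comment> \<open>The orthogonal complement of the range of a symmetric operator is its
    kernel.\<close>
  have W_perp: "(\<forall>w\<in>W. inner x w = 0) \<longleftrightarrow> p x + b x = 0" for x
  proof -
    have "inner x (p y + b y) = inner (p x + b x) y" for y
      using p_sym b_sym by (simp add: inner_add symmetric_opD)
    then have "(\<forall>w\<in>W. inner x w = 0) \<longleftrightarrow> (\<forall>y. inner (p x + b x) y = 0)"
      by (auto simp: W_def)
    then show ?thesis by (metis inner_eq_zero_iff inner_zero_left)
  qed
  have f_comm: "T (f x) = f (T x)" if T: "T \<in> real_commutant {a}" for T x
  proof (rule closure_span_projection_commute[OF f])
    show "T w \<in> W" if "w \<in> W" for w
      using that by (auto simp: W_def b_comm[OF T] p_comm[OF T] blinfun.bilinear_simps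
          simp flip: blinfun.add_right intro!: image_eqI[of _ _ "T _"])
    show "inner (T x) w = 0" if "\<And>w. w \<in> W \<Longrightarrow> inner x w = 0" "w \<in> W" for x w
    proof -
      have "p x + b x = 0" using that W_perp by blast
      then have "T (p x + b x) = 0" by (simp add: blinfun.bilinear_simps)
      then have "p (T x) + b (T x) = 0" by (simp add: b_comm[OF T] p_comm[OF T] blinfun.bilinear_simps)
      then show ?thesis using that(2) W_perp by blast
    qed
  qed
  define e where "e = id_blinfun - f"
  have ex: "e x = x - f x" for x by (simp add: e_def blinfun.bilinear_simps)
  have e_proj: "orth_proj e" using f(1) by (simp add: e_def orth_proj_compl)
  have "f \<in> real_commutant (real_commutant {a})"
    by (rule real_commutantI) (simp add: f_comm)
  then have e_in: "e \<in> real_commutant (real_commutant {a})"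
    unfolding e_def by (intro real_commutant_diff id_in_real_commutant)
  have on_e: "p (e x) = - b (e x)" for x
  proof -
    have "\<forall>w\<in>W. inner (e x) w = 0"
      using f(1,2) by (simp add: ex inner_diff orth_proj_sym)
    then show ?thesis unfolding W_perp by (simp add: eq_neg_iff_add_eq_0)
  qed
  \<comment> \<open>\<open>p\<close> and \<open>b\<close> commute and have equal squares, so p - b
    annihilates the range of p + b.\<close>
  have on_f: "p (f x) = b (f x)" for x
  proof -
    have "(p - b) (f x) = 0"
      by (rule vanishes_on_closure_span[OF _ f(4)])
        (auto simp: W_def blinfun.bilinear_simps p_sq pb)
    then show ?thesis by (simp add: blinfun.bilinear_simps)
  qed
  have "spectral_cut a t e"
    unfolding spectral_cut_def
  proof (intro conjI allI impI)
    show "orth_proj e" by (rule e_proj)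
    show "a (e x) = e (a x)" for x
      using real_commutantD[OF e_in, of a x] by (simp add: real_commutant_def)
    show "inner (e x) (a (e x)) \<le> t * (norm (e x))\<^sup>2" for x
      using p_pos[of "e x"] unfolding on_e bx
      by (simp add: inner_diff power2_norm_eq_inner)
    show "t * (norm x)\<^sup>2 < inner x (a x)" if "e x = 0" "x \<noteq> 0" for x
    proof -
      have fx: "f x = x" using that(1) by (simp add: ex)
      \<comment> \<open>This gives the strict inequality: if the form of \<open>b\<close> vanished
        at \<open>x\<close>, then p x = b x = 0, and \<open>x\<close> would lie in the kernel of p +
        b, where \<open>f\<close> is 0.\<close>
      have "inner x (b x) \<noteq> 0"
      proof
        assume "inner x (b x) = 0"
        then have "p x = 0" using p_zero on_f[of x] fx by metis
        then have "p x + b x = 0" using on_f[of x] fx by simp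
        then have "f x = 0" using W_perp f(3) by blast
        then show False using fx that(2) by simp
      qed
      then have "inner x (b x) > 0"
        using p_pos[of x] on_f[of x] fx by simp
      then show ?thesis by (simp add: bx inner_diff power2_norm_eq_inner)
    qed
  qed
  moreover have "(k *\<^sub>R (id_blinfun - Y)) o\<^sub>L e = (t *\<^sub>R id_blinfun - a) o\<^sub>L e"
    unfolding p_def[symmetric]
    by (rule blinfun_eqI) (simp add: on_e bx blinfun.bilinear_simps)
  moreover have "(k *\<^sub>R (id_blinfun - Y)) o\<^sub>L (id_blinfun - e) =
      (a - t *\<^sub>R id_blinfun) o\<^sub>L (id_blinfun - e)"
    unfolding p_def[symmetric] b_def[symmetric]
    by (rule blinfun_eqI) (simp add: on_f ex blinfun.bilinear_simps)
  ultimately show thesis using that e_in Y(1,2) Y_in by blast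
qed

text \<open>A vector in the range of the lower cut and in the kernel of the upper one would have a
  form value both at most s and greater than t. Producing such a vector requires the two cuts to
  commute, which the definition does not provide directly.\<close>

lemma spectral_cut_mono:
  fixes a :: "'a::{real_inner,banach} op"
  assumes sym: "symmetric_op a" and e: "spectral_cut a s e" and f: "spectral_cut a t f" and "s \<le> t"
  shows "f (e x) = e x"
proof -
  have *: "g (h x) = h x \<and> h (g x) = h x"
    if h: "spectral_cut a u h" and g: "spectral_cut a v g" and "u \<le> v"
      and comm: "\<And>x. g (h x) = h (g x)" for g h u v x
  proof -
    define y where "y = h (x - g x)"
    have hy: "h y = y" and gy: "g y = 0"
      using h g by (auto simp: y_def spectral_cut_def orth_proj_idem comm blinfun.bilinear_simps)
    have "inner y (a y) \<le> u * (norm y)\<^sup>2" using h hy by (metis spectral_cut_def)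
    also have "\<dots> \<le> v * (norm y)\<^sup>2" using \<open>u \<le> v\<close> by (simp add: mult_right_mono)
    finally have "y = 0" using g gy by (auto simp: spectral_cut_def not_less[symmetric])
    then have "h (g x) = h x" by (simp add: y_def blinfun.bilinear_simps)
    then show ?thesis using comm[of x] by simp
  qed
  \<comment> \<open>A cut in the bicommutant of \<open>a\<close> commutes with every other cut,
    since all cuts commute with \<open>a\<close>. Hence an arbitrary cut equals the constructed one,
    and commutation becomes available for all.\<close>
  have uniq: "g = h" if h: "spectral_cut a u h" "h \<in> real_commutant (real_commutant {a})"
    and g: "spectral_cut a u g" for g h u
  proof -
    have "g \<in> real_commutant {a}"
      using g by (intro real_commutantI) (simp add: spectral_cut_def)
    then have comm: "h (g x) = g (h x)" for x using real_commutantD[OF h(2)] by metis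
    show ?thesis
      using *[OF h(1) g] *[OF g h(1)] comm by (metis order_refl blinfun_eqI)
  qed
  obtain e' where e': "spectral_cut a s e'" "e' \<in> real_commutant (real_commutant {a})"
    using spectral_cut_exists[OF sym] by metis
  have "e = e'" using uniq e e' by blast
  moreover have "f \<in> real_commutant {a}"
    using f by (intro real_commutantI) (simp add: spectral_cut_def)
  ultimately have "f (e x) = e (f x)" for x using real_commutantD[OF e'(2)] by metis
  then show ?thesis using *[OF e f \<open>s \<le> t\<close>] by blast
qed

lemma spectral_cut_unique:
  fixes a :: "'a::{real_inner,banach} op"
  assumes "symmetric_op a" "spectral_cut a t e" "spectral_cut a t f"
  shows "e = f"
proof (rule blinfun_eqI)
  fix x
  have "f (e x) = e x" "e (f x) = f x" for x
    using spectral_cut_mono[OF assms(1)] assms(2,3) by auto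
  moreover have "(\<forall>x. f (e x) = e x) \<longleftrightarrow> (\<forall>x. e (f x) = e x)"
    by (rule orth_proj_absorb_swap) (use assms in \<open>auto simp: spectral_cut_def\<close>)
  ultimately show "e x = f x" by metis
qed

lemma spectral_cut_bicommutant:
  fixes a :: "'a::{real_inner,banach} op"
  assumes "symmetric_op a" "spectral_cut a t e"
  shows "e \<in> real_commutant (real_commutant {a})"
  using spectral_cut_exists[OF assms(1)] spectral_cut_unique assms by metis

lemma spectral_cut_large:
  assumes "spectral_cut a t e" "norm a \<le> t"
  shows "e = id_blinfun"
proof (rule blinfun_eqI)
  fix x
  have "x - e x = 0"
  proof (rule ccontr)
    assume ne: "x - e x \<noteq> 0"
    have "e (x - e x) = 0" using assms by (simp add: spectral_cut_def orth_proj_idem blinfun.bilinear_simps)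
    then have "t * (norm (x - e x))\<^sup>2 < inner (x - e x) (a (x - e x))"
      using assms ne by (simp add: spectral_cut_def)
    also have "\<dots> \<le> norm (x - e x) * (norm a * norm (x - e x))"
      by (rule order_trans[OF norm_cauchy_schwarz]) (intro mult_left_mono norm_blinfun norm_ge_zero)
    also have "\<dots> = norm a * (norm (x - e x))\<^sup>2" by (simp add: power2_eq_square)
    finally have "t * (norm (x - e x))\<^sup>2 < norm a * (norm (x - e x))\<^sup>2" .
    then show False using assms(2) by (simp add: mult_less_cancel_right)
  qed
  then show "e x = id_blinfun x" by simp
qed

text \<open>The bound is strict because cuts belong to closed half-lines: at t = - norm a there may
  be an eigenspace.\<close>

lemma spectral_cut_small:
  assumes "spectral_cut a t e" "t < - norm a"
  shows "e = 0"
proof (rule blinfun_eqI)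
  fix x
  have "- (norm a * (norm (e x))\<^sup>2) \<le> inner (e x) (a (e x))"
  proof -
    have "\<bar>inner (e x) (a (e x))\<bar> \<le> norm (e x) * (norm a * norm (e x))"
      by (rule order_trans[OF Cauchy_Schwarz_ineq2]) (intro mult_left_mono norm_blinfun norm_ge_zero)
    then show ?thesis by (simp add: power2_eq_square mult_ac)
  qed
  also have "\<dots> \<le> t * (norm (e x))\<^sup>2" using assms(1) unfolding spectral_cut_def by blast
  finally have "0 \<le> (t + norm a) * (norm (e x))\<^sup>2" by (simp add: algebra_simps)
  then have "e x = 0" using assms(2) by (simp add: zero_le_mult_iff)
  then show "e x = (0 :: 'a op) x" by simp
qed

section \<open>Projection-valued measures\<close>

text \<open>The squared norms of Q n x increase and are bounded, and by Pythagoras their differences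
  are the squared distances between the vectors; so the sequence is Cauchy at every
  \<open>x\<close>.\<close>

lemma orth_proj_incseq_limit:
  fixes Q :: "nat \<Rightarrow> 'a::{real_inner,banach} op"
  assumes Q: "\<And>n. orth_proj (Q n)" and inc: "\<And>n x. Q (Suc n) (Q n x) = Q n x"
  obtains L where "orth_proj L" and "\<And>x. (\<lambda>n. Q n x) \<longlonglongrightarrow> L x"
proof -
  have le: "Q (n + k) (Q n x) = Q n x" for n k x
    by (induction k) (simp_all add: Q orth_proj_idem, metis inc)
  have ge: "Q n (Q (n + k) x) = Q n x" for n k x
    using le orth_proj_absorb_swap[OF Q[of n] Q[of "n + k"]] by blast
  have dist: "(norm (Q (n + k) x - Q n x))\<^sup>2 = (norm (Q (n + k) x))\<^sup>2 - (norm (Q n x))\<^sup>2" for n k x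
    using orth_proj_pythagoras[OF Q[of n], of "Q (n + k) x"] by (simp add: ge)
  have conv: "convergent (\<lambda>n. Q n x)" for x
  proof -
    have "incseq (\<lambda>n. (norm (Q n x))\<^sup>2)"
    proof (rule incseq_SucI)
      show "(norm (Q n x))\<^sup>2 \<le> (norm (Q (Suc n) x))\<^sup>2" for n
        using dist[of n 1 x] zero_le_power2[of "norm (Q (n + 1) x - Q n x)"] by simp
    qed
    moreover have "(norm (Q n x))\<^sup>2 \<le> (norm x)\<^sup>2" for n
      by (intro power_mono orth_proj_norm_le Q) simp
    ultimately have "convergent (\<lambda>n. (norm (Q n x))\<^sup>2)"
      using incseq_convergent unfolding convergent_def by blast
    then have C: "Cauchy (\<lambda>n. (norm (Q n x))\<^sup>2)" by (rule convergent_Cauchy)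
    have "Cauchy (\<lambda>n. Q n x)"
    proof (rule metric_CauchyI)
      fix e :: real assume e: "e > 0"
      then obtain N where N: "\<And>m n. m \<ge> N \<Longrightarrow> n \<ge> N \<Longrightarrow>
          dist ((norm (Q m x))\<^sup>2) ((norm (Q n x))\<^sup>2) < e\<^sup>2"
        using metric_CauchyD[OF C, of "e\<^sup>2"] by auto
      have *: "dist (Q m x) (Q n x) < e" if "n \<ge> N" "m \<ge> n" for m n
      proof -
        have "(norm (Q m x - Q n x))\<^sup>2 < e\<^sup>2"
          using dist[of n "m - n" x] N[of m n] that by (simp add: dist_real_def)
        then show ?thesis using e by (simp add: dist_norm power_less_imp_less_base)
      qed
      have "dist (Q m x) (Q n x) < e" if "m \<ge> N" "n \<ge> N" for m n
        using *[of n m] *[of m n] that by (cases "m \<ge> n") (auto simp: dist_commute)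
      then show "\<exists>N. \<forall>m\<ge>N. \<forall>n\<ge>N. dist (Q m x) (Q n x) < e" by blast
    qed
    then show ?thesis by (rule Cauchy_convergent)
  qed
  define l where "l x = lim (\<lambda>n. Q n x)" for x
  have l: "(\<lambda>n. Q n x) \<longlonglongrightarrow> l x" for x
    using conv by (simp add: l_def convergent_LIMSEQ_iff)
  have "bounded_linear l"
  proof (rule bounded_linear_intro)
    show "l (x + y) = l x + l y" for x y
      using tendsto_add[OF l[of x] l[of y]] LIMSEQ_unique[OF l[of "x + y"]]
      by (simp add: blinfun.bilinear_simps)
    show "l (c *\<^sub>R x) = c *\<^sub>R l x" for c x
      using tendsto_scaleR[OF tendsto_const l[of x], of c] LIMSEQ_unique[OF l[of "c *\<^sub>R x"]]
      by (simp add: blinfun.bilinear_simps)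
    show "norm (l x) \<le> norm x * 1" for x
      using LIMSEQ_le_const2[OF tendsto_norm[OF l[of x]], of "norm x"] orth_proj_norm_le[OF Q]
      by simp
  qed
  then have lL: "Blinfun l x = l x" for x by (simp add: bounded_linear_Blinfun_apply)
  show thesis
  proof
    show lim: "(\<lambda>n. Q n x) \<longlonglongrightarrow> Blinfun l x" for x using l by (simp add: lL)
    have sym: "symmetric_op (Blinfun l)"
      by (rule symmetric_op_limit[OF _ lim]) (simp add: Q orth_proj_symmetric)
    \<comment> \<open>Each Q n absorbs the later ones and hence the limit; letting n grow makes the
      limit idempotent.\<close>
    have "Q n (l x) = Q n x" for n x
    proof -
      have "(\<lambda>k. Q n (Q (k + n) x)) \<longlonglongrightarrow> Q n (l x)"
        by (intro blinfun.tendsto tendsto_const LIMSEQ_ignore_initial_segment l)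
      then show ?thesis
        using ge by (simp add: add.commute[of _ n] LIMSEQ_const_iff)
    qed
    then have "l (l x) = l x" for x
      using l[of "l x"] l[of x] LIMSEQ_unique by simp
    then show "orth_proj (Blinfun l)"
      using sym by (intro orth_projI) (simp_all add: symmetric_op_def lL)
  qed
qed

lemma orth_proj_decseq_limit:
  fixes Q :: "nat \<Rightarrow> 'a::{real_inner,banach} op"
  assumes Q: "\<And>n. orth_proj (Q n)" and dec: "\<And>n x. Q n (Q (Suc n) x) = Q (Suc n) x"
  obtains L where "orth_proj L" and "\<And>x. (\<lambda>n. Q n x) \<longlonglongrightarrow> L x"
proof -
  have swap: "Q (Suc n) (Q n x) = Q (Suc n) x" for n x
    using dec orth_proj_absorb_swap[OF Q[of "Suc n"] Q[of n]] by blast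
  obtain L where L: "orth_proj L" "\<And>x. (\<lambda>n. (id_blinfun - Q n) x) \<longlonglongrightarrow> L x"
    using orth_proj_incseq_limit[of "\<lambda>n. id_blinfun - Q n"] orth_proj_compl[OF Q] swap
    by (auto simp: blinfun.bilinear_simps Q orth_proj_idem)
  show thesis
  proof
    show "orth_proj (id_blinfun - L)" using L(1) by (rule orth_proj_compl)
    show "(\<lambda>n. Q n x) \<longlonglongrightarrow> (id_blinfun - L) x" for x
      using tendsto_diff[OF tendsto_const[of x] L(2)[of x]] by (simp add: blinfun.bilinear_simps)
  qed
qed

lemma orth_proj_add:
  fixes P Q :: "'a::real_inner op"
  assumes "orth_proj P" "orth_proj Q" and PQ: "\<And>x. P (Q x) = 0"
  shows "orth_proj (P + Q)" and "Q (P x) = 0"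
proof -
  have "inner (Q (P x)) y = 0" for x y
    using assms by (simp add: orth_proj_sym)
  then show QP: "Q (P x) = 0" for x by (metis inner_eq_zero_iff)
  show "orth_proj (P + Q)"
    by (rule orth_projI)
      (use assms QP in \<open>simp_all add: blinfun.bilinear_simps inner_add orth_proj_sym orth_proj_idem\<close>)
qed

lemma orth_proj_sums:
  fixes P :: "nat \<Rightarrow> 'a::{real_inner,banach} op"
  assumes P: "\<And>n. orth_proj (P n)" and orth: "\<And>m n x. m \<noteq> n \<Longrightarrow> P m (P n x) = 0"
  obtains L where "orth_proj L" and "\<And>x. (\<lambda>n. P n x) sums L x"
proof -
  define Q where "Q n = (\<Sum>i<n. P i)" for n
  have Qx: "Q n x = (\<Sum>i<n. P i x)" for n x by (simp add: Q_def blinfun.sum_left)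
  have PQ: "P n (Q n x) = 0" for n x
    by (simp add: Qx blinfun.sum_right orth)
  have Q: "orth_proj (Q n)" for n
  proof (induction n)
    case (Suc n)
    have "orth_proj (P n + Q n)" by (rule orth_proj_add(1)[OF P Suc PQ])
    then show ?case by (simp add: Q_def add.commute)
  qed (simp add: Q_def orth_proj_0)
  have "Q (Suc n) (Q n x) = Q n x" for n x
  proof -
    have "Q (Suc n) = Q n + P n" by (simp add: Q_def)
    then show ?thesis by (simp add: blinfun.bilinear_simps PQ orth_proj_idem Q)
  qed
  then obtain L where "orth_proj L" "\<And>x. (\<lambda>n. Q n x) \<longlonglongrightarrow> L x"
    using orth_proj_incseq_limit[of Q] Q by blast
  then show thesis using that by (simp add: sums_def Qx)
qed

text \<open>\<open>f t\<close> plays the role of \<open>\<chi>\<^bsub>(-\<infinity>, t]\<^esub>(a)\<close>.\<close>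

definition projection_resolution :: "(real \<Rightarrow> 'a::real_inner op) \<Rightarrow> bool" where
  "projection_resolution f \<longleftrightarrow> (\<forall>t. orth_proj (f t)) \<and>
     (\<forall>s t x. s \<le> t \<longrightarrow> f t (f s x) = f s x) \<and>
     (\<forall>t x. continuous (at_right t) (\<lambda>s. inner x (f s x))) \<and>
     (\<exists>M. \<forall>t. (t < -M \<longrightarrow> f t = 0) \<and> (M \<le> t \<longrightarrow> f t = id_blinfun))"

text \<open>f t is the infimum of the d u with u > t; by monotonicity the points t + 1/(n+1)
  suffice. The last two properties sandwich \<open>f\<close>: d t is below f t, and f s is below d t
  for s < t.\<close>

lemma projection_family_right_limit:
  fixes d :: "real \<Rightarrow> 'a::{real_inner,banach} op"
  assumes d: "\<And>t. orth_proj (d t)" and mono: "\<And>s t x. s \<le> t \<Longrightarrow> d t (d s x) = d s x"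
    and bd: "\<exists>M. \<forall>t. (t < -M \<longrightarrow> d t = 0) \<and> (M \<le> t \<longrightarrow> d t = id_blinfun)"
  obtains f where "projection_resolution f"
    and "\<And>t x. (\<lambda>n. d (t + 1 / real (Suc n)) x) \<longlonglongrightarrow> f t x"
    and "\<And>t x. f t (d t x) = d t x" and "\<And>s t x. s < t \<Longrightarrow> d t (f s x) = f s x"
proof -
  have "\<exists>L. orth_proj L \<and> (\<forall>x. (\<lambda>n. d (t + 1 / real (Suc n)) x) \<longlonglongrightarrow> L x)" for t
  proof -
    have "d (t + 1 / real (Suc n)) (d (t + 1 / real (Suc (Suc n))) x) = d (t + 1 / real (Suc (Suc n))) x" for n x
      by (rule mono) (simp add: frac_le)
    then obtain L where "orth_proj L" "\<And>x. (\<lambda>n. d (t + 1 / real (Suc n)) x) \<longlonglongrightarrow> L x"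
      by (rule orth_proj_decseq_limit[of "\<lambda>n. d (t + 1 / real (Suc n))", OF d]) (rule that)
    then show ?thesis by blast
  qed
  then obtain f where f: "\<And>t. orth_proj (f t)"
    and lim: "\<And>t x. (\<lambda>n. d (t + 1 / real (Suc n)) x) \<longlonglongrightarrow> f t x"
    by metis
  have fd: "f t (d t x) = d t x" for t x
  proof -
    have "(\<lambda>n. d (t + 1 / real (Suc n)) (d t x)) = (\<lambda>n. d t x)"
      by (intro ext mono) simp
    then show ?thesis using lim[of t "d t x"] by (simp add: LIMSEQ_const_iff)
  qed
  have df: "d t (f s x) = f s x" if "s < t" for s t x
  proof -
    have "(\<lambda>n. d t (d (s + 1 / real (Suc n)) x)) \<longlonglongrightarrow> d t (f s x)"
      by (intro blinfun.tendsto tendsto_const lim)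
    moreover have "\<forall>\<^sub>F n in sequentially. d t (d (s + 1 / real (Suc n)) x) = d (s + 1 / real (Suc n)) x"
    proof -
      have "(\<lambda>n. s + 1 / real (Suc n)) \<longlonglongrightarrow> s + 0"
        by (intro tendsto_intros LIMSEQ_Suc[OF lim_1_over_n])
      then have "\<forall>\<^sub>F n in sequentially. s + 1 / real (Suc n) < t"
        using that by (intro order_tendstoD(2)) auto
      then show ?thesis by eventually_elim (simp add: mono)
    qed
    ultimately have "(\<lambda>n. d (s + 1 / real (Suc n)) x) \<longlonglongrightarrow> d t (f s x)"
      by (rule Lim_transform_eventually)
    then show ?thesis using lim LIMSEQ_unique by blast
  qed
  have le1: "inner x (f s x) \<le> inner x (d t x)" if "s < t" for s t x
    using orth_proj_le_iff[OF f[of s] d[of t]] df[OF that] by blast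
  have le2: "inner x (d t x) \<le> inner x (f t x)" for t x
    using orth_proj_le_iff[OF d[of t] f[of t]] fd by blast
  have f_mono: "inner x (f s x) \<le> inner x (f t x)" if "s \<le> t" for s t x
    using le1[of s t x] le2[of x t] that by (cases "s = t") auto
  have "continuous (at_right t) (\<lambda>s. inner x (f s x))" for t x
    unfolding continuous_within
  proof (rule order_tendstoI)
    fix a assume "a < inner x (f t x)"
    then show "\<forall>\<^sub>F s in at_right t. a < inner x (f s x)"
      using f_mono unfolding eventually_at_filter
      by (intro always_eventually) (auto intro: less_le_trans)
  next
    fix a assume a: "inner x (f t x) < a"
    have "(\<lambda>n. inner x (d (t + 1 / real (Suc n)) x)) \<longlonglongrightarrow> inner x (f t x)"
      by (intro tendsto_intros lim)
    then have "\<forall>\<^sub>F n in sequentially. inner x (d (t + 1 / real (Suc n)) x) < a"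
      using a by (rule order_tendstoD)
    then obtain n where n: "inner x (d (t + 1 / real (Suc n)) x) < a"
      using eventually_happens trivial_limit_sequentially by blast
    have "inner x (f s x) < a" if "s < t + 1 / real (Suc n)" for s
      using le1[OF that, of x] n by linarith
    moreover have "t < t + 1 / real (Suc n)" by simp
    ultimately show "\<forall>\<^sub>F s in at_right t. inner x (f s x) < a"
      unfolding eventually_at_right_field by blast
  qed
  moreover have "\<exists>M. \<forall>t. (t < -M \<longrightarrow> f t = 0) \<and> (M \<le> t \<longrightarrow> f t = id_blinfun)"
  proof -
    obtain M where M: "\<And>t. t < -M \<Longrightarrow> d t = 0" "\<And>t. M \<le> t \<Longrightarrow> d t = id_blinfun"
      using bd by blast
    have "f t = 0" if "t < -M" for t
    proof (rule blinfun_eqI)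
      fix x
      \<comment> \<open>(t - M) / 2 is the midpoint of t and -M: above t, so that \<open>df\<close>
        applies, and still below -M, where \<open>d\<close> vanishes.\<close>
      show "f t x = (0 :: 'a op) x"
        using df[of t "(t - M) / 2" x] M(1)[of "(t - M) / 2"] that by (simp add: field_simps)
    qed
    moreover have "f t = id_blinfun" if "M \<le> t" for t
      by (rule blinfun_eqI) (use fd[of t] M(2)[OF that] in simp)
    ultimately show ?thesis by blast
  qed
  ultimately have "projection_resolution f"
    unfolding projection_resolution_def
    using f f_mono orth_proj_le_iff[OF f f] by blast
  then show thesis using that lim fd df by blast
qed

section \<open>Projection-valued measures and their scalar measures\<close>

definition pvm :: "(real set \<Rightarrow> 'a::real_inner op) \<Rightarrow> bool" where
  "pvm E \<longleftrightarrow> (\<forall>B\<in>sets borel. orth_proj (E B)) \<and> E {} = 0 \<and> (\<exists>M. E {-M..M} = id_blinfun) \<and>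
     (\<forall>F :: nat \<Rightarrow> real set. range F \<subseteq> sets borel \<longrightarrow> disjoint_family F \<longrightarrow>
        (\<forall>x. (\<lambda>n. E (F n) x) sums E (\<Union>n. F n) x))"

definition quad_measure :: "(real set \<Rightarrow> 'a::real_inner op) \<Rightarrow> 'a \<Rightarrow> real measure" where
  "quad_measure E x = measure_of UNIV (sets borel) (\<lambda>B. ennreal (inner x (E B x)))"

lemma sets_quad_measure [simp, measurable_cong]: "sets (quad_measure E x) = sets borel"
  and space_quad_measure [simp]: "space (quad_measure E x) = UNIV"
  by (simp_all add: quad_measure_def space_borel[symmetric] del: space_borel)

lemma
  fixes E :: "real set \<Rightarrow> 'a::real_inner op"
  assumes E: "pvm E"
  shows emeasure_quad_measure:
      "B \<in> sets borel \<Longrightarrow> emeasure (quad_measure E x) B = ennreal (inner x (E B x))"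
    and measure_quad_measure:
      "B \<in> sets borel \<Longrightarrow> measure (quad_measure E x) B = inner x (E B x)"
    and finite_borel_quad_measure: "finite_borel_measure (quad_measure E x)"
proof -
  have nonneg: "0 \<le> inner x (E B x)" if "B \<in> sets borel" for B
    using E that by (simp add: pvm_def orth_proj_inner)
  have em: "emeasure (quad_measure E x) B = ennreal (inner x (E B x))" if "B \<in> sets borel" for B
  proof (rule emeasure_measure_of[OF quad_measure_def])
    show "positive (sets (quad_measure E x)) (\<lambda>B. ennreal (inner x (E B x)))"
      using E by (simp add: positive_def pvm_def)
    show "countably_additive (sets (quad_measure E x)) (\<lambda>B. ennreal (inner x (E B x)))"
    proof (rule countably_additiveI)
      fix A :: "nat \<Rightarrow> real set"
      assume A: "range A \<subseteq> sets (quad_measure E x)" "disjoint_family A"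
      then have "(\<lambda>n. E (A n) x) sums E (\<Union>n. A n) x"
        using E by (simp add: pvm_def)
      then have "(\<lambda>n. inner x (E (A n) x)) sums inner x (E (\<Union>n. A n) x)"
        by (rule bounded_linear.sums[OF bounded_linear_inner_right])
      then show "(\<Sum>i. ennreal (inner x (E (A i) x))) = ennreal (inner x (E (\<Union>i. A i) x))"
        using A by (intro suminf_ennreal_eq) (auto intro!: nonneg)
    qed
  qed (use that in auto)
  then show "B \<in> sets borel \<Longrightarrow> emeasure (quad_measure E x) B = ennreal (inner x (E B x))"
    and "B \<in> sets borel \<Longrightarrow> measure (quad_measure E x) B = inner x (E B x)"
    by (simp_all add: measure_def nonneg)
  show "finite_borel_measure (quad_measure E x)"
    by (intro finite_borel_measure.intro finite_measureI finite_borel_measure_axioms.intro)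
      (simp_all add: em)
qed

lemma pvm_mono:
  fixes E :: "real set \<Rightarrow> 'a::real_inner op"
  assumes E: "pvm E" and "A \<in> sets borel" "B \<in> sets borel" "A \<subseteq> B"
  shows "inner x (E A x) \<le> inner x (E B x)" and "E B (E A x) = E A x"
proof -
  interpret finite_borel_measure "quad_measure E x" for x
    using E by (rule finite_borel_quad_measure)
  have *: "inner x (E A x) \<le> inner x (E B x)" for x
    using finite_measure_mono[of A B x] assms by (simp add: measure_quad_measure)
  then show "inner x (E A x) \<le> inner x (E B x)" .
  show "E B (E A x) = E A x"
    using * orth_proj_le_iff[of "E A" "E B"] assms by (simp add: pvm_def)
qed

lemma pvm_UNIV:
  fixes E :: "real set \<Rightarrow> 'a::real_inner op"
  assumes E: "pvm E"
  shows "E UNIV = id_blinfun"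
proof (rule blinfun_eqI)
  obtain M where M: "E {-M..M} = id_blinfun" using E by (auto simp: pvm_def)
  show "E UNIV x = id_blinfun x" for x
    using pvm_mono(2)[OF E, of "{-M..M}" UNIV x] M by simp
qed

text \<open>Finite additivity is borrowed from the scalar measures and lifted to operators by
  \<open>symmetric_op_eqI\<close>.\<close>

lemma pvm_Un:
  fixes E :: "real set \<Rightarrow> 'a::real_inner op"
  assumes E: "pvm E" and B: "A \<in> sets borel" "B \<in> sets borel" "A \<inter> B = {}"
  shows "E (A \<union> B) = E A + E B"
proof (rule symmetric_op_eqI)
  interpret finite_borel_measure "quad_measure E x" for x
    using E by (rule finite_borel_quad_measure)
  have sym: "symmetric_op (E C)" if "C \<in> sets borel" for C
    using E that by (simp add: pvm_def orth_proj_symmetric)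
  show "symmetric_op (E (A \<union> B))" "symmetric_op (E A + E B)"
    using sym B by (auto simp: symmetric_op_def blinfun.bilinear_simps inner_add)
  show "inner x (E (A \<union> B) x) = inner x ((E A + E B) x)" for x
    using finite_measure_Union[of A x B] B E
    by (simp add: measure_quad_measure blinfun.bilinear_simps inner_add)
qed

lemma pvm_Compl:
  fixes E :: "real set \<Rightarrow> 'a::real_inner op"
  assumes E: "pvm E" and B: "B \<in> sets borel"
  shows "E (- B) = id_blinfun - E B"
  using pvm_Un[OF E B, of "- B"] B pvm_UNIV[OF E] by (simp add: borel_comp eq_diff_eq add.commute)

text \<open>The values on half-lines are the distribution functions of the scalar measures, which
  determine these measures and thus the forms of E B.\<close>

lemma pvm_eqI:
  fixes E E' :: "real set \<Rightarrow> 'a::real_inner op"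
  assumes E: "pvm E" and E': "pvm E'" and eq: "\<And>t. E {..t} = E' {..t}" and B: "B \<in> sets borel"
  shows "E B = E' B"
proof (rule symmetric_op_eqI)
  show "symmetric_op (E B)" "symmetric_op (E' B)"
    using E E' B by (simp_all add: pvm_def orth_proj_symmetric)
  have "quad_measure E x = quad_measure E' x" for x
    by (rule cdf_unique')
      (auto simp: finite_borel_quad_measure E E' cdf_def measure_quad_measure eq)
  then show "inner x (E B x) = inner x (E' B x)" for x
    using measure_quad_measure[OF E B] measure_quad_measure[OF E' B] by metis
qed

text \<open>The sets \<open>B\<close> for which the form \<open>x \<mapsto> \<mu>\<^sub>x B\<close> is that of a projection are a Dynkin system, where
  \<open>\<mu>\<^sub>x\<close> is the Stieltjes measure of \<open>t \<mapsto> \<langle>x, f t x\<rangle>\<close>.\<close>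

lemma projection_resolution_pvm:
  fixes f :: "real \<Rightarrow> 'a::{real_inner,banach} op"
  assumes f: "projection_resolution f"
  obtains E where "pvm E" and "\<And>t. E {..t} = f t"
    and "\<And>B. B \<in> sets borel \<Longrightarrow> E B \<in> real_commutant (real_commutant (range f))"
proof -
  have f_proj: "orth_proj (f t)" for t using f by (simp add: projection_resolution_def)
  define F where "F x t = inner x (f t x)" for x t
  define \<mu> where "\<mu> x = interval_measure (F x)" for x
  have F_mono: "F x s \<le> F x t" if "s \<le> t" for x s t
    using orth_proj_le_iff[OF f_proj f_proj, of s t] f that
    by (auto simp: F_def projection_resolution_def)
  have F_right: "continuous (at_right t) (F x)" for x t
    using f unfolding F_def projection_resolution_def by blast
  obtain M where M: "\<And>t. t < -M \<Longrightarrow> f t = 0" "\<And>t. M \<le> t \<Longrightarrow> f t = id_blinfun"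
    using f unfolding projection_resolution_def by blast
  have F_bot: "(F x \<longlongrightarrow> 0) at_bot" for x
    by (rule tendsto_eventually)
      (auto simp: eventually_at_bot_dense F_def M intro!: exI[of _ "-M"])
  have F_top: "(F x \<longlongrightarrow> (norm x)\<^sup>2) at_top" for x
    by (rule tendsto_eventually)
      (auto simp: eventually_at_top_linorder F_def M power2_norm_eq_inner intro!: exI[of _ M])
  interpret finite_borel_measure "\<mu> x" for x
    unfolding \<mu>_def
    by (rule finite_borel_measure_interval_measure[OF F_mono F_right F_bot F_top]) simp_all
  have \<mu>_Iic: "measure (\<mu> x) {..t} = inner x (f t x)" for x t
    unfolding \<mu>_def using measure_interval_measure_Iic[OF F_mono F_right F_bot] by (simp add: F_def)
  have \<mu>_UNIV: "measure (\<mu> x) UNIV = (norm x)\<^sup>2" for x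
    unfolding \<mu>_def measure_def using interval_measure_UNIV[OF F_mono F_right F_bot F_top] by simp
  have \<mu>_le: "measure (\<mu> x) B \<le> (norm x)\<^sup>2" for x B
    using bounded_measure[of x B] by (simp add: borel_UNIV \<mu>_UNIV)
  define rep where "rep B P \<longleftrightarrow> orth_proj P \<and> (\<forall>x. measure (\<mu> x) B = inner x (P x))" for B P
  have rep_unique: "P = Q" if "rep B P" "rep B Q" for B P Q
    using that by (intro symmetric_op_eqI) (auto simp: rep_def orth_proj_symmetric)
  have rep_UN: "\<exists>L. rep (\<Union>n. A n) L \<and> (\<forall>x. (\<lambda>n. P n x) sums L x)"
    if A: "range A \<subseteq> sets borel" "disjoint_family A" and P: "\<And>n. rep (A n) (P n)"
    for A :: "nat \<Rightarrow> real set" and P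
  proof -
    \<comment> \<open>For y in the range of P n, the set A n already carries the whole mass of
      \<open>\<mu> y\<close>, the squared norm of y. A disjoint A m therefore has mass 0, which is
      the squared norm of P m y.\<close>
    have orth: "P m (P n x) = 0" if "m \<noteq> n" for m n x
    proof -
      define y where "y = P n x"
      have "P n y = y" using P[of n] by (simp add: y_def rep_def orth_proj_idem)
      moreover have "measure (\<mu> y) (A m) + measure (\<mu> y) (A n) = measure (\<mu> y) (A m \<union> A n)"
        using A that by (intro finite_measure_Union[symmetric]) (auto simp: disjoint_family_on_def)
      ultimately have "(norm (P m y))\<^sup>2 + (norm y)\<^sup>2 \<le> (norm y)\<^sup>2"
        using P[of m] P[of n] \<mu>_le[of y "A m \<union> A n"]
        by (simp add: rep_def orth_proj_inner power2_norm_eq_inner[of y])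
      then show ?thesis by (simp add: y_def)
    qed
    have P_proj: "orth_proj (P n)" for n using P[of n] by (simp add: rep_def)
    obtain L where L: "orth_proj L" "\<And>x. (\<lambda>n. P n x) sums L x"
      by (rule orth_proj_sums[OF P_proj orth]) (assumption, rule that)
    have "measure (\<mu> x) (\<Union>n. A n) = inner x (L x)" for x
    proof -
      have "(\<lambda>n. measure (\<mu> x) (A n)) sums measure (\<mu> x) (\<Union>n. A n)"
        using A by (intro finite_measure_UNION) (auto simp: M_is_borel)
      moreover have "(\<lambda>n. measure (\<mu> x) (A n)) = (\<lambda>n. inner x (P n x))"
        using P by (simp add: rep_def)
      moreover have "(\<lambda>n. inner x (P n x)) sums inner x (L x)"
        by (rule bounded_linear.sums[OF bounded_linear_inner_right L(2)])
      ultimately show ?thesis using sums_unique2 by metis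
    qed
    then show ?thesis using L by (auto simp: rep_def)
  qed
  let ?C = "real_commutant (real_commutant (range f))"
  \<comment> \<open>Membership in the bicommutant is carried through the Dynkin induction together
    with the representation, so that a single choice yields both.\<close>
  have "\<exists>P. rep B P \<and> P \<in> ?C" if "B \<in> sets borel" for B
  proof (rule sigma_sets_induct_disjoint[of "range (\<lambda>t::real. {..t})" UNIV B])
    have *: "sets (borel :: real measure) = sigma_sets UNIV (range (\<lambda>t. {..t}))"
      by (subst borel_eq_atMost) simp
    then show "B \<in> sigma_sets UNIV (range (\<lambda>t. {..t}))" using that by simp
    show "Int_stable (range (\<lambda>t::real. {..t}))"
      by (auto simp: Int_stable_def)
    show "\<exists>P. rep A P \<and> P \<in> ?C" if "A \<in> range (\<lambda>t. {..t})" for A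
    proof -
      obtain t where t: "A = {..t}" using \<open>A \<in> range (\<lambda>t. {..t})\<close> by blast
      show ?thesis
        by (rule exI[of _ "f t"])
          (use subset_real_bicommutant[of "range f"] in \<open>auto simp: rep_def t \<mu>_Iic f_proj\<close>)
    qed
    show "\<exists>P. rep {} P \<and> P \<in> ?C"
      by (rule exI[of _ 0]) (simp add: rep_def orth_proj_0 zero_in_real_commutant)
    show "\<exists>P. rep (UNIV - A) P \<and> P \<in> ?C"
      if A: "A \<in> sigma_sets UNIV (range (\<lambda>t. {..t}))" and ex: "\<exists>P. rep A P \<and> P \<in> ?C" for A
    proof -
      obtain P where P: "rep A P" "P \<in> ?C" using ex by blast
      have "rep (UNIV - A) (id_blinfun - P)"
        using P(1) A finite_measure_compl[of A] *
        by (auto simp: rep_def orth_proj_compl borel_UNIV \<mu>_UNIV blinfun.bilinear_simps inner_diff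
            power2_norm_eq_inner)
      then show ?thesis using P(2) real_commutant_diff id_in_real_commutant by blast
    qed
    show "\<exists>P. rep (\<Union>n. A n) P \<and> P \<in> ?C"
      if A: "disjoint_family A" "range A \<subseteq> sigma_sets UNIV (range (\<lambda>t. {..t}))"
        and ex: "\<And>i. \<exists>P. rep (A i) P \<and> P \<in> ?C" for A :: "nat \<Rightarrow> real set"
    proof -
      obtain P where P: "\<And>n. rep (A n) (P n)" "\<And>n. P n \<in> ?C" using ex by metis
      obtain L where L: "rep (\<Union>n. A n) L" "\<And>x. (\<lambda>n. P n x) sums L x"
        using rep_UN[OF _ A(1) P(1)] A(2) * by blast
      have "L \<in> ?C"
      proof (rule real_commutant_limit)
        show "(\<Sum>i<n. P i) \<in> ?C" for n
          by (induction n) (simp_all add: zero_in_real_commutant real_commutant_add P)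
        show "(\<lambda>n. blinfun_apply (\<Sum>i<n. P i) x) \<longlonglongrightarrow> blinfun_apply L x" for x
          using L(2)[of x] by (simp add: sums_def blinfun.sum_left)
      qed
      then show ?thesis using L(1) by blast
    qed
  qed auto
  then obtain E where E: "\<And>B. B \<in> sets borel \<Longrightarrow> rep B (E B) \<and> E B \<in> ?C" by metis
  show thesis
  proof
    show "E B \<in> ?C" if "B \<in> sets borel" for B using E that by blast
    show Iic: "E {..t} = f t" for t
      using E[of "{..t}"] f_proj by (intro rep_unique[of "{..t}"]) (auto simp: rep_def \<mu>_Iic)
    have "rep {} 0" by (simp add: rep_def orth_proj_0)
    then have E0: "E {} = 0" using E[of "{}"] rep_unique by auto
    \<comment> \<open>The extra 1 puts the left endpoint strictly below -M, where the resolution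
      vanishes.\<close>
    have bd: "\<exists>N. E {-N..N} = id_blinfun"
    proof (intro exI rep_unique[of "{-(\<bar>M\<bar> + 1)..\<bar>M\<bar> + 1}"])
      let ?N = "\<bar>M\<bar> + 1"
      show "rep {-?N..?N} (E {-?N..?N})" using E by simp
      have "measure (\<mu> x) {-?N..?N} = (norm x)\<^sup>2" for x
      proof (rule antisym)
        have "(norm x)\<^sup>2 = cdf (\<mu> x) ?N - cdf (\<mu> x) (-?N)"
          using M by (simp add: cdf_def \<mu>_Iic power2_norm_eq_inner)
        also have "\<dots> = measure (\<mu> x) {-?N<..?N}" by (rule cdf_diff_eq) simp
        also have "\<dots> \<le> measure (\<mu> x) {-?N..?N}"
          by (rule finite_measure_mono) auto
        finally show "(norm x)\<^sup>2 \<le> measure (\<mu> x) {-?N..?N}" .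
      qed (rule \<mu>_le)
      then show "rep {-?N..?N} id_blinfun"
        by (simp add: rep_def orth_proj_id power2_norm_eq_inner)
    qed
    have add: "(\<lambda>n. E (A n) x) sums E (\<Union>n. A n) x"
      if A: "range A \<subseteq> sets borel" "disjoint_family A" for A :: "nat \<Rightarrow> real set" and x
    proof -
      have "rep (A n) (E (A n))" for n using E A by blast
      from rep_UN[OF A, of "\<lambda>n. E (A n)", OF this]
      obtain L where L: "rep (\<Union>n. A n) L" "(\<lambda>n. E (A n) x) sums L x"
        by blast
      moreover have "rep (\<Union>n. A n) (E (\<Union>n. A n))" using E A by blast
      ultimately show ?thesis using rep_unique by blast
    qed
    show "pvm E"
      unfolding pvm_def using E E0 bd add by (auto simp: rep_def)
  qed
qed

section \<open>The spectral theorem for symmetric operators\<close>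

text \<open>Split B along A. The part inside A is fixed by E A; the part outside lies below E (- A)
  = 1 - E A and is annihilated.\<close>

lemma pvm_Int:
  fixes E :: "real set \<Rightarrow> 'a::real_inner op"
  assumes E: "pvm E" and A: "A \<in> sets borel" and B: "B \<in> sets borel"
  shows "E A (E B x) = E (A \<inter> B) x"
proof -
  have "E B = E (A \<inter> B) + E (- A \<inter> B)"
  proof -
    have "B = (A \<inter> B) \<union> (- A \<inter> B)" by blast
    then show ?thesis using pvm_Un[OF E, of "A \<inter> B" "- A \<inter> B"] A B by (simp add: borel_comp)
  qed
  moreover have "E A (E (A \<inter> B) x) = E (A \<inter> B) x"
    using pvm_mono(2)[OF E, of "A \<inter> B" A] A B by simp
  moreover have "E A (E (- A \<inter> B) x) = 0"
  proof -
    have "E (- A) (E (- A \<inter> B) x) = E (- A \<inter> B) x"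
      using pvm_mono(2)[OF E, of "- A \<inter> B" "- A"] A B by (simp add: borel_comp)
    then show ?thesis using pvm_Compl[OF E A] by (simp add: blinfun.bilinear_simps)
  qed
  ultimately show ?thesis by (simp add: blinfun.bilinear_simps)
qed

lemma pvm_bound:
  fixes E :: "real set \<Rightarrow> 'a::real_inner op"
  assumes E: "pvm E"
  obtains M where "M \<ge> 0" and "E {-M..M} = id_blinfun"
    and "\<And>x. AE t in quad_measure E x. t \<in> {-M..M}"
proof -
  obtain M' where M': "E {-M'..M'} = id_blinfun" using E unfolding pvm_def by blast
  define M where "M = \<bar>M'\<bar>"
  have M: "E {-M..M} = id_blinfun"
  proof (rule blinfun_eqI)
    show "E {-M..M} x = id_blinfun x" for x
      using pvm_mono(2)[OF E, of "{-M'..M'}" "{-M..M}" x] M' by (simp add: M_def)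
  qed
  have AE: "AE t in quad_measure E x. t \<in> {-M..M}" for x
  proof (rule AE_I)
    show "{t \<in> space (quad_measure E x). t \<notin> {-M..M}} \<subseteq> - {-M..M}" by auto
    show "emeasure (quad_measure E x) (- {-M..M}) = 0"
      using pvm_Compl[OF E, of "{-M..M}"] M
      by (subst emeasure_quad_measure[OF E]) (auto simp: borel_comp)
    show "- {-M..M} \<in> sets (quad_measure E x)" by (simp add: borel_comp)
  qed
  show thesis by (rule that[OF _ M AE]) (simp add: M_def)
qed

lemma integrable_quad_measure:
  fixes E :: "real set \<Rightarrow> 'a::real_inner op"
  assumes E: "pvm E"
  shows "integrable (quad_measure E x) (\<lambda>t. t)"
proof -
  interpret finite_borel_measure "quad_measure E x"
    using E by (rule finite_borel_quad_measure)
  obtain M where "AE t in quad_measure E x. t \<in> {-M..M}" using pvm_bound[OF E] by metis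
  then have "AE t in quad_measure E x. norm t \<le> M"
    by eventually_elim auto
  then show ?thesis by (rule integrable_const_bound) simp
qed

text \<open>By \<open>pvm_Int\<close>, replacing x by E S x restricts the scalar measure to S, so
  forms on the range of E S become integrals over S.\<close>

lemma quad_measure_range:
  fixes E :: "real set \<Rightarrow> 'a::real_inner op"
  assumes E: "pvm E" and S: "S \<in> sets borel"
  shows "quad_measure E (E S x) = density (quad_measure E x) (\<lambda>t. ennreal (indicator S t))"
proof (rule measure_eqI)
  fix B assume "B \<in> sets (quad_measure E (E S x))"
  then have B: "B \<in> sets borel" by simp
  have "inner (E S x) (E B (E S x)) = inner x (E (S \<inter> B) x)"
  proof -
    have "inner (E S x) (E B (E S x)) = inner x (E S (E (B \<inter> S) x))"
      using E S unfolding pvm_Int[OF E B S] by (simp add: pvm_def orth_proj_sym)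
    also have "E S (E (B \<inter> S) x) = E (S \<inter> B) x"
      using pvm_Int[OF E, of S "B \<inter> S" x] S B by (simp add: Int_ac)
    finally show ?thesis .
  qed
  moreover have "emeasure (density (quad_measure E x) (\<lambda>t. ennreal (indicator S t))) B =
      emeasure (quad_measure E x) (S \<inter> B)"
    using S B by (subst emeasure_density)
      (auto simp: nn_integral_indicator ennreal_indicator indicator_inter_arith[symmetric])
  ultimately show "emeasure (quad_measure E (E S x)) B =
      emeasure (density (quad_measure E x) (\<lambda>t. ennreal (indicator S t))) B"
    using S B by (simp add: emeasure_quad_measure[OF E])
qed simp

text \<open>Only the form of \<open>a\<close> is tied to \<open>E\<close>, so commutation has to be
  extracted from it: the integral splits over {..t} and its complement without a cross term, hence
  \<open>a\<close> respects both ranges.\<close>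

lemma spectral_cut_pvm:
  fixes E :: "real set \<Rightarrow> 'a::real_inner op"
  assumes sym: "symmetric_op a" and E: "pvm E"
    and int: "\<And>x. inner x (a x) = (\<integral>t. t \<partial>quad_measure E x)"
  shows "spectral_cut a t (E {..t})"
proof -
  have integ: "integrable (quad_measure E x) (\<lambda>t. indicator S t * t)"
    if "S \<in> sets borel" for S x
    using integrable_mult_indicator[of S "quad_measure E x" "\<lambda>t. t"] that
      integrable_quad_measure[OF E] by simp
  have q_range: "inner (E S x) (a (E S x)) = (\<integral>t. indicator S t * t \<partial>quad_measure E x)"
    if "S \<in> sets borel" for S x
    unfolding int quad_measure_range[OF E that] using that by (subst integral_density) auto
  let ?e = "E {..t}"
  have e: "orth_proj ?e" using E by (simp add: pvm_def)
  have compl: "E (- {..t}) x = x - ?e x" for x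
    unfolding pvm_Compl[OF E atMost_borel] by (simp add: blinfun.bilinear_simps)
  have split: "inner x (a x) = inner (?e x) (a (?e x)) + inner (x - ?e x) (a (x - ?e x))" for x
  proof -
    have "inner x (a x) = (\<integral>s. indicator {..t} s * s + indicator (- {..t}) s * s \<partial>quad_measure E x)"
      unfolding int by (rule Bochner_Integration.integral_cong) (auto simp: indicator_def)
    also have "\<dots> = inner (?e x) (a (?e x)) + inner (E (- {..t}) x) (a (E (- {..t}) x))"
      by (subst Bochner_Integration.integral_add) (auto simp: q_range borel_comp intro!: integ)
    finally show ?thesis by (simp only: compl)
  qed
  \<comment> \<open>Compare the splitting of the form at z with its bilinear expansion; the mixed
    term is all that is left over.\<close>
  have cross: "inner (?e x) (a (y - ?e y)) = 0" for x y
  proof -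
    define z where "z = ?e x + (y - ?e y)"
    have ez: "?e z = ?e x"
      using e by (simp add: z_def blinfun.bilinear_simps orth_proj_idem)
    have "inner z (a z) = inner (?e x) (a (?e x)) + inner (y - ?e y) (a (y - ?e y))"
      using split[of z] unfolding ez by (simp add: z_def)
    moreover have "inner z (a z) = inner (?e x) (a (?e x)) + inner (y - ?e y) (a (y - ?e y))
        + 2 * inner (?e x) (a (y - ?e y))"
      unfolding z_def blinfun.add_right inner_add_left inner_add_right
      using symmetric_opD[OF sym, of "y - ?e y" "?e x"] by (simp add: inner_commute)
    ultimately show ?thesis by simp
  qed
  show ?thesis
    unfolding spectral_cut_def
  proof (intro conjI allI impI)
    show "orth_proj ?e" by (rule e)
    show "a (?e x) = ?e (a x)" for x
    proof -
      have 1: "inner y (?e (a x)) = inner y (?e (a (?e x)))" for y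
        using cross[of y x] e by (simp add: orth_proj_sym blinfun.bilinear_simps inner_diff)
      have 2: "inner y (a (?e x)) = inner y (?e (a (?e x)))" for y
      proof -
        have "inner (a (?e x)) (y - ?e y) = 0"
          using cross[of x y] sym by (simp add: symmetric_opD)
        then show ?thesis using e by (simp add: inner_diff_right inner_commute orth_proj_sym)
      qed
      have "inner y (a (?e x) - ?e (a x)) = 0" for y
        using 1[of y] 2[of y] by (simp add: inner_diff_right)
      from this[of "a (?e x) - ?e (a x)"] show ?thesis by simp
    qed
    show "inner (?e x) (a (?e x)) \<le> t * (norm (?e x))\<^sup>2" for x
    proof -
      interpret finite_borel_measure "quad_measure E x"
        using E by (rule finite_borel_quad_measure)
      have ind: "integrable (quad_measure E x) (\<lambda>s. indicator {..t} s :: real)"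
        by (rule integrable_real_indicator) (auto simp: less_top[symmetric])
      have "inner (?e x) (a (?e x)) \<le> (\<integral>s. t * indicator {..t} s \<partial>quad_measure E x)"
        unfolding q_range[OF atMost_borel]
        by (intro integral_mono integ integrable_mult_right ind) (auto simp: indicator_def)
      also have "\<dots> = t * inner x (?e x)"
        by (simp add: measure_quad_measure[OF E])
      finally show ?thesis using e by (simp add: orth_proj_inner)
    qed
    show "t * (norm x)\<^sup>2 < inner x (a x)" if ex: "?e x = 0" and "x \<noteq> 0" for x
    proof -
      interpret finite_borel_measure "quad_measure E x"
        using E by (rule finite_borel_quad_measure)
      have total: "measure (quad_measure E x) UNIV = (norm x)\<^sup>2"
        by (simp add: measure_quad_measure[OF E] pvm_UNIV[OF E] power2_norm_eq_inner)
      have above: "AE s in quad_measure E x. t < s"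
      proof (rule AE_I[of _ _ "{..t}"])
        show "emeasure (quad_measure E x) {..t} = 0"
          by (simp add: emeasure_quad_measure[OF E] ex)
      qed auto
      have integ': "integrable (quad_measure E x) (\<lambda>s. s - t)"
        by (intro Bochner_Integration.integrable_diff integrable_quad_measure[OF E]) simp
      have eq: "(\<integral>s. s - t \<partial>quad_measure E x) = inner x (a x) - t * (norm x)\<^sup>2"
        by (subst Bochner_Integration.integral_diff)
          (simp_all add: integrable_quad_measure[OF E] int total)
      have nonneg: "AE s in quad_measure E x. 0 \<le> s - t"
        using above by eventually_elim simp
      \<comment> \<open>A vanishing integral of a nonnegative function would give s = t almost
        everywhere, against s > t almost everywhere; the measure would be zero although its mass is
        the squared norm of x.\<close>
      have "(\<integral>s. s - t \<partial>quad_measure E x) \<noteq> 0"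
      proof
        assume "(\<integral>s. s - t \<partial>quad_measure E x) = 0"
        then have "AE s in quad_measure E x. s - t = 0"
          using integral_nonneg_eq_0_iff_AE[OF integ' nonneg] by simp
        with above have "AE s in quad_measure E x. False" by eventually_elim simp
        then have "emeasure (quad_measure E x) UNIV = 0"
          by (simp add: AE_iff_null null_setsD1)
        then show False using \<open>x \<noteq> 0\<close> total by (simp add: measure_def)
      qed
      moreover have "0 \<le> (\<integral>s. s - t \<partial>quad_measure E x)"
        using nonneg by (rule integral_nonneg_AE)
      ultimately show ?thesis using eq by simp
    qed
  qed
qed

text \<open>The first N digits sum to the floor of 2^N u divided by 2^N, since passing from N + 1 to
  N halves the floor and drops its parity. The bound u < 1 makes the integer part vanish.\<close>

lemma binary_digits_sums:
  fixes u :: real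
  assumes "0 \<le> u" "u < 1"
  shows "(\<lambda>n. (1/2) ^ Suc n * of_bool (odd \<lfloor>2 ^ Suc n * u\<rfloor>)) sums u"
proof -
  have partial: "(\<Sum>n<N. (1/2) ^ Suc n * of_bool (odd \<lfloor>2 ^ Suc n * u\<rfloor>)) = \<lfloor>2 ^ N * u\<rfloor> / 2 ^ N" for N
  proof (induction N)
    case 0
    have "\<lfloor>u\<rfloor> = 0" using assms by (simp add: floor_unique)
    then show ?case by simp
  next
    case (Suc N)
    define k where "k = \<lfloor>2 ^ Suc N * u\<rfloor>"
    have "\<lfloor>2 ^ N * u\<rfloor> = \<lfloor>(2 ^ Suc N * u) / real_of_int 2\<rfloor>" by simp
    also have "\<dots> = k div 2" unfolding k_def by (rule floor_divide_real_eq_div) simp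
    finally have half: "\<lfloor>2 ^ N * u\<rfloor> = k div 2" .
    have "k = 2 * (k div 2) + of_bool (odd k)" by (simp add: mod_2_eq_odd[symmetric])
    then have "real_of_int k = real_of_int (2 * (k div 2) + of_bool (odd k))" by (rule arg_cong)
    then have "real_of_int k = 2 * real_of_int (k div 2) + of_bool (odd k)" by simp
    then have "real_of_int k / 2 ^ Suc N = real_of_int (k div 2) / 2 ^ N + (1/2) ^ Suc N * of_bool (odd k)"
      by (simp add: power_divide add_divide_distrib)
    then show ?case using Suc half by (simp add: k_def)
  qed
  have "(\<lambda>N. \<lfloor>2 ^ N * u\<rfloor> / 2 ^ N) \<longlonglongrightarrow> u"
  proof (rule tendsto_sandwich)
    show "\<forall>\<^sub>F N in sequentially. u - (1/2) ^ N \<le> \<lfloor>2 ^ N * u\<rfloor> / 2 ^ N"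
    proof (rule always_eventually, rule allI)
      fix N
      have "(2 ^ N * u - 1) / 2 ^ N \<le> \<lfloor>2 ^ N * u\<rfloor> / 2 ^ N"
        by (intro divide_right_mono) (linarith, simp)
      then show "u - (1/2) ^ N \<le> \<lfloor>2 ^ N * u\<rfloor> / 2 ^ N"
        by (simp add: power_divide diff_divide_distrib)
    qed
    show "\<forall>\<^sub>F N in sequentially. \<lfloor>2 ^ N * u\<rfloor> / 2 ^ N \<le> u"
      by (rule always_eventually) (simp add: divide_le_eq mult.commute)
    have "(\<lambda>N. u - (1/2) ^ N) \<longlonglongrightarrow> u - 0"
      by (intro tendsto_intros LIMSEQ_power_zero) simp
    then show "(\<lambda>N. u - (1/2) ^ N) \<longlonglongrightarrow> u" by simp
  qed simp
  then show ?thesis unfolding sums_def partial .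
qed

text \<open>The operator \<open>\<integral> t dE(t)\<close> is a norm convergent series of spectral projections: after rescaling the
  support of \<open>E\<close> into \<open>[0, 1)\<close>, expand the integrand \<open>t\<close> in binary digits.\<close>

lemma pvm_integral_operator:
  fixes E :: "real set \<Rightarrow> 'a::{real_inner,banach} op"
  assumes E: "pvm E" and C: "\<And>B. B \<in> sets borel \<Longrightarrow> E B \<in> real_commutant G"
  obtains b where "symmetric_op b" and "\<And>x. inner x (b x) = (\<integral>t. t \<partial>quad_measure E x)"
    and "b \<in> real_commutant G"
proof -
  obtain M where M: "M \<ge> 0" "\<And>x. AE t in quad_measure E x. t \<in> {-M..M}"
    using pvm_bound[OF E] by metis
  \<comment> \<open>The denominator 2 M + 1 keeps the image of {-M..M} strictly below 1 and is
    nonzero for M = 0. The set \<open>B n\<close> below is where binary digit n + 1 of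
    \<open>\<phi> t\<close> equals 1.\<close>
  define \<phi> where "\<phi> t = (t + M) / (2 * M + 1)" for t
  define B where "B n = {t. odd \<lfloor>2 ^ Suc n * \<phi> t\<rfloor>}" for n
  have B_borel: "B n \<in> sets borel" for n
  proof -
    have "(\<lambda>t. \<lfloor>2 ^ Suc n * \<phi> t\<rfloor>) \<in> borel \<rightarrow>\<^sub>M count_space UNIV"
      unfolding \<phi>_def by measurable
    from measurable_sets[OF this, of "{k. odd k}"] show ?thesis
      by (simp add: B_def vimage_def)
  qed
  have EB: "orth_proj (E (B n))" for n using E B_borel by (simp add: pvm_def)
  have norm_EB: "norm (E (B n)) \<le> 1" for n
    by (rule norm_blinfun_bound) (simp_all add: orth_proj_norm_le EB)
  have "summable (\<lambda>n. (1/2) ^ Suc n *\<^sub>R E (B n))"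
  proof (rule summable_comparison_test)
    show "\<exists>N. \<forall>n\<ge>N. norm ((1/2) ^ Suc n *\<^sub>R E (B n)) \<le> (1/2) ^ Suc n"
      using norm_EB by (auto simp: mult_left_le)
    show "summable (\<lambda>n. (1/2::real) ^ Suc n)" by (simp add: summable_geometric)
  qed
  then obtain S where S: "(\<lambda>n. (1/2) ^ Suc n *\<^sub>R E (B n)) sums S"
    unfolding summable_def by blast
  have Sx: "(\<lambda>n. (1/2) ^ Suc n *\<^sub>R E (B n) x) sums S x" for x
    using bounded_linear.sums[OF blinfun.bounded_linear_left S, of x] by (simp add: blinfun.scaleR_left)
  have S_lim: "(\<lambda>N. blinfun_apply (\<Sum>n<N. (1/2) ^ Suc n *\<^sub>R E (B n)) x) \<longlonglongrightarrow> S x" for x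
    using S unfolding sums_def by (intro blinfun.tendsto tendsto_const)
  have S_sym: "symmetric_op S"
  proof (rule symmetric_op_limit[OF _ S_lim])
    show "symmetric_op (\<Sum>n<N. (1/2) ^ Suc n *\<^sub>R E (B n))" for N
      by (induction N)
        (auto simp: symmetric_op_def blinfun.bilinear_simps inner_add orth_proj_sym[OF EB])
  qed
  have S_comm: "S \<in> real_commutant G"
  proof (rule real_commutant_limit[OF _ S_lim])
    show "(\<Sum>n<N. (1/2) ^ Suc n *\<^sub>R E (B n)) \<in> real_commutant G" for N
      by (induction N)
        (auto intro!: zero_in_real_commutant real_commutant_add real_commutant_scaleR C B_borel
          simp del: power_Suc)
  qed
  \<comment> \<open>Undoes the rescaling: t = (2 M + 1) \<open>\<phi> t\<close> - M.\<close>
  define b where "b = (2 * M + 1) *\<^sub>R S - M *\<^sub>R id_blinfun"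
  show thesis
  proof
    show "symmetric_op b"
      using S_sym by (simp add: b_def symmetric_op_def blinfun.bilinear_simps inner_diff)
    show "b \<in> real_commutant G"
      unfolding b_def by (intro real_commutant_diff real_commutant_scaleR S_comm id_in_real_commutant)
    fix x
    interpret finite_borel_measure "quad_measure E x"
      using E by (rule finite_borel_quad_measure)
    let ?f = "\<lambda>n t. (1/2) ^ Suc n * indicator (B n) t :: real"
    have f_sums: "AE t in quad_measure E x. (\<lambda>n. ?f n t) sums \<phi> t"
      using M(2)[of x]
    proof eventually_elim
      case (elim t)
      then have "0 \<le> \<phi> t" "\<phi> t < 1" using M(1) by (auto simp: \<phi>_def divide_simps)
      from binary_digits_sums[OF this] show ?case
        by (simp add: indicator_def of_bool_def B_def)
    qed
    have norm_f: "norm (?f n t) = ?f n t" for n t by (simp add: abs_mult)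
    have "(\<lambda>n. \<integral>t. ?f n t \<partial>quad_measure E x) sums (\<integral>t. (\<Sum>n. ?f n t) \<partial>quad_measure E x)"
    proof (rule sums_integral)
      show "integrable (quad_measure E x) (?f n)" for n
        using B_borel by (intro integrable_mult_right integrable_real_indicator)
          (auto simp: less_top[symmetric])
      show "AE t in quad_measure E x. summable (\<lambda>n. norm (?f n t))"
        using f_sums unfolding norm_f by eventually_elim (rule sums_summable)
      have "summable (\<lambda>n. (1/2) ^ Suc n * measure (quad_measure E x) (B n))"
      proof (rule summable_comparison_test)
        show "\<exists>N. \<forall>n\<ge>N. norm ((1/2) ^ Suc n * measure (quad_measure E x) (B n)) \<le>
            (1/2) ^ Suc n * measure (quad_measure E x) UNIV"
          using bounded_measure by (auto simp: abs_mult simp del: power_Suc intro!: mult_left_mono)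
        show "summable (\<lambda>n. (1/2::real) ^ Suc n * measure (quad_measure E x) UNIV)"
          by (intro summable_mult2) (simp add: summable_geometric)
      qed
      then show "summable (\<lambda>n. \<integral>t. norm (?f n t) \<partial>quad_measure E x)"
        unfolding norm_f by (simp add: B_borel)
    qed
    also have "(\<integral>t. (\<Sum>n. ?f n t) \<partial>quad_measure E x) = (\<integral>t. \<phi> t \<partial>quad_measure E x)"
    proof (rule integral_cong_AE)
      show "AE t in quad_measure E x. (\<Sum>n. ?f n t) = \<phi> t"
        using f_sums by eventually_elim (simp add: sums_iff)
      note B_borel [measurable]
      show "(\<lambda>t. \<Sum>n. ?f n t) \<in> borel_measurable (quad_measure E x)" by measurable
      show "\<phi> \<in> borel_measurable (quad_measure E x)" unfolding \<phi>_def by measurable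
    qed
    also have "(\<lambda>n. \<integral>t. ?f n t \<partial>quad_measure E x) = (\<lambda>n. inner x ((1/2) ^ Suc n *\<^sub>R E (B n) x))"
      by (simp add: B_borel measure_quad_measure[OF E])
    finally have S_int: "inner x (S x) = (\<integral>t. \<phi> t \<partial>quad_measure E x)"
      by (rule sums_unique2[OF bounded_linear.sums[OF bounded_linear_inner_right Sx]])
    have "(\<integral>t. t \<partial>quad_measure E x) = (\<integral>t. (2 * M + 1) * \<phi> t - M \<partial>quad_measure E x)"
      using M(1) by (simp add: \<phi>_def)
    also have "\<dots> = (2 * M + 1) * inner x (S x) - M * inner x x"
    proof -
      have "integrable (quad_measure E x) \<phi>"
        unfolding \<phi>_def
        by (intro integrable_divide Bochner_Integration.integrable_add integrable_quad_measure[OF E]) simp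
      then show ?thesis
        by (simp add: S_int measure_quad_measure[OF E] pvm_UNIV[OF E])
    qed
    finally show "inner x (b x) = (\<integral>t. t \<partial>quad_measure E x)"
      by (simp add: b_def blinfun.bilinear_simps inner_diff)
  qed
qed

text \<open>Cut the interval into n + 1 equal pieces: the increments of \<open>F\<close> telescope
  while the length factor shrinks to (t - s) / (n + 1).\<close>

lemma increment_bound_imp_eq:
  fixes D F :: "real \<Rightarrow> real"
  assumes bound: "\<And>s t. s \<le> t \<Longrightarrow> \<bar>D t - D s\<bar> \<le> (t - s) * (F t - F s)" and "s \<le> t"
  shows "D s = D t"
proof -
  have "\<bar>D t - D s\<bar> \<le> (t - s) * (F t - F s) / real (Suc n)" for n
  proof -
    define h where "h = (t - s) / real (Suc n)"
    have h: "h \<ge> 0" using \<open>s \<le> t\<close> by (simp add: h_def)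
    have "\<bar>D (s + real k * h) - D s\<bar> \<le> h * (F (s + real k * h) - F s)" for k
    proof (induction k)
      case (Suc k)
      have "\<bar>D (s + real (Suc k) * h) - D (s + real k * h)\<bar> \<le>
          h * (F (s + real (Suc k) * h) - F (s + real k * h))"
        using bound[of "s + real k * h" "s + real (Suc k) * h"] h by (simp add: algebra_simps)
      with Suc show ?case by (simp add: right_diff_distrib)
    qed simp
    from this[of "Suc n"] show ?thesis by (simp add: h_def)
  qed
  moreover have "(\<lambda>n. (t - s) * (F t - F s) / real (Suc n)) \<longlonglongrightarrow> 0"
    by (rule LIMSEQ_Suc[OF lim_const_over_n])
  ultimately have "\<bar>D t - D s\<bar> \<le> 0"
    using LIMSEQ_le_const by blast
  then show ?thesis by simp
qed

text \<open>On a vector g = e t x - e s x the forms of \<open>a\<close> and \<open>b\<close> both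
  lie between s and t times the squared norm of g. So the form of a - b along the shared cuts
  satisfies the bound of \<open>increment_bound_imp_eq\<close> and is constant.\<close>

lemma spectral_cuts_determine:
  fixes a b :: "'a::{real_inner,banach} op"
  assumes sym: "symmetric_op a" "symmetric_op b"
    and a: "\<And>t. spectral_cut a t (e t)" and b: "\<And>t. spectral_cut b t (e t)"
  shows "a = b"
proof (rule symmetric_op_eqI[OF sym])
  fix x
  have e: "orth_proj (e t)" for t using a unfolding spectral_cut_def by blast
  define d where "d = a - b"
  have ed: "d (e t y) = e t (d y)" for t y
    using a[of t] b[of t] unfolding spectral_cut_def d_def by (simp add: blinfun.bilinear_simps)
  define D where "D t = inner x (d (e t x))" for t
  define F where "F t = inner x (e t x)" for t
  have "\<bar>D t - D s\<bar> \<le> (t - s) * (F t - F s)" if "s \<le> t" for s t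
  proof -
    have ts: "e t (e s y) = e s y" for y
      by (rule spectral_cut_mono[OF sym(1) a a that])
    have st: "e s (e t y) = e s y" for y
      using ts orth_proj_absorb_swap[OF e[of s] e[of t]] by blast
    define g where "g = e t x - e s x"
    have tg: "e t g = g" and sg: "e s g = 0"
      using ts st e by (simp_all add: g_def blinfun.bilinear_simps orth_proj_idem)
    have quad: "s * (norm g)\<^sup>2 \<le> inner g (c g) \<and> inner g (c g) \<le> t * (norm g)\<^sup>2"
      if c: "\<And>t. spectral_cut c t (e t)" for c
    proof
      show "s * (norm g)\<^sup>2 \<le> inner g (c g)"
        using c[of s] sg unfolding spectral_cut_def by (cases "g = 0") (auto intro: less_imp_le)
      have "inner (e t g) (c (e t g)) \<le> t * (norm (e t g))\<^sup>2"
        using c[of t] unfolding spectral_cut_def by blast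
      then show "inner g (c g) \<le> t * (norm g)\<^sup>2" by (simp add: tg)
    qed
    have "\<bar>inner g (d g)\<bar> \<le> (t - s) * (norm g)\<^sup>2"
      using quad[OF a] quad[OF b]
      by (simp add: d_def blinfun.bilinear_simps inner_diff left_diff_distrib abs_le_iff)
    moreover have "inner g y = inner x (e t y) - inner x (e s y)" for y
      using e by (simp add: g_def inner_diff_left orth_proj_sym)
    then have "inner g (d g) = D t - D s" and "(norm g)\<^sup>2 = F t - F s"
      by (simp_all add: D_def F_def power2_norm_eq_inner tg sg flip: ed)
        (simp_all add: g_def blinfun.bilinear_simps inner_diff_right)
    ultimately show ?thesis by simp
  qed
  then have "D s = D t" if "s \<le> t" for s t using that by (rule increment_bound_imp_eq)
  \<comment> \<open>The cuts are shared, so bounds coming from \<open>a\<close> alone tell where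
    \<open>e\<close> is 0 and where it is the identity.\<close>
  moreover have "D (- norm a - 1) = 0"
    using spectral_cut_small[OF a[of "- norm a - 1"]] by (simp add: D_def blinfun.bilinear_simps)
  moreover have "D (norm a) = inner x (d x)"
    using spectral_cut_large[OF a[of "norm a"]] by (simp add: D_def)
  moreover have "- norm a - 1 \<le> norm a" using norm_ge_zero[of a] by linarith
  ultimately have "inner x (d x) = 0" by metis
  then show "inner x (a x) = inner x (b x)"
    by (simp add: d_def blinfun.bilinear_simps inner_diff)
qed

lemma projection_resolution_operator:
  fixes f :: "real \<Rightarrow> 'a::{real_inner,banach} op"
  assumes f: "projection_resolution f"
  obtains b E where "symmetric_op b" and "b \<in> real_commutant (real_commutant (range f))"
    and "\<And>t. spectral_cut b t (f t)" and "pvm E" and "\<And>t. E {..t} = f t"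
    and "\<And>x. inner x (b x) = (\<integral>t. t \<partial>quad_measure E x)"
    and "\<And>B. B \<in> sets borel \<Longrightarrow> E B \<in> real_commutant (real_commutant (range f))"
proof -
  obtain E where E: "pvm E" "\<And>t. E {..t} = f t"
    "\<And>B. B \<in> sets borel \<Longrightarrow> E B \<in> real_commutant (real_commutant (range f))"
    by (rule projection_resolution_pvm[OF f]) (rule that)
  obtain b where b: "symmetric_op b" "\<And>x. inner x (b x) = (\<integral>t. t \<partial>quad_measure E x)"
    "b \<in> real_commutant (real_commutant (range f))"
    by (rule pvm_integral_operator[OF E(1,3)]) (assumption, rule that)
  have "spectral_cut b t (f t)" for t
    using spectral_cut_pvm[OF b(1) E(1) b(2)] by (simp add: E(2))
  then show thesis by (intro that[OF b(1,3) _ E(1,2) b(2) E(3)])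
qed

text \<open>What has to be shown is right continuity. The right regularisation of \<open>e\<close>
  consists again of cuts of \<open>a\<close>, so by uniqueness it is \<open>e\<close>.\<close>

lemma spectral_cut_projection_resolution:
  fixes a :: "'a::{real_inner,banach} op"
  assumes sym: "symmetric_op a" and e: "\<And>t. spectral_cut a t (e t)"
  shows "projection_resolution e"
proof -
  have e_proj: "orth_proj (e t)" for t using e unfolding spectral_cut_def by blast
  have e_mono: "e t (e s x) = e s x" if "s \<le> t" for s t x
    by (rule spectral_cut_mono[OF sym e e that])
  have bd: "\<exists>M. \<forall>t. (t < -M \<longrightarrow> e t = 0) \<and> (M \<le> t \<longrightarrow> e t = id_blinfun)"
    using spectral_cut_small[OF e] spectral_cut_large[OF e] by blast
  obtain f where f: "projection_resolution f"
    "\<And>t x. (\<lambda>n. e (t + 1 / real (Suc n)) x) \<longlonglongrightarrow> f t x"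
    "\<And>t x. f t (e t x) = e t x" "\<And>s t x. s < t \<Longrightarrow> e t (f s x) = f s x"
    by (rule projection_family_right_limit[OF e_proj e_mono bd]) (assumption, rule that)
  have f_proj: "orth_proj (f t)" for t using f(1) unfolding projection_resolution_def by blast
  have "spectral_cut a t (f t)" for t
    unfolding spectral_cut_def
  proof (intro conjI allI impI)
    show "orth_proj (f t)" by (rule f_proj)
    have "f t \<in> real_commutant {a}"
    proof (rule real_commutant_limit[OF _ f(2)])
      show "e (t + 1 / real (Suc n)) \<in> real_commutant {a}" for n
        using e[of "t + 1 / real (Suc n)"]
        by (intro real_commutantI) (simp add: spectral_cut_def)
    qed
    then show "a (f t x) = f t (a x)" for x
      using real_commutantD[of "f t" "{a}" a x] by simp
    show "inner (f t x) (a (f t x)) \<le> t * (norm (f t x))\<^sup>2" for x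
    proof (cases "f t x = 0")
      case False
      then have pos: "(norm (f t x))\<^sup>2 > 0" by simp
      \<comment> \<open>The range of f t lies in that of e s for every s > t; the bound by t follows
        by letting s decrease to t.\<close>
      have "inner (f t x) (a (f t x)) / (norm (f t x))\<^sup>2 \<le> s" if "t < s" for s
      proof -
        have "inner (e s (f t x)) (a (e s (f t x))) \<le> s * (norm (e s (f t x)))\<^sup>2"
          using e[of s] unfolding spectral_cut_def by blast
        then show ?thesis using pos by (simp add: f(4)[OF that] divide_le_eq)
      qed
      then have "inner (f t x) (a (f t x)) / (norm (f t x))\<^sup>2 \<le> t" by (rule dense_ge)
      then show ?thesis using pos by (simp add: divide_le_eq)
    qed (simp add: blinfun.bilinear_simps)
    show "t * (norm x)\<^sup>2 < inner x (a x)" if fx: "f t x = 0" and "x \<noteq> 0" for x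
    proof -
      have "e t (f t x) = e t x"
        using f(3) orth_proj_absorb_swap[OF e_proj[of t] f_proj[of t]] by blast
      then have "e t x = 0" by (simp add: fx blinfun.bilinear_simps)
      then show ?thesis using e[of t] \<open>x \<noteq> 0\<close> unfolding spectral_cut_def by blast
    qed
  qed
  then have "f = e" using spectral_cut_unique[OF sym] e by blast
  then show ?thesis using f(1) by simp
qed

text \<open>The cuts of \<open>a\<close> form a resolution, and the operator \<open>b\<close> built
  from that resolution has the same cuts. Hence a = b, and the measure built along with
  \<open>b\<close> represents \<open>a\<close>.\<close>

theorem spectral_theorem_symmetric:
  fixes a :: "'a::{real_inner,banach} op"
  assumes sym: "symmetric_op a"
  obtains E where "pvm E" and "\<And>x. inner x (a x) = (\<integral>t. t \<partial>quad_measure E x)"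
    and "\<And>B. B \<in> sets borel \<Longrightarrow> E B \<in> real_commutant (real_commutant {a})"
proof -
  have "\<exists>e. spectral_cut a t e" for t
    using spectral_cut_exists[OF sym] by metis
  then obtain e where e: "\<And>t. spectral_cut a t (e t)" by metis
  obtain b E where b: "symmetric_op b" "b \<in> real_commutant (real_commutant (range e))"
    "\<And>t. spectral_cut b t (e t)" and E: "pvm E" "\<And>t. E {..t} = e t"
    "\<And>x. inner x (b x) = (\<integral>t. t \<partial>quad_measure E x)"
    "\<And>B. B \<in> sets borel \<Longrightarrow> E B \<in> real_commutant (real_commutant (range e))"
    by (rule projection_resolution_operator[OF spectral_cut_projection_resolution[OF sym e]])
      (rule that)
  have "a = b" by (rule spectral_cuts_determine[OF sym b(1) e b(3)])
  moreover have "range e \<subseteq> real_commutant (real_commutant {a})"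
    using spectral_cut_bicommutant[OF sym e] by blast
  then have "real_commutant (real_commutant (range e)) \<subseteq> real_commutant (real_commutant {a})"
    by (rule real_bicommutant_least)
  ultimately show thesis using that[OF E(1)] E(3,4) by blast
qed

section \<open>Spectral projections in von Neumann algebras\<close>

instance chilbert_space \<subseteq> banach ..

lemma bounded_ops_eq_real_commutant:
  "bounded_ops = real_commutant (range (\<lambda>c. cscale_op c (id_blinfun :: 'h::chilbert_space op)))"
  by (auto simp: bounded_ops_def cscale_op_apply intro!: real_commutantI dest: real_commutantD)
    (metis (mono_tags, lifting) cscale_op_apply id_blinfun.rep_eq rangeI real_commutantD)

lemma commutant_eq_real_commutant:
  "commutant S = real_commutant (range (\<lambda>c. cscale_op c (id_blinfun :: 'h::chilbert_space op)) \<union> S)"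
  by (auto simp: commutant_def bounded_ops_eq_real_commutant real_commutant_def)

lemma Im_cinner: "Im (cinner x y) = inner x ((- \<i>) *\<^sub>C y)"
  for x y :: "'h::chilbert_space"
  unfolding Re_cinner[symmetric] cinner_scaleC_right by simp

text \<open>The imaginary part of the complex inner product is the real inner product with - i y, so
  for complex-linear \<open>T\<close> real symmetry already controls both parts.\<close>

lemma self_adjoint_iff: "self_adjoint T \<longleftrightarrow> T \<in> bounded_ops \<and> symmetric_op T"
  for T :: "'h::chilbert_space op"
proof -
  have "is_adjoint T T \<longleftrightarrow> symmetric_op T" if T: "T \<in> bounded_ops"
  proof
    assume "is_adjoint T T"
    then show "symmetric_op T"
      by (simp add: is_adjoint_def symmetric_op_def flip: Re_cinner)
  next
    assume sym: "symmetric_op T"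
    have "cinner (T x) y = cinner x (T y)" for x y
    proof (rule complex_eqI)
      show "Re (cinner (T x) y) = Re (cinner x (T y))"
        using sym by (simp add: Re_cinner symmetric_opD)
      have "inner (T x) ((- \<i>) *\<^sub>C y) = inner x (T ((- \<i>) *\<^sub>C y))"
        using sym by (rule symmetric_opD)
      also have "T ((- \<i>) *\<^sub>C y) = (- \<i>) *\<^sub>C T y"
        using T unfolding bounded_ops_def by blast
      finally show "Im (cinner (T x) y) = Im (cinner x (T y))"
        by (simp add: Im_cinner)
    qed
    then show "is_adjoint T T" by (simp add: is_adjoint_def)
  qed
  then show ?thesis by (auto simp: self_adjoint_def)
qed

lemma projection_iff: "projection P \<longleftrightarrow> P \<in> bounded_ops \<and> orth_proj P"
  for P :: "'h::chilbert_space op"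
  by (auto simp: projection_def self_adjoint_iff orth_proj_def)

lemma op_le_iff: "op_le S T \<longleftrightarrow> (\<forall>x. inner x (S x) \<le> inner x (T x))"
  for S T :: "'h::chilbert_space op"
  by (simp add: op_le_def Re_cinner)

lemma op_le_projection_iff:
  "projection P \<Longrightarrow> projection Q \<Longrightarrow> op_le P Q \<longleftrightarrow> (\<forall>x. Q (P x) = P x)"
  for P Q :: "'h::chilbert_space op"
  unfolding op_le_iff projection_iff by (simp add: orth_proj_le_iff)

lemma op_le_refl: "op_le S S"
  by (simp add: op_le_def)

lemma op_le_trans: "op_le R S \<Longrightarrow> op_le S T \<Longrightarrow> op_le R T"
  by (meson op_le_def order_trans)

lemma projection_antisym:
  fixes P Q :: "'h::chilbert_space op"
  assumes "projection P" "projection Q" "op_le P Q" "op_le Q P"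
  shows "P = Q"
  using assms unfolding projection_iff op_le_iff
  by (intro symmetric_op_eqI antisym) (auto simp: orth_proj_symmetric)

lemma projection_compl:
  fixes P :: "'h::chilbert_space op"
  assumes "projection P"
  shows "projection (id_blinfun - P)"
  using assms unfolding projection_iff bounded_ops_eq_real_commutant
  by (auto intro: orth_proj_compl real_commutant_diff id_in_real_commutant)

lemma op_le_compl_iff:
  "op_le (id_blinfun - P) (id_blinfun - Q) \<longleftrightarrow> op_le Q P"
  "op_le P (id_blinfun - Q) \<longleftrightarrow> op_le Q (id_blinfun - P)"
  "op_le (id_blinfun - P) Q \<longleftrightarrow> op_le (id_blinfun - Q) P"
  for P Q :: "'h::chilbert_space op"
  by (auto simp: op_le_iff blinfun.bilinear_simps inner_diff algebra_simps)

section \<open>Spectral measures of self-adjoint operators\<close>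

lemma scalar_measure_eq_quad_measure: "scalar_measure E x = quad_measure E x"
  by (simp add: scalar_measure_def quad_measure_def Re_cinner)

text \<open>Self-adjointness makes \<open>cinner x (a x)\<close> real, so the complex integral
  equation is its real part.\<close>

lemma spectral_measure_of_iff:
  fixes a :: "'h::chilbert_space op"
  assumes a: "self_adjoint a"
  shows "spectral_measure_of a E \<longleftrightarrow> pvm E \<and> (\<forall>B\<in>sets borel. E B \<in> bounded_ops) \<and>
    (\<forall>x. inner x (a x) = (\<integral>t. t \<partial>quad_measure E x))"
proof -
  have "cinner x (a x) = complex_of_real r \<longleftrightarrow> inner x (a x) = r" for x r
  proof -
    have "cinner x (a x) = cnj (cinner x (a x))"
      using a cinner_commute[of x "a x"] by (simp add: self_adjoint_def is_adjoint_def)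
    then have "Im (cinner x (a x)) = 0" by (simp add: complex_eq_iff)
    then show ?thesis by (auto simp: complex_eq_iff Re_cinner)
  qed
  then show ?thesis
    by (auto simp: spectral_measure_of_def pvm_def projection_iff scalar_measure_eq_quad_measure)
qed

lemma spectral_measure_cut:
  fixes a :: "'h::chilbert_space op"
  assumes "self_adjoint a" "spectral_measure_of a E"
  shows "spectral_cut a t (E {..t})"
  using assms by (intro spectral_cut_pvm) (auto simp: self_adjoint_iff spectral_measure_of_iff)

lemma spectral_measure_unique:
  fixes a :: "'h::chilbert_space op"
  assumes a: "self_adjoint a" and E: "spectral_measure_of a E" "spectral_measure_of a E'"
    and B: "B \<in> sets borel"
  shows "E B = E' B"
proof (rule pvm_eqI[OF _ _ _ B])
  show "pvm E" "pvm E'" using a E by (auto simp: spectral_measure_of_iff)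
  show "E {..t} = E' {..t}" for t
    using a spectral_measure_cut[OF a E(1)] spectral_measure_cut[OF a E(2)]
    by (intro spectral_cut_unique[of a t]) (auto simp: self_adjoint_iff)
qed

lemma spectral_projection_eqI:
  fixes a :: "'h::chilbert_space op"
  assumes "self_adjoint a" "spectral_measure_of a E" "B \<in> sets borel"
  shows "spectral_projection a B = E B"
  unfolding spectral_projection_def
  using assms spectral_measure_unique by (intro the_equality) blast+

text \<open>The scalar multiplications commute with \<open>F\<close>, so everything in the
  bicommutant commutes with them.\<close>

lemma real_bicommutant_bounded_ops:
  fixes F :: "'h::chilbert_space op set"
  assumes "F \<subseteq> bounded_ops" "T \<in> real_commutant (real_commutant F)"
  shows "T \<in> bounded_ops"
proof -
  have "range (\<lambda>c. cscale_op c id_blinfun) \<subseteq> real_commutant F"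
    using assms(1) unfolding bounded_ops_eq_real_commutant real_commutant_def by auto
  then show ?thesis
    using assms(2) real_commutant_antimono unfolding bounded_ops_eq_real_commutant by blast
qed

lemma spectral_measure_exists:
  fixes a :: "'h::chilbert_space op"
  assumes a: "self_adjoint a"
  obtains E where "spectral_measure_of a E"
    and "\<And>B. B \<in> sets borel \<Longrightarrow> E B \<in> real_commutant (real_commutant {a})"
proof -
  obtain E where E: "pvm E" "\<And>x. inner x (a x) = (\<integral>t. t \<partial>quad_measure E x)"
    "\<And>B. B \<in> sets borel \<Longrightarrow> E B \<in> real_commutant (real_commutant {a})"
    using spectral_theorem_symmetric[of a] a unfolding self_adjoint_iff by blast
  moreover have "E B \<in> bounded_ops" if "B \<in> sets borel" for B
    using E(3)[OF that] a by (intro real_bicommutant_bounded_ops) (auto simp: self_adjoint_iff)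
  ultimately show thesis
    using a by (intro that[of E]) (auto simp: spectral_measure_of_iff)
qed

lemma spectral_resolution_cut:
  fixes a :: "'h::chilbert_space op"
  assumes a: "self_adjoint a"
  shows "spectral_cut a t (spectral_resolution a t)"
proof -
  obtain E where "spectral_measure_of a E" using spectral_measure_exists[OF a] by blast
  then show ?thesis
    unfolding spectral_resolution_def
    using spectral_projection_eqI[OF a, of E "{..t}"] spectral_measure_cut[OF a, of E t] by simp
qed

lemma projection_spectral_resolution:
  fixes a :: "'h::chilbert_space op"
  assumes a: "self_adjoint a"
  shows "projection (spectral_resolution a t)"
proof -
  obtain E where E: "spectral_measure_of a E" using spectral_measure_exists[OF a] by blast
  then have "projection (E {..t})" by (simp add: spectral_measure_of_def)
  then show ?thesis
    unfolding spectral_resolution_def by (simp add: spectral_projection_eqI[OF a E])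
qed

lemma spectral_resolution_eqI:
  fixes a :: "'h::chilbert_space op"
  assumes "self_adjoint a" "spectral_cut a t e"
  shows "spectral_resolution a t = e"
  using assms spectral_resolution_cut by (intro spectral_cut_unique[of a t]) (auto simp: self_adjoint_iff)

text \<open>Passes from real to complex bicommutants: the complex commutant of \<open>A\<close> lies
  in the real commutant of \<open>F\<close>, and \<open>T\<close> is complex linear.\<close>

lemma von_neumann_algebra_bicommutant:
  fixes A :: "'h::chilbert_space op set"
  assumes A: "von_neumann_algebra A" and "F \<subseteq> A" and T: "T \<in> real_commutant (real_commutant F)"
  shows "T \<in> A"
proof -
  have F: "F \<subseteq> bounded_ops"
    using assms by (auto simp: von_neumann_algebra_def star_subalgebra_def)
  have "commutant A \<subseteq> real_commutant F"
    using \<open>F \<subseteq> A\<close> by (auto simp: commutant_def real_commutant_def)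
  then have "T \<in> commutant (commutant A)"
    using T real_bicommutant_bounded_ops[OF F T]
    by (auto simp: commutant_def real_commutant_def)
  then show ?thesis using A by (simp add: von_neumann_algebra_def)
qed

lemma spectral_projection_mem:
  fixes A :: "'h::chilbert_space op set"
  assumes A: "von_neumann_algebra A" and a: "a \<in> sa_part A" and B: "B \<in> sets borel"
  shows "spectral_projection a B \<in> Proj A"
proof -
  have sa: "self_adjoint a" and "a \<in> A" using a by (auto simp: sa_part_def)
  obtain E where E: "spectral_measure_of a E" "E B \<in> real_commutant (real_commutant {a})"
    using spectral_measure_exists[OF sa] B by blast
  have "E B \<in> A" using von_neumann_algebra_bicommutant[OF A, of "{a}"] \<open>a \<in> A\<close> E(2) by blast
  then show ?thesis
    using spectral_projection_eqI[OF sa E(1) B] E(1) B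
    by (simp add: Proj_def spectral_measure_of_def)
qed

lemma spectral_resolution_mem:
  fixes A :: "'h::chilbert_space op set"
  assumes "von_neumann_algebra A" "a \<in> sa_part A"
  shows "spectral_resolution a t \<in> Proj A"
  unfolding spectral_resolution_def using assms by (intro spectral_projection_mem) auto

lemma spectral_projection_mono:
  fixes a :: "'h::chilbert_space op"
  assumes a: "self_adjoint a" and B: "B \<in> sets borel" "B' \<in> sets borel" "B \<subseteq> B'"
  shows "op_le (spectral_projection a B) (spectral_projection a B')"
proof -
  obtain E where E: "spectral_measure_of a E" using spectral_measure_exists[OF a] by blast
  then have "pvm E" using a by (simp add: spectral_measure_of_iff)
  then show ?thesis
    using pvm_mono(1)[of E B B'] B by (simp add: spectral_projection_eqI[OF a E] op_le_iff)
qed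

lemma spectral_projection_greaterThan:
  fixes a :: "'h::chilbert_space op"
  assumes a: "self_adjoint a"
  shows "spectral_projection a {s<..} = id_blinfun - spectral_resolution a s"
proof -
  obtain E where E: "spectral_measure_of a E" using spectral_measure_exists[OF a] by blast
  then have "pvm E" using a by (simp add: spectral_measure_of_iff)
  from pvm_Compl[OF this, of "{..s}"] show ?thesis
    unfolding spectral_resolution_def
    by (simp add: spectral_projection_eqI[OF a E])
qed

lemma spectral_le_antisym:
  fixes a b :: "'h::chilbert_space op"
  assumes a: "self_adjoint a" and b: "self_adjoint b" and le: "spectral_le a b" "spectral_le b a"
  shows "a = b"
proof (rule spectral_cuts_determine)
  show "symmetric_op a" "symmetric_op b" using a b by (simp_all add: self_adjoint_iff)
  show "spectral_cut a t (spectral_resolution a t)" for t by (rule spectral_resolution_cut[OF a])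
  have "spectral_resolution a t = spectral_resolution b t" for t
  proof (rule symmetric_op_eqI)
    show "symmetric_op (spectral_resolution a t)" "symmetric_op (spectral_resolution b t)"
      using spectral_resolution_cut[OF a, of t] spectral_resolution_cut[OF b, of t]
      by (simp_all add: spectral_cut_def orth_proj_symmetric)
    show "inner x (spectral_resolution a t x) = inner x (spectral_resolution b t x)" for x
      using le unfolding spectral_le_def op_le_iff by (intro antisym) auto
  qed
  then show "spectral_cut b t (spectral_resolution a t)" for t
    using spectral_resolution_cut[OF b, of t] by simp
qed

lemma spectral_resolution_projection_resolution:
  fixes a :: "'h::chilbert_space op"
  assumes a: "self_adjoint a"
  shows "projection_resolution (spectral_resolution a)"
  using a spectral_resolution_cut[OF a]
  by (intro spectral_cut_projection_resolution[of a]) (auto simp: self_adjoint_iff)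

text \<open>Converse of taking resolutions inside \<open>C\<close>: the operator lies in the
  bicommutant of the given projections. Elements of a context can thus be built from projections
  alone.\<close>

lemma projection_resolution_self_adjoint:
  fixes C :: "'h::chilbert_space op set"
  assumes C: "von_neumann_algebra C" and f: "projection_resolution f" and "range f \<subseteq> C"
  obtains b where "b \<in> sa_part C" and "\<And>t. spectral_resolution b t = f t"
proof -
  obtain b where b: "symmetric_op b" "b \<in> real_commutant (real_commutant (range f))"
    "\<And>t. spectral_cut b t (f t)"
    using projection_resolution_operator[OF f] by metis
  have "b \<in> C" by (rule von_neumann_algebra_bicommutant[OF C \<open>range f \<subseteq> C\<close> b(2)])
  moreover have "b \<in> bounded_ops"
    using \<open>b \<in> C\<close> C by (auto simp: von_neumann_algebra_def star_subalgebra_def)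
  ultimately have sa: "self_adjoint b" and "b \<in> sa_part C"
    using b(1) by (simp_all add: self_adjoint_iff sa_part_def)
  then show thesis using that spectral_resolution_eqI[OF sa b(3)] by blast
qed

text \<open>The projection onto the closed span of all ranges. The complement of that span is the
  joint kernel, so anything commuting with \<open>S\<close> respects both, and the projection stays
  in \<open>C\<close>. Minimality is among all projections, so it can later be tested against
  resolutions that lie outside \<open>C\<close>.\<close>

lemma Proj_sup_exists:
  fixes C :: "'h::chilbert_space op set"
  assumes C: "von_neumann_algebra C" and S: "S \<subseteq> Proj C"
  obtains p where "p \<in> Proj C" and "\<And>q. q \<in> S \<Longrightarrow> op_le q p"
    and "\<And>p'. projection p' \<Longrightarrow> \<forall>q\<in>S. op_le q p' \<Longrightarrow> op_le p p'"
proof -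
  define W where "W = (\<Union>q\<in>S. range (blinfun_apply q))"
  have S_proj: "orth_proj q" "projection q" "q \<in> C" if "q \<in> S" for q
    using S that by (auto simp: Proj_def projection_iff)
  obtain P where P: "orth_proj P" "\<And>w. w \<in> W \<Longrightarrow> P w = w"
    "\<And>x. (\<And>w. w \<in> W \<Longrightarrow> inner x w = 0) \<Longrightarrow> P x = 0" "\<And>x. P x \<in> closure (span W)"
    using closure_span_projection[of W] by blast
  have W_perp: "(\<forall>w\<in>W. inner x w = 0) \<longleftrightarrow> (\<forall>q\<in>S. q x = 0)" for x
  proof
    assume *: "\<forall>w\<in>W. inner x w = 0"
    show "\<forall>q\<in>S. q x = 0"
    proof
      fix q assume q: "q \<in> S"
      then have "inner x (q x) = 0" using * by (auto simp: W_def)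
      then show "q x = 0" using S_proj(1)[OF q] by (simp add: orth_proj_inner)
    qed
  next
    assume "\<forall>q\<in>S. q x = 0"
    then show "\<forall>w\<in>W. inner x w = 0"
      using S_proj(1) by (auto simp: W_def orth_proj_sym[symmetric])
  qed
  have "P \<in> real_commutant (real_commutant S)"
  proof (rule real_commutantI)
    fix T x assume T: "T \<in> real_commutant S"
    have Tq: "T (q y) = q (T y)" if "q \<in> S" for q y using real_commutantD[OF T that] .
    have "T (P x) = P (T x)"
    proof (rule closure_span_projection_commute[OF P])
      show "T w \<in> W" if "w \<in> W" for w using that Tq by (auto simp: W_def)
      show "inner (T x) w = 0" if x: "\<And>w. w \<in> W \<Longrightarrow> inner x w = 0" and w: "w \<in> W" for x w
      proof -
        have "\<forall>q\<in>S. q x = 0" using x W_perp by blast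
        then have "\<forall>q\<in>S. q (T x) = 0" by (simp add: Tq[symmetric] blinfun.bilinear_simps)
        then show ?thesis using w W_perp by blast
      qed
    qed
    then show "P (T x) = T (P x)" by simp
  qed
  then have "P \<in> C" using von_neumann_algebra_bicommutant[OF C, of S] S_proj(3) by blast
  then have PC: "P \<in> Proj C"
    using P(1) C by (auto simp: Proj_def projection_iff von_neumann_algebra_def star_subalgebra_def)
  then have P_proj: "projection P" by (simp add: Proj_def)
  show thesis
  proof
    show "P \<in> Proj C" by (rule PC)
    show "op_le q P" if "q \<in> S" for q
      using S_proj(2)[OF that] P_proj P(2) that by (auto simp: op_le_projection_iff W_def)
    show "op_le P p'" if p': "projection p'" and ub: "\<forall>q\<in>S. op_le q p'" for p'
    proof -
      have "p' w = w" if "w \<in> W" for w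
        using that ub S_proj(2) p' by (auto simp: W_def op_le_projection_iff)
      then have "(p' - id_blinfun) (P x) = 0" for x
        by (intro vanishes_on_closure_span[OF _ P(4)]) (simp add: blinfun.bilinear_simps)
      then show ?thesis using p' P_proj by (simp add: op_le_projection_iff blinfun.bilinear_simps)
    qed
  qed
qed

text \<open>The double commutant property exhibits \<open>C\<close> as a real commutant, which gives
  real scaling, differences and norm closedness; closedness serves the fixed point argument for
  characters.\<close>

lemma von_neumann_algebra_closed_ops:
  fixes C :: "'h::chilbert_space op set"
  assumes C: "von_neumann_algebra C"
  shows "id_blinfun \<in> C" and "S \<in> C \<Longrightarrow> T \<in> C \<Longrightarrow> S + T \<in> C"
    and "S \<in> C \<Longrightarrow> T \<in> C \<Longrightarrow> S o\<^sub>L T \<in> C" and "T \<in> C \<Longrightarrow> cscale_op c T \<in> C"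
    and "T \<in> C \<Longrightarrow> k *\<^sub>R T \<in> C" and "S \<in> C \<Longrightarrow> T \<in> C \<Longrightarrow> S - T \<in> C"
    and "closed C"
proof -
  have eq: "C = real_commutant (range (\<lambda>c. cscale_op c id_blinfun) \<union> commutant C)"
    using C commutant_eq_real_commutant[of "commutant C"] by (simp add: von_neumann_algebra_def)
  show "id_blinfun \<in> C" "S \<in> C \<Longrightarrow> T \<in> C \<Longrightarrow> S + T \<in> C"
    "S \<in> C \<Longrightarrow> T \<in> C \<Longrightarrow> S o\<^sub>L T \<in> C" "T \<in> C \<Longrightarrow> cscale_op c T \<in> C"
    using C by (simp_all add: von_neumann_algebra_def star_subalgebra_def)
  show "T \<in> C \<Longrightarrow> k *\<^sub>R T \<in> C" by (subst (asm) eq, subst eq) (rule real_commutant_scaleR)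
  show "S \<in> C \<Longrightarrow> T \<in> C \<Longrightarrow> S - T \<in> C"
    by (subst (asm) eq, subst (asm) (2) eq, subst eq) (rule real_commutant_diff)
  show "closed C" by (subst eq) (rule closed_real_commutant)
qed

lemma Proj_compl:
  fixes C :: "'h::chilbert_space op set"
  assumes "von_neumann_algebra C" "p \<in> Proj C"
  shows "id_blinfun - p \<in> Proj C"
  using assms by (simp add: Proj_def projection_compl von_neumann_algebra_closed_ops)

lemma Proj_inf_exists:
  fixes C :: "'h::chilbert_space op set"
  assumes C: "von_neumann_algebra C" and S: "S \<subseteq> Proj C"
  obtains p where "p \<in> Proj C" and "\<And>q. q \<in> S \<Longrightarrow> op_le p q"
    and "\<And>p'. projection p' \<Longrightarrow> \<forall>q\<in>S. op_le p' q \<Longrightarrow> op_le p' p"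
proof -
  obtain p where p: "p \<in> Proj C" "\<And>q. q \<in> (\<lambda>q. id_blinfun - q) ` S \<Longrightarrow> op_le q p"
    "\<And>p'. projection p' \<Longrightarrow> \<forall>q\<in>(\<lambda>q. id_blinfun - q) ` S. op_le q p' \<Longrightarrow> op_le p p'"
    by (rule Proj_sup_exists[OF C, of "(\<lambda>q. id_blinfun - q) ` S"])
      (use S Proj_compl[OF C] in blast, rule that)
  show thesis
  proof
    show "id_blinfun - p \<in> Proj C" by (rule Proj_compl[OF C p(1)])
    show "op_le (id_blinfun - p) q" if "q \<in> S" for q
      using p(2)[of "id_blinfun - q"] that op_le_compl_iff(3) by blast
    show "op_le p' (id_blinfun - p)" if "projection p'" "\<forall>q\<in>S. op_le p' q" for p'
    proof -
      have "op_le p (id_blinfun - p')"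
        using p(3)[OF projection_compl[OF that(1)]] that(2) op_le_compl_iff(1) by blast
      then show ?thesis using op_le_compl_iff(2) by blast
    qed
  qed
qed

section \<open>Daseinisation\<close>

text \<open>A lower bound belonging to \<open>S\<close> is the infimum whatever carrier surrounds
  \<open>S\<close>, so for both daseinisations it is enough to find attained extrema inside
  \<open>C\<close>.\<close>

lemma gorder_inf_eq_least:
  assumes "m \<in> S" and "S \<subseteq> X" and "\<And>x. x \<in> S \<Longrightarrow> R m x"
    and "\<And>x y. x \<in> X \<Longrightarrow> y \<in> X \<Longrightarrow> R x y \<Longrightarrow> R y x \<Longrightarrow> x = y"
  shows "\<Sqinter>\<^bsub>\<lparr>carrier = X, eq = (=), le = R\<rparr>\<^esub> S = m"
proof -
  let ?L = "\<lparr>carrier = X, eq = (=), le = R\<rparr>"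
  have m: "greatest ?L m (Lower ?L S)"
    using assms by (auto simp: greatest_def Lower_def)
  have "x = m" if "greatest ?L x (Lower ?L S)" for x
    using that m assms(1,2,4) unfolding greatest_def Lower_def by auto
  then show ?thesis unfolding Lattice.inf_def using m by (rule some_equality[rotated])
qed

lemma gorder_sup_eq_greatest:
  assumes "m \<in> S" and "S \<subseteq> X" and "\<And>x. x \<in> S \<Longrightarrow> R x m"
    and "\<And>x y. x \<in> X \<Longrightarrow> y \<in> X \<Longrightarrow> R x y \<Longrightarrow> R y x \<Longrightarrow> x = y"
  shows "\<Squnion>\<^bsub>\<lparr>carrier = X, eq = (=), le = R\<rparr>\<^esub> S = m"
proof -
  let ?L = "\<lparr>carrier = X, eq = (=), le = R\<rparr>"
  have m: "least ?L m (Upper ?L S)"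
    using assms by (auto simp: least_def Upper_def)
  have "x = m" if "least ?L x (Upper ?L S)" for x
    using that m assms(1,2,4) unfolding least_def Upper_def by auto
  then show ?thesis unfolding Lattice.sup_def using m by (rule some_equality[rotated])
qed

text \<open>Common to both daseinisations: the right regularisation of \<open>d\<close> is the
  resolution of an element of \<open>C\<close>. The two estimates are the sandwich through which
  \<open>b\<close> is used afterwards.\<close>

lemma projection_family_self_adjoint:
  fixes C :: "'h::chilbert_space op set"
  assumes C: "von_neumann_algebra C" and d: "\<And>t. d t \<in> Proj C"
    and mono: "\<And>s t. s \<le> t \<Longrightarrow> op_le (d s) (d t)"
    and bd: "\<And>t. t < -M \<Longrightarrow> d t = 0" "\<And>t. M \<le> t \<Longrightarrow> d t = id_blinfun"
  obtains b where "b \<in> sa_part C" and "\<And>t. op_le (d t) (spectral_resolution b t)"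
    and "\<And>s t. s < t \<Longrightarrow> op_le (spectral_resolution b s) (d t)"
proof -
  have proj: "projection (d t)" "orth_proj (d t)" "d t \<in> C" for t
    using d[of t] by (auto simp: Proj_def projection_iff)
  have dd: "d t (d s x) = d s x" if "s \<le> t" for s t x
    using mono[OF that] by (simp add: op_le_projection_iff proj)
  have bd': "\<exists>M. \<forall>t. (t < -M \<longrightarrow> d t = 0) \<and> (M \<le> t \<longrightarrow> d t = id_blinfun)"
    using bd by blast
  obtain f where f: "projection_resolution f"
    "\<And>t x. (\<lambda>n. d (t + 1 / real (Suc n)) x) \<longlonglongrightarrow> f t x"
    "\<And>t x. f t (d t x) = d t x" "\<And>s t x. s < t \<Longrightarrow> d t (f s x) = f s x"
    by (rule projection_family_right_limit[OF proj(2) dd bd']) (assumption, rule that)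
  have "f t \<in> real_commutant (real_commutant (range d))" for t
    by (rule real_commutant_limit[OF _ f(2)]) (use subset_real_bicommutant[of "range d"] in blast)
  then have "f t \<in> C" for t
    using von_neumann_algebra_bicommutant[OF C, of "range d"] proj(3) by blast
  then obtain b where b: "b \<in> sa_part C" "\<And>t. spectral_resolution b t = f t"
    using projection_resolution_self_adjoint[OF C f(1)] by blast
  have f_proj: "projection (f t)" for t
    using spectral_resolution_mem[OF C b(1), of t] b(2) by (simp add: Proj_def)
  show thesis
    by (rule that[OF b(1)]) (simp_all add: b(2) op_le_projection_iff proj f_proj f(3,4))
qed

text \<open>Right continuity of the forms. It recovers at s an estimate that the sandwich supplies
  only at points t > s.\<close>

lemma spectral_resolution_right_lower_bound:
  fixes a S :: "'h::chilbert_space op"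
  assumes a: "self_adjoint a" and le: "\<And>t. s < t \<Longrightarrow> op_le S (spectral_resolution a t)"
  shows "op_le S (spectral_resolution a s)"
  unfolding op_le_iff
proof
  fix x
  have "continuous (at_right s) (\<lambda>t. inner x (spectral_resolution a t x))"
    using spectral_resolution_projection_resolution[OF a] by (simp add: projection_resolution_def)
  then have lim: "((\<lambda>t. inner x (spectral_resolution a t x)) \<longlongrightarrow> inner x (spectral_resolution a s x)) (at_right s)"
    by (simp add: continuous_within)
  have "\<forall>\<^sub>F t in at_right s. inner x (S x) \<le> inner x (spectral_resolution a t x)"
    using eventually_at_right_less[of s] by eventually_elim (use le op_le_iff in blast)
  then show "inner x (S x) \<le> inner x (spectral_resolution a s x)"
    by (rule tendsto_lowerbound[OF lim]) simp
qed

lemma spectral_resolution_mono: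
  fixes a :: "'h::chilbert_space op"
  assumes "self_adjoint a" "s \<le> t"
  shows "op_le (spectral_resolution a s) (spectral_resolution a t)"
  unfolding spectral_resolution_def using assms by (intro spectral_projection_mono) auto

lemma spectral_resolution_bounds:
  fixes a :: "'h::chilbert_space op"
  assumes "self_adjoint a"
  shows "t < - norm a \<Longrightarrow> spectral_resolution a t = 0"
    and "norm a \<le> t \<Longrightarrow> spectral_resolution a t = id_blinfun"
  using spectral_resolution_cut[OF assms] spectral_cut_small spectral_cut_large by blast+

lemma projection_0: "projection 0" and projection_id: "projection id_blinfun"
  by (auto simp: projection_iff orth_proj_0 orth_proj_id bounded_ops_eq_real_commutant
      zero_in_real_commutant id_in_real_commutant)

lemma projection_bounds:
  fixes p :: "'h::chilbert_space op"
  assumes "projection p"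
  shows "op_le 0 p" and "op_le p id_blinfun"
  using assms by (simp_all add: op_le_projection_iff projection_0 projection_id blinfun.bilinear_simps)

lemma id_in_Proj: "von_neumann_algebra C \<Longrightarrow> id_blinfun \<in> Proj C"
  by (simp add: Proj_def projection_id von_neumann_algebra_closed_ops)

lemma zero_in_Proj: "von_neumann_algebra C \<Longrightarrow> 0 \<in> Proj C"
  using Proj_compl[OF _ id_in_Proj] by fastforce

text \<open>\<open>p\<close> itself need not lie in \<open>C\<close>, but the infimum from
  \<open>Proj_inf_exists\<close> is greatest among all projections below the family; hence it
  dominates \<open>p\<close> and belongs to the family.\<close>

lemma outer_das_proj_least:
  fixes A C :: "'h::chilbert_space op set"
  assumes C: "von_neumann_algebra C" and "C \<subseteq> A" and p: "p \<in> Proj A"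
  shows "outer_das_proj A p C \<in> Proj C" and "op_le p (outer_das_proj A p C)"
    and "\<And>q. q \<in> Proj C \<Longrightarrow> op_le p q \<Longrightarrow> op_le (outer_das_proj A p C) q"
proof -
  let ?S = "{q \<in> Proj C. op_le p q}"
  have sub: "?S \<subseteq> Proj C" by blast
  obtain m where m: "m \<in> Proj C" "\<And>q. q \<in> ?S \<Longrightarrow> op_le m q"
    "\<And>p'. projection p' \<Longrightarrow> \<forall>q\<in>?S. op_le p' q \<Longrightarrow> op_le p' m"
    by (rule Proj_inf_exists[OF C sub]) (rule that)
  have pm: "op_le p m" using m(3)[of p] p by (simp add: Proj_def)
  have "outer_das_proj A p C = m"
    unfolding outer_das_proj_def Proj_order_def
  proof (rule gorder_inf_eq_least)
    show "m \<in> ?S" using m(1) pm by simp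
    show "?S \<subseteq> Proj A" using \<open>C \<subseteq> A\<close> by (auto simp: Proj_def)
    show "op_le m x" if "x \<in> ?S" for x using m(2) that .
    show "x = y" if "x \<in> Proj A" "y \<in> Proj A" "op_le x y" "op_le y x" for x y
      using that projection_antisym by (auto simp: Proj_def)
  qed
  then show "outer_das_proj A p C \<in> Proj C" and "op_le p (outer_das_proj A p C)"
    and "\<And>q. q \<in> Proj C \<Longrightarrow> op_le p q \<Longrightarrow> op_le (outer_das_proj A p C) q"
    using m(1,2) pm by auto
qed

text \<open>The infimum defining the outer daseinisation is a minimum: its spectral resolution is
  \<open>t \<mapsto> \<And>\<^sub>u\<^sub>>\<^sub>t \<Or>{q \<in> Proj C. q \<le> e\<^sup>a\<^sub>u}\<close>.\<close>

lemma outer_das_resolution: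
  fixes A C :: "'h::chilbert_space op set"
  assumes C: "von_neumann_algebra C" and CA: "C \<subseteq> A" and a: "self_adjoint a"
  shows "outer_das A a C \<in> sa_part C" and "spectral_le a (outer_das A a C)"
    and "\<And>q t. q \<in> Proj C \<Longrightarrow> op_le q (spectral_resolution a t) \<Longrightarrow>
      op_le q (spectral_resolution (outer_das A a C) t)"
proof -
  let ?e = "spectral_resolution a"
  note e_proj = projection_spectral_resolution[OF a]
  have "\<exists>p\<in>Proj C. (\<forall>q\<in>{q \<in> Proj C. op_le q (?e t)}. op_le q p) \<and>
      (\<forall>p'. projection p' \<longrightarrow> (\<forall>q\<in>{q \<in> Proj C. op_le q (?e t)}. op_le q p') \<longrightarrow> op_le p p')" for t
    by (rule Proj_sup_exists[OF C, of "{q \<in> Proj C. op_le q (?e t)}"]) blast+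
  then obtain d where d: "\<And>t. d t \<in> Proj C"
    and ub: "\<And>q t. q \<in> Proj C \<Longrightarrow> op_le q (?e t) \<Longrightarrow> op_le q (d t)"
    and lub: "\<And>t p'. projection p' \<Longrightarrow> \<forall>q\<in>Proj C. op_le q (?e t) \<longrightarrow> op_le q p' \<Longrightarrow> op_le (d t) p'"
    by (simp add: Ball_def) metis
  have d_proj: "projection (d t)" for t using d by (simp add: Proj_def)
  \<comment> \<open>The supremum may be compared with the resolution of \<open>a\<close> although
    the latter need not lie in \<open>C\<close>.\<close>
  have de: "op_le (d t) (?e t)" for t by (rule lub) (simp_all add: e_proj)
  have mono: "op_le (d s) (d t)" if "s \<le> t" for s t
    using op_le_trans[OF de spectral_resolution_mono[OF a that]] d ub by blast
  have small: "d t = 0" if "t < - norm a" for t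
    using de[of t] spectral_resolution_bounds(1)[OF a that] projection_bounds(1)[OF d_proj]
    by (intro projection_antisym d_proj projection_0) simp_all
  have large: "d t = id_blinfun" if "norm a \<le> t" for t
  proof (intro projection_antisym d_proj projection_id projection_bounds)
    show "op_le id_blinfun (d t)"
      by (rule ub) (simp_all add: id_in_Proj C spectral_resolution_bounds(2)[OF a that] op_le_refl)
  qed
  obtain b where b: "b \<in> sa_part C" "\<And>t. op_le (d t) (spectral_resolution b t)"
    "\<And>s t. s < t \<Longrightarrow> op_le (spectral_resolution b s) (d t)"
    by (rule projection_family_self_adjoint[of C d "norm a", OF C d mono small large])
      (assumption+, rule that)
  have ab: "spectral_le a b"
    unfolding spectral_le_def
  proof
    show "op_le (spectral_resolution b s) (?e s)" for s
      by (rule spectral_resolution_right_lower_bound[OF a]) (rule op_le_trans[OF b(3) de])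
  qed
  have "outer_das A a C = b"
    unfolding outer_das_def spectral_order_def
  proof (rule gorder_inf_eq_least)
    show "b \<in> {b \<in> sa_part C. spectral_le a b}" using b(1) ab by simp
    show "{b \<in> sa_part C. spectral_le a b} \<subseteq> sa_part A" using CA by (auto simp: sa_part_def)
    show "spectral_le b b'" if b': "b' \<in> {b \<in> sa_part C. spectral_le a b}" for b'
      unfolding spectral_le_def
    proof
      fix t
      have "op_le (spectral_resolution b' t) (d t)"
        using b' spectral_resolution_mem[OF C, of b' t] by (intro ub) (auto simp: spectral_le_def)
      then show "op_le (spectral_resolution b' t) (spectral_resolution b t)"
        using b(2) by (rule op_le_trans)
    qed
    show "x = y" if "x \<in> sa_part A" "y \<in> sa_part A" "spectral_le x y" "spectral_le y x" for x y
      using that spectral_le_antisym by (auto simp: sa_part_def)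
  qed
  then show "outer_das A a C \<in> sa_part C" and "spectral_le a (outer_das A a C)"
    and "\<And>q t. q \<in> Proj C \<Longrightarrow> op_le q (spectral_resolution a t) \<Longrightarrow>
      op_le q (spectral_resolution (outer_das A a C) t)"
    by (simp_all only: b(1) ab op_le_trans[OF ub b(2)])
qed

text \<open>Dual to the outer case, except that infima of dominating projections need not be right
  continuous in t. The regularisation can move upwards, so the last estimate compares s with a
  strictly larger t.\<close>

lemma inner_das_resolution:
  fixes A C :: "'h::chilbert_space op set"
  assumes C: "von_neumann_algebra C" and CA: "C \<subseteq> A" and a: "self_adjoint a"
  shows "inner_das A a C \<in> sa_part C" and "spectral_le (inner_das A a C) a"
    and "\<And>q s t. s < t \<Longrightarrow> q \<in> Proj C \<Longrightarrow> op_le (spectral_resolution a t) q \<Longrightarrow>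
      op_le (spectral_resolution (inner_das A a C) s) q"
proof -
  let ?e = "spectral_resolution a"
  note e_proj = projection_spectral_resolution[OF a]
  have "\<exists>p\<in>Proj C. (\<forall>q\<in>{q \<in> Proj C. op_le (?e t) q}. op_le p q) \<and>
      (\<forall>p'. projection p' \<longrightarrow> (\<forall>q\<in>{q \<in> Proj C. op_le (?e t) q}. op_le p' q) \<longrightarrow> op_le p' p)" for t
    by (rule Proj_inf_exists[OF C, of "{q \<in> Proj C. op_le (?e t) q}"]) blast+
  then obtain d where d: "\<And>t. d t \<in> Proj C"
    and lb: "\<And>q t. q \<in> Proj C \<Longrightarrow> op_le (?e t) q \<Longrightarrow> op_le (d t) q"
    and glb: "\<And>t p'. projection p' \<Longrightarrow> \<forall>q\<in>Proj C. op_le (?e t) q \<longrightarrow> op_le p' q \<Longrightarrow> op_le p' (d t)"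
    by (simp add: Ball_def) metis
  have d_proj: "projection (d t)" for t using d by (simp add: Proj_def)
  have ed: "op_le (?e t) (d t)" for t by (rule glb) (simp_all add: e_proj)
  have mono: "op_le (d s) (d t)" if "s \<le> t" for s t
    using op_le_trans[OF spectral_resolution_mono[OF a that] ed] d lb by blast
  have small: "d t = 0" if "t < - norm a" for t
  proof (intro projection_antisym d_proj projection_0 projection_bounds)
    show "op_le (d t) 0"
      by (rule lb) (simp_all add: zero_in_Proj C spectral_resolution_bounds(1)[OF a that] op_le_refl)
  qed
  have large: "d t = id_blinfun" if "norm a \<le> t" for t
    using ed[of t] spectral_resolution_bounds(2)[OF a that] projection_bounds(2)[OF d_proj]
    by (intro projection_antisym d_proj projection_id) simp_all
  obtain b where b: "b \<in> sa_part C" "\<And>t. op_le (d t) (spectral_resolution b t)"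
    "\<And>s t. s < t \<Longrightarrow> op_le (spectral_resolution b s) (d t)"
    by (rule projection_family_self_adjoint[of C d "norm a", OF C d mono small large])
      (assumption+, rule that)
  have ba: "spectral_le b a"
    unfolding spectral_le_def using op_le_trans[OF ed b(2)] by blast
  have eq: "inner_das A a C = b"
    unfolding inner_das_def spectral_order_def
  proof (rule gorder_sup_eq_greatest)
    show "b \<in> {b \<in> sa_part C. spectral_le b a}" using b(1) ba by simp
    show "{b \<in> sa_part C. spectral_le b a} \<subseteq> sa_part A" using CA by (auto simp: sa_part_def)
    show "spectral_le b' b" if b': "b' \<in> {b \<in> sa_part C. spectral_le b a}" for b'
      unfolding spectral_le_def
    proof
      fix s
      \<comment> \<open>The resolution of \<open>b'\<close> is itself a competitor in the infimum d
        t, being in \<open>C\<close> and above the resolution of \<open>a\<close>.\<close>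
      have db': "op_le (d t) (spectral_resolution b' t)" for t
        using b' spectral_resolution_mem[OF C, of b' t] by (intro lb) (auto simp: spectral_le_def)
      have "self_adjoint b'" using b' by (simp add: sa_part_def)
      then show "op_le (spectral_resolution b s) (spectral_resolution b' s)"
        by (rule spectral_resolution_right_lower_bound) (rule op_le_trans[OF b(3) db'])
    qed
    show "x = y" if "x \<in> sa_part A" "y \<in> sa_part A" "spectral_le x y" "spectral_le y x" for x y
      using that spectral_le_antisym by (auto simp: sa_part_def)
  qed
  show "inner_das A a C \<in> sa_part C" and "spectral_le (inner_das A a C) a"
    by (simp_all only: eq b(1) ba)
  show "op_le (spectral_resolution (inner_das A a C) s) q"
    if "s < t" "q \<in> Proj C" "op_le (spectral_resolution a t) q" for q s t
    unfolding eq by (rule op_le_trans[OF b(3)[OF that(1)] lb[OF that(2,3)]])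
qed

section \<open>Characters\<close>

lemma gelfand_spectrum_simps:
  fixes C :: "'h::chilbert_space op set"
  assumes C: "von_neumann_algebra C" and l: "l \<in> gelfand_spectrum C"
  shows "l id_blinfun = 1" and "S \<in> C \<Longrightarrow> T \<in> C \<Longrightarrow> l (S + T) = l S + l T"
    and "T \<in> C \<Longrightarrow> l (cscale_op c T) = c * l T"
    and "S \<in> C \<Longrightarrow> T \<in> C \<Longrightarrow> l (S o\<^sub>L T) = l S * l T"
    and "T \<in> C \<Longrightarrow> l (k *\<^sub>R T) = of_real k * l T"
    and "S \<in> C \<Longrightarrow> T \<in> C \<Longrightarrow> l (S - T) = l S - l T"
proof -
  show *: "l id_blinfun = 1" "S \<in> C \<Longrightarrow> T \<in> C \<Longrightarrow> l (S + T) = l S + l T"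
    "T \<in> C \<Longrightarrow> l (cscale_op c T) = c * l T" "S \<in> C \<Longrightarrow> T \<in> C \<Longrightarrow> l (S o\<^sub>L T) = l S * l T" for S T c
    using l by (auto simp: gelfand_spectrum_def)
  have scale: "k *\<^sub>R T = cscale_op (of_real k) T" for k and T :: "'h op"
    by (rule blinfun_eqI) (simp add: blinfun.scaleR_left cscale_op_apply scaleC_of_real)
  show "T \<in> C \<Longrightarrow> l (k *\<^sub>R T) = of_real k * l T"
    unfolding scale by (rule *(3))
  show "l (S - T) = l S - l T" if "S \<in> C" "T \<in> C"
  proof -
    have "l S = l ((S - T) + T)" by simp
    also have "\<dots> = l (S - T) + l T"
      using that C by (intro *(2) von_neumann_algebra_closed_ops)
    finally show ?thesis by simp
  qed
qed

text \<open>If \<open>\<bar>l Y\<bar> > 1\<close>, then \<open>1 - T\<close> with \<open>T = Y / l Y\<close> has a right inverse in \<open>C\<close>, the fixed point of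
  \<open>G \<mapsto> 1 + TG\<close>, although \<open>l (1 - T) = 0\<close>.\<close>

lemma gelfand_spectrum_contractive:
  fixes C :: "'h::chilbert_space op set"
  assumes C: "von_neumann_algebra C" and l: "l \<in> gelfand_spectrum C" and Y: "Y \<in> C" "norm Y \<le> 1"
  shows "Re (l Y) \<le> 1"
proof (rule ccontr)
  assume "\<not> Re (l Y) \<le> 1"
  then have big: "cmod (l Y) > 1"
    using complex_Re_le_cmod[of "l Y"] by linarith
  note simps = gelfand_spectrum_simps[OF C l] and closed = von_neumann_algebra_closed_ops[OF C]
  define T where "T = cscale_op (1 / l Y) Y"
  have TC: "T \<in> C" using Y(1) by (simp add: T_def closed)
  have lT: "l T = 1" using big Y(1) by (auto simp: T_def simps)
  have T_norm: "norm T \<le> 1 / cmod (l Y)"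
  proof (rule norm_blinfun_bound)
    show "norm (T x) \<le> 1 / cmod (l Y) * norm x" for x
      using order_trans[OF norm_blinfun[of Y x] mult_right_mono[OF Y(2) norm_ge_zero[of x]]] big
      by (simp add: T_def cscale_op_apply norm_scaleC norm_divide divide_right_mono)
  qed simp
  have "\<exists>!G. G \<in> C \<and> id_blinfun + (T o\<^sub>L G) = G"
  proof (rule Banach_fix)
    show "complete C" using closed(7) by (simp add: complete_eq_closed)
    show "C \<noteq> {}" using closed(1) by blast
    show "1 / cmod (l Y) < 1" using big by (subst divide_less_eq_1_pos) linarith+
    show "(\<lambda>G. id_blinfun + (T o\<^sub>L G)) ` C \<subseteq> C" using TC closed by auto
    have "norm ((T o\<^sub>L S) - (T o\<^sub>L S')) \<le> 1 / cmod (l Y) * norm (S - S')" for S S'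
    proof -
      have "(T o\<^sub>L S) - (T o\<^sub>L S') = T o\<^sub>L (S - S')"
        by (rule blinfun_eqI) (simp add: blinfun.bilinear_simps)
      then show ?thesis
        using order_trans[OF norm_blinfun_compose mult_right_mono[OF T_norm norm_ge_zero]] by simp
    qed
    then show "dist (id_blinfun + (T o\<^sub>L S)) (id_blinfun + (T o\<^sub>L S')) \<le> 1 / cmod (l Y) * dist S S'" for S S'
      by (simp add: dist_norm)
  qed simp
  then obtain G where G: "G \<in> C" "id_blinfun + (T o\<^sub>L G) = G" by blast
  have "l G = l (id_blinfun + (T o\<^sub>L G))" using G(2) by simp
  also have "\<dots> = 1 + l G" using TC G(1) by (simp add: simps closed lT)
  finally show False by simp
qed

lemma gelfand_spectrum_projection:
  fixes C :: "'h::chilbert_space op set"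
  assumes C: "von_neumann_algebra C" and l: "l \<in> gelfand_spectrum C" and p: "p \<in> Proj C"
  shows "l p = 0 \<or> l p = 1" and "l (id_blinfun - p) = 1 - l p"
    and "q \<in> Proj C \<Longrightarrow> op_le p q \<Longrightarrow> l p = 1 \<Longrightarrow> l q = 1"
proof -
  note simps = gelfand_spectrum_simps[OF C l]
  have pC: "p \<in> C" "p o\<^sub>L p = p" using p by (auto simp: Proj_def projection_def)
  have "l p = l p * l p" using simps(4)[OF pC(1) pC(1)] pC(2) by simp
  then show "l p = 0 \<or> l p = 1" by simp
  show "l (id_blinfun - p) = 1 - l p"
    using pC by (simp add: simps von_neumann_algebra_closed_ops[OF C])
  show "l q = 1" if q: "q \<in> Proj C" "op_le p q" "l p = 1"
  proof -
    have "q o\<^sub>L p = p"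
      using p q(1,2) by (intro blinfun_eqI) (simp add: Proj_def op_le_projection_iff)
    then have "l p = l q * l p" using simps(4)[of q p] q(1) pC(1) by (simp add: Proj_def)
    then show ?thesis using q(3) by simp
  qed
qed

text \<open>Apply \<open>l\<close> to k (1 - Y) e = (t - b) e, or to k (1 - Y)(1 - e) = (b - t)(1 -
  e) when \<open>l\<close> vanishes on e. The left side is k (1 - l Y), whose real part is
  nonnegative because characters are contractive.\<close>

lemma gelfand_spectrum_resolution:
  fixes C :: "'h::chilbert_space op set"
  assumes C: "von_neumann_algebra C" and l: "l \<in> gelfand_spectrum C" and b: "b \<in> sa_part C"
  shows "l (spectral_resolution b t) = 1 \<Longrightarrow> Re (l b) \<le> t"
    and "l (spectral_resolution b t) = 0 \<Longrightarrow> t \<le> Re (l b)"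
proof -
  note simps = gelfand_spectrum_simps[OF C l] and closed = von_neumann_algebra_closed_ops[OF C]
  have sa: "self_adjoint b" and bC: "b \<in> C" using b by (auto simp: sa_part_def)
  have sym: "symmetric_op b" using sa by (simp add: self_adjoint_iff)
  obtain e Y k where e: "spectral_cut b t e" and k: "0 \<le> k" and Y: "norm Y \<le> 1"
    and Y_comm: "Y \<in> real_commutant (real_commutant {b})"
    and on: "(k *\<^sub>R (id_blinfun - Y)) o\<^sub>L e = (t *\<^sub>R id_blinfun - b) o\<^sub>L e"
    and off: "(k *\<^sub>R (id_blinfun - Y)) o\<^sub>L (id_blinfun - e) = (b - t *\<^sub>R id_blinfun) o\<^sub>L (id_blinfun - e)"
    using spectral_cut_exists[OF sym, of t] by metis
  have e_eq: "spectral_resolution b t = e" by (rule spectral_resolution_eqI[OF sa e])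
  have eC: "e \<in> C" using spectral_resolution_mem[OF C b, of t] by (simp add: e_eq Proj_def)
  have YC: "Y \<in> C" using von_neumann_algebra_bicommutant[OF C, of "{b}"] bC Y_comm by blast
  have pos: "0 \<le> k * (1 - Re (l Y))"
    using k gelfand_spectrum_contractive[OF C l YC Y] by simp
  show "Re (l b) \<le> t" if "l (spectral_resolution b t) = 1"
  proof -
    have "of_real k * (1 - l Y) = of_real t - l b"
      using arg_cong[OF on, of l] that bC YC eC by (simp add: simps closed e_eq)
    from arg_cong[OF this, of Re] show ?thesis using pos by simp
  qed
  show "t \<le> Re (l b)" if "l (spectral_resolution b t) = 0"
  proof -
    have "of_real k * (1 - l Y) = l b - of_real t"
      using arg_cong[OF off, of l] that bC YC eC by (simp add: simps closed e_eq)
    from arg_cong[OF this, of Re] show ?thesis using pos by simp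
  qed
qed

lemma outer_das_bounds:
  fixes A C :: "'h::chilbert_space op set" and s :: real
  assumes A: "von_neumann_algebra A" and C: "von_neumann_algebra C" and CA: "C \<subseteq> A"
    and a: "a \<in> sa_part A" and l: "l \<in> gelfand_spectrum C"
  defines "q \<equiv> outer_das_proj A (spectral_projection a {s<..}) C"
  shows "s < Re (l (outer_das A a C)) \<Longrightarrow> l q = 1"
    and "l q = 1 \<Longrightarrow> s \<le> Re (l (outer_das A a C))"
proof -
  have sa: "self_adjoint a" using a by (simp add: sa_part_def)
  let ?b = "outer_das A a C" and ?e = "spectral_resolution a"
  note b = outer_das_resolution[OF C CA sa]
  have p: "spectral_projection a {s<..} \<in> Proj A" by (rule spectral_projection_mem[OF A a]) simp
  note q = outer_das_proj_least[OF C CA p, folded q_def]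
  have q': "op_le (id_blinfun - ?e s) q"
    using q(2) by (simp add: spectral_projection_greaterThan[OF sa])
  \<comment> \<open>Otherwise \<open>l\<close> is 1 on 1 - q, a projection of \<open>C\<close> below
    the resolution of \<open>a\<close> at s and therefore below that of the daseinisation.\<close>
  show "l q = 1" if s: "s < Re (l ?b)"
  proof (rule ccontr)
    assume "l q \<noteq> 1"
    then have "l (id_blinfun - q) = 1"
      using gelfand_spectrum_projection(1,2)[OF C l q(1)] by auto
    moreover have "op_le (id_blinfun - q) (spectral_resolution ?b s)"
      using b(3)[OF Proj_compl[OF C q(1)]] q' op_le_compl_iff(3) by blast
    ultimately have "l (spectral_resolution ?b s) = 1"
      using gelfand_spectrum_projection(3)[OF C l Proj_compl[OF C q(1)] spectral_resolution_mem[OF C b(1)]]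
      by blast
    then show False using gelfand_spectrum_resolution(1)[OF C l b(1)] s by fastforce
  qed
  \<comment> \<open>The complement of the resolution of \<open>?b\<close> at s is a projection in
    \<open>C\<close> above the spectral projection, so it dominates \<open>q\<close>. The strict
    inequality is lost in passing from value 0 on the resolution to s as a lower bound.\<close>
  show "s \<le> Re (l ?b)" if "l q = 1"
  proof -
    let ?f = "spectral_resolution ?b s"
    have f: "?f \<in> Proj C" by (rule spectral_resolution_mem[OF C b(1)])
    have "op_le (id_blinfun - ?e s) (id_blinfun - ?f)"
      using b(2) unfolding op_le_compl_iff(1) spectral_le_def by blast
    then have "op_le q (id_blinfun - ?f)"
      using q(3)[OF Proj_compl[OF C f]] by (simp add: spectral_projection_greaterThan[OF sa])
    then have "l (id_blinfun - ?f) = 1"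
      using gelfand_spectrum_projection(3)[OF C l q(1) Proj_compl[OF C f]] that by blast
    then have "l ?f = 0" using gelfand_spectrum_projection(2)[OF C l f] by simp
    then show ?thesis using gelfand_spectrum_resolution(2)[OF C l b(1)] by blast
  qed
qed

lemma inner_das_bounds:
  fixes A C :: "'h::chilbert_space op set" and r :: real
  assumes A: "von_neumann_algebra A" and C: "von_neumann_algebra C" and CA: "C \<subseteq> A"
    and a: "a \<in> sa_part A" and l: "l \<in> gelfand_spectrum C"
  defines "q \<equiv> outer_das_proj A (spectral_projection a {..<r}) C"
  shows "Re (l (inner_das A a C)) < r \<Longrightarrow> l q = 1"
    and "l q = 1 \<Longrightarrow> Re (l (inner_das A a C)) \<le> r"
proof -
  have sa: "self_adjoint a" using a by (simp add: sa_part_def)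
  let ?b = "inner_das A a C"
  note b = inner_das_resolution[OF C CA sa]
  have p: "spectral_projection a {..<r} \<in> Proj A" by (rule spectral_projection_mem[OF A a]) simp
  note q = outer_das_proj_least[OF C CA p, folded q_def]
  have f: "spectral_resolution ?b t \<in> Proj C" for t by (rule spectral_resolution_mem[OF C b(1)])
  show "l q = 1" if r: "Re (l ?b) < r"
  proof (rule ccontr)
    assume "l q \<noteq> 1"
    have "x \<le> Re (l ?b)" if "x < r" for x
    proof -
      \<comment> \<open>The intermediate point serves twice: y < r puts the closed half-line {..y}
        inside the open {..<r}, and x < y is the gap required by
        \<open>inner_das_resolution\<close>.\<close>
      obtain y where y: "x < y" "y < r" using dense[OF \<open>x < r\<close>] by blast
      have "op_le (spectral_resolution a y) (spectral_projection a {..<r})"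
        unfolding spectral_resolution_def using y by (intro spectral_projection_mono sa) auto
      then have "op_le (spectral_resolution a y) q" using q(2) by (rule op_le_trans)
      then have "op_le (spectral_resolution ?b x) q" by (rule b(3)[OF y(1) q(1)])
      then have "l (spectral_resolution ?b x) = 0"
        using \<open>l q \<noteq> 1\<close> gelfand_spectrum_projection(1)[OF C l f]
          gelfand_spectrum_projection(3)[OF C l f q(1)] by blast
      then show ?thesis using gelfand_spectrum_resolution(2)[OF C l b(1)] by blast
    qed
    then have "r \<le> Re (l ?b)" by (rule dense_le)
    then show False using r by simp
  qed
  show "Re (l ?b) \<le> r" if "l q = 1"
  \<comment> \<open>The closed half-line {..r} replaces {..<r} here, which is why only a weak bound
    at r results.\<close>
  proof -
    have "op_le (spectral_projection a {..<r}) (spectral_resolution a r)"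
      unfolding spectral_resolution_def by (intro spectral_projection_mono sa) auto
    moreover have "op_le (spectral_resolution a r) (spectral_resolution ?b r)"
      using b(2) by (simp add: spectral_le_def)
    ultimately have "op_le q (spectral_resolution ?b r)"
      using q(3)[OF f] op_le_trans by blast
    then have "l (spectral_resolution ?b r) = 1"
      using gelfand_spectrum_projection(3)[OF C l q(1) f] that by blast
    then show ?thesis using gelfand_spectrum_resolution(1)[OF C l b(1)] by blast
  qed
qed

lemma openin_daseinisation_rectangle:
  "openin (prod_topology (context_topology A) (prod_topology R_u R_l))
    (contexts A \<times> {..<ereal u} \<times> {ereal v<..})"
proof -
  have "openin (context_topology A) (contexts A)"
    by (simp add: openin_context_topology)
  moreover have "openin R_u {..<ereal u}" "openin R_l {ereal v<..}"
    unfolding R_u_def R_l_def by (auto intro: topology_generated_by_Basis)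
  ultimately show ?thesis by (simp add: openin_prod_Times_iff)
qed

theorem theorem3p16:
  fixes A :: "'h::chilbert_space op set" and a :: "'h op"
    and r s \<epsilon> :: real
    and Dhat Dhat_eps :: "('h op set \<times> ereal \<times> ereal) set"
  assumes "von_neumann_algebra A" and "a \<in> sa_part A" and "s < r" and "\<epsilon> > 0"
    and "Dhat = contexts A \<times> {..<ereal r} \<times> {ereal s<..}"
    and "Dhat_eps = contexts A \<times> {..<ereal (r + \<epsilon>)} \<times> {ereal (s - \<epsilon>)<..}"
  shows "openin (prod_topology (context_topology A) (prod_topology R_u R_l)) Dhat \<and>
         openin (prod_topology (context_topology A) (prod_topology R_u R_l)) Dhat_eps \<and>
         das_map A a -` Dhat \<inter> spectral_presheaf_space A
           \<subseteq> elementary_prop A a {..<r} \<inter> elementary_prop A a {s<..} \<and>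
         elementary_prop A a {..<r} \<inter> elementary_prop A a {s<..}
           \<subseteq> das_map A a -` Dhat_eps \<inter> spectral_presheaf_space A"
proof -
  have bounds: "(Re (l (inner_das A a C)) < r \<longrightarrow>
        l (outer_das_proj A (spectral_projection a {..<r}) C) = 1) \<and>
      (l (outer_das_proj A (spectral_projection a {..<r}) C) = 1 \<longrightarrow>
        Re (l (inner_das A a C)) \<le> r) \<and>
      (s < Re (l (outer_das A a C)) \<longrightarrow>
        l (outer_das_proj A (spectral_projection a {s<..}) C) = 1) \<and>
      (l (outer_das_proj A (spectral_projection a {s<..}) C) = 1 \<longrightarrow>
        s \<le> Re (l (outer_das A a C)))"
    if "(C, l) \<in> spectral_presheaf_space A" for C l
  proof -
    have "von_neumann_algebra C" "C \<subseteq> A" "l \<in> gelfand_spectrum C"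
      using that by (auto simp: spectral_presheaf_space_def contexts_def)
    then show ?thesis
      using outer_das_bounds[OF assms(1) _ _ assms(2)] inner_das_bounds[OF assms(1) _ _ assms(2)]
      by blast
  qed
  have "das_map A a -` Dhat \<inter> spectral_presheaf_space A
      \<subseteq> elementary_prop A a {..<r} \<inter> elementary_prop A a {s<..}"
    using bounds by (auto simp: das_map_def elementary_prop_def assms(5))
  moreover have "elementary_prop A a {..<r} \<inter> elementary_prop A a {s<..}
      \<subseteq> das_map A a -` Dhat_eps \<inter> spectral_presheaf_space A"
  proof
    fix z assume z: "z \<in> elementary_prop A a {..<r} \<inter> elementary_prop A a {s<..}"
    obtain C l where Cl: "z = (C, l)" by (cases z)
    have mem: "(C, l) \<in> spectral_presheaf_space A"
      using z by (simp add: Cl elementary_prop_def)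
    then have "C \<in> contexts A" by (simp add: spectral_presheaf_space_def)
    \<comment> \<open>Both bounds may be equalities; the margin \<open>\<epsilon>\<close> makes them
      strict below.\<close>
    moreover have "Re (l (inner_das A a C)) \<le> r" "s \<le> Re (l (outer_das A a C))"
      using z bounds[OF mem] by (auto simp: Cl elementary_prop_def)
    ultimately show "z \<in> das_map A a -` Dhat_eps \<inter> spectral_presheaf_space A"
      using mem \<open>\<epsilon> > 0\<close> by (simp add: Cl das_map_def assms(6))
  qed
  ultimately show ?thesis
    by (simp add: assms(5,6) openin_daseinisation_rectangle)
qed

end
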